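(* Let $\delta\in(0,10^{-2})$, let $l_1=\mathbb{R}\times\{0\}\times\{0\}$, $l_2=\{0\}\times\mathbb{R}\times\{\tfrac12\}$, $l_3=\{\tfrac12\}\times\{\tfrac12\}\times\mathbb{R}$, let $\mathcal{L}=\bigcup_{i=1}^3(l_i+\mathbb{Z}^3)\subset\mathbb{R}^3$, and let $U_\delta(\mathcal{L})$ be the Euclidean $\delta$-neighborhood of $\mathcal{L}$. Let $a:\mathbb{R}^3\to[\delta,1+\delta]$ be a smooth $\mathbb{Z}^3$-periodic function such that (i) $a\ge1$ outside $U_\delta(\mathcal{L})$ and $\min_{\mathbb{R}^3}a=\delta$; (ii) $a(y)=\delta$ if and only if $y\in\mathcal{L}$. Let $H(y,p)=\frac{1}{a(y)}|p|$ for $(y,p)\in\mathbb{R}^3\times\mathbb{R}^3$, and let $g$ be bounded and Lipschitz continuous on $\mathbb{R}^3$. For $\varepsilon>0$ let $u^\varepsilon$ be the viscosity solution of $u^\varepsilon_t+H(x/\varepsilon,Du^\varepsilon)=0$ in $\mathbb{R}^3\times(0,\infty)$, $u^\varepsilon(\cdot,0)=g$, and let $u$ be the viscosity solution of $u_t+\overline H(Du)=0$ in $\mathbb{R}^3\times(0,\infty)$, $u(\cdot,0)=g$, where $\overline H$ is the effective Hamiltonian of $H$. Then there is a constant $C$ depending only on $a$ and $\|Dg\|_{L^\infty(\mathbb{R}^3)}$ such that for every $\varepsilon>0$ $$\|u^\varepsilon-u\|_{L^\infty(\mathbb{R}^3\times[0,\infty))}\le C\varepsilon.$$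
   Context: $\mathbb{T}^3=\mathbb{R}^3/\mathbb{Z}^3$. The effective Hamiltonian $\overline H:\mathbb{R}^3\to\mathbb{R}$: for each $p\in\mathbb{R}^3$, $\overline H(p)$ is the unique constant such that the cell problem $H(y,p+Dv)=\overline H(p)$ in $\mathbb{T}^3$ has a continuous ($\mathbb{Z}^3$-periodic) viscosity solution $v$. "The viscosity solution" of each Cauchy problem means the unique viscosity solution that is Lipschitz continuous on $\mathbb{R}^3\times[0,\infty)$. *)

theory Defs
  imports "HOL-Analysis.Analysis" "HOL-Probability.Essential_Supremum"
begin

section \<open>Differentiability\<close>

fun C_k :: "nat \<Rightarrow> ('a::euclidean_space \<Rightarrow> real) \<Rightarrow> bool" where
  "C_k 0 f = continuous_on UNIV f"
| "C_k (Suc k) f = ((\<forall>x. f differentiable at x) \<and>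
     (\<forall>b\<in>Basis. C_k k (\<lambda>x. frechet_derivative f (at x) b)))"

definition smooth :: "('a::euclidean_space \<Rightarrow> real) \<Rightarrow> bool" where
  "smooth f \<longleftrightarrow> (\<forall>k. C_k k f)"

definition C1_with_gradient ::
    "'a::euclidean_space set \<Rightarrow> ('a \<Rightarrow> real) \<Rightarrow> ('a \<Rightarrow> 'a) \<Rightarrow> bool" where
  "C1_with_gradient \<Omega> \<phi> D\<phi> \<longleftrightarrow>
     (\<forall>z\<in>\<Omega>. GDERIV \<phi> z :> D\<phi> z) \<and> continuous_on \<Omega> D\<phi>"

definition gradient :: "('a::euclidean_space \<Rightarrow> real) \<Rightarrow> 'a \<Rightarrow> 'a" where
  "gradient f x = (THE d. GDERIV f x :> d)"

text \<open>The norm of \<open>Dg\<close> in \<open>L\<^sup>\<infinity>\<close>. For Lipschitz \<open>g\<close> the points of non-differentiability form a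
  null set (Rademacher), so the value \<open>\<infinity>\<close> chosen there does not influence the essential
  supremum, which is then finite.\<close>

definition gradient_Linf_norm :: "('a::euclidean_space \<Rightarrow> real) \<Rightarrow> ereal" where
  "gradient_Linf_norm g = esssup lebesgue
     (\<lambda>x. if g differentiable at x then ereal (norm (gradient g x)) else \<infinity>)"


section \<open>Viscosity solutions of first-order equations\<close>

text \<open>Equations \<open>F z (Dw z) = 0\<close> on an open set \<open>\<Omega>\<close>; the Hamiltonians considered here do not
  depend on the value of the unknown.\<close>

definition viscosity_subsolution ::
    "'a::euclidean_space set \<Rightarrow> ('a \<Rightarrow> 'a \<Rightarrow> real) \<Rightarrow> ('a \<Rightarrow> real) \<Rightarrow> bool" where
  "viscosity_subsolution \<Omega> F w \<longleftrightarrow>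
     (\<forall>\<phi> D\<phi>. \<forall>z\<in>\<Omega>. C1_with_gradient \<Omega> \<phi> D\<phi> \<longrightarrow>
        (\<forall>\<^sub>F y in at z within \<Omega>. w y - \<phi> y \<le> w z - \<phi> z) \<longrightarrow> F z (D\<phi> z) \<le> 0)"

definition viscosity_supersolution ::
    "'a::euclidean_space set \<Rightarrow> ('a \<Rightarrow> 'a \<Rightarrow> real) \<Rightarrow> ('a \<Rightarrow> real) \<Rightarrow> bool" where
  "viscosity_supersolution \<Omega> F w \<longleftrightarrow>
     (\<forall>\<phi> D\<phi>. \<forall>z\<in>\<Omega>. C1_with_gradient \<Omega> \<phi> D\<phi> \<longrightarrow>
        (\<forall>\<^sub>F y in at z within \<Omega>. w y - \<phi> y \<ge> w z - \<phi> z) \<longrightarrow> F z (D\<phi> z) \<ge> 0)"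

definition viscosity_solution ::
    "'a::euclidean_space set \<Rightarrow> ('a \<Rightarrow> 'a \<Rightarrow> real) \<Rightarrow> ('a \<Rightarrow> real) \<Rightarrow> bool" where
  "viscosity_solution \<Omega> F w \<longleftrightarrow>
     continuous_on \<Omega> w \<and> viscosity_subsolution \<Omega> F w \<and> viscosity_supersolution \<Omega> F w"

text \<open>Lipschitz viscosity solutions \<open>u (x, t)\<close> of \<open>u\<^sub>t + H x (Du) = 0\<close> for \<open>t > 0\<close>, with initial
  value \<open>g\<close>. The space-time gradient is the pair \<open>(Du, u\<^sub>t)\<close>.\<close>

definition Cauchy_viscosity_solution ::
    "('a::euclidean_space \<Rightarrow> 'a \<Rightarrow> real) \<Rightarrow> ('a \<Rightarrow> real) \<Rightarrow> ('a \<times> real \<Rightarrow> real) \<Rightarrow> bool" where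
  "Cauchy_viscosity_solution H g u \<longleftrightarrow>
     viscosity_solution (UNIV \<times> {0<..}) (\<lambda>(x, t) (q, s). s + H x q) u \<and>
     (\<forall>x. u (x, 0) = g x) \<and>
     (\<exists>K. K-lipschitz_on (UNIV \<times> {0..}) u)"


section \<open>Periodicity and the effective Hamiltonian\<close>

definition integer_lattice :: "(real ^ 'n) set" where
  "integer_lattice = {z. \<forall>i. z $ i \<in> \<int>}"

definition periodic :: "(real ^ 'n \<Rightarrow> real) \<Rightarrow> bool" where
  "periodic f \<longleftrightarrow> (\<forall>x. \<forall>z\<in>integer_lattice. f (x + z) = f x)"

text \<open>Functions on the torus are identified with periodic functions on the whole space.\<close>

definition cell_problem_solution ::
    "(real ^ 'n \<Rightarrow> real ^ 'n \<Rightarrow> real) \<Rightarrow> real ^ 'n \<Rightarrow> real \<Rightarrow> (real ^ 'n \<Rightarrow> real) \<Rightarrow> bool" where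
  "cell_problem_solution H p c v \<longleftrightarrow>
     periodic v \<and> viscosity_solution UNIV (\<lambda>y q. H y (p + q) - c) v"

definition effective_hamiltonian ::
    "(real ^ 'n \<Rightarrow> real ^ 'n \<Rightarrow> real) \<Rightarrow> real ^ 'n \<Rightarrow> real" where
  "effective_hamiltonian H p = (THE c. \<exists>v. cell_problem_solution H p c v)"


section \<open>The periodic family of lines\<close>

definition line1 :: "(real ^ 3) set" where
  "line1 = range (\<lambda>s. vector [s, 0, 0])"

definition line2 :: "(real ^ 3) set" where
  "line2 = range (\<lambda>s. vector [0, s, 1/2])"

definition line3 :: "(real ^ 3) set" where
  "line3 = range (\<lambda>s. vector [1/2, 1/2, s])"

definition lines :: "(real ^ 3) set" where
  "lines = (\<Union>l\<in>{line1, line2, line3}. \<Union>z\<in>integer_lattice. (\<lambda>x. x + z) ` l)"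

definition neighborhood :: "real \<Rightarrow> 'a::metric_space set \<Rightarrow> 'a set" where
  "neighborhood d S = (\<Union>x\<in>S. ball x d)"

end

theory Submission
  imports Defs
begin

text \<open>The effective Hamiltonian is \<open>\<bar>p\<bar>\<^sub>\<infinity> / \<delta>\<close>: information travels with speed \<open>1 / \<delta>\<close> along the lines,
  and the slow medium between them forbids shortcuts. The latter is witnessed by \<open>C\<^sup>1\<close> periodic
  perturbations \<open>h\<^sub>i\<close> of the coordinates that equal \<open>x\<^sub>i\<close> near the lines in direction \<open>i\<close>, are locally
  constant near the other lines, and have bounded gradients: every combination \<open>\<Sum> c\<^sub>i Dh\<^sub>i\<close> with
  \<open>\<bar>c\<^sub>i\<bar> \<le> M\<close> is bounded by \<open>M a / \<delta>\<close>. Hence \<open>\<Sum> p\<^sub>i h\<^sub>i\<close> is a smooth subsolution of the cell problem, and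
  a smoothed \<open>l\<^sup>1\<close> distance in the rescaled coordinates \<open>\<epsilon> h(x / \<epsilon>)\<close> bounds \<open>u\<^sup>\<epsilon>\<close> from below by the minimum
  of \<open>g\<close> over an \<open>l\<^sup>1\<close> ball of radius \<open>t / \<delta>\<close>, up to \<open>O(\<epsilon>)\<close>. Moving along lines gives the matching upper
  bound, and the same two bounds hold for \<open>u\<close>. All comparisons use a single smooth test function,
  so no doubling of variables is needed.\<close>

section \<open>Test function estimates for the Cauchy problem\<close>

text \<open>What shapes the proof is the need for three functions whose gradients together never
  exceed what the medium affords. The placement of the lines makes this possible. Two families of
  different directions are half a period apart in the remaining coordinate, so a periodic cut-off
  can tell them apart. On a line of another direction the coordinate \<open>x $ i\<close> is a fixed
  multiple of 1/2, so subtracting the signed distance to the nearest such multiple flattens it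
  there. Near a line only one gradient survives, a unit vector, which is just affordable where
  \<open>a \<ge> \<delta>\<close>. Elsewhere \<open>a \<ge> 1\<close> allows total size
  \<open>1 / \<delta> > 100\<close>, and crude constants fit. The smallness of
  \<open>\<delta>\<close> enters here and in keeping the neighbourhoods where the cut-offs are
  constant. The cell constant is pinned for every corrector: from above by testing with the smooth
  subsolution, from below by travelling one period along a line. Since
  \<open>effective_hamiltonian\<close> is a definite description, a corrector must also be
  exhibited, and this is what Perron's method is for.\<close>

lemma subsolution_decreasing_along_ray:
  fixes w :: "'a::euclidean_space \<times> real \<Rightarrow> real"
  assumes cont: "continuous_on (UNIV \<times> {0..}) w"
    and sub: "viscosity_subsolution (UNIV \<times> {0<..}) (\<lambda>(x, t) (q, s). s + H x q) w"
    and r: "r > 0"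
    and dir: "\<And>\<tau> x q. 0 \<le> \<tau> \<Longrightarrow> \<tau> \<le> T \<Longrightarrow> norm (x - (x1 + \<tau> *\<^sub>R b)) < r \<Longrightarrow> b \<bullet> q \<le> H x q"
    and T: "0 \<le> T" and t1: "0 \<le> t1"
  shows "w (x1 + T *\<^sub>R b, t1 + T) \<le> w (x1, t1)"
proof (rule ccontr)
  assume "\<not> ?thesis"
  then have neg: "w (x1, t1) < w (x1 + T *\<^sub>R b, t1 + T)" by simp
  then have "T \<noteq> 0" by auto
  with T have Tpos: "T > 0" by simp
  \<comment> \<open>In the frame moving with velocity \<open>b\<close> the claim reads
    \<open>W (0, T) \<le> W (0, 0)\<close>. At an interior maximum of the penalised
    \<open>W\<close>, the bound \<open>b \<bullet> q \<le> H x q\<close> compensates the drift part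
    of the time derivative, and the increasing time penalty makes the left-hand side of the equation
    positive.\<close>
  define W where "W = (\<lambda>(y, \<tau>). w (x1 + \<tau> *\<^sub>R b + y, t1 + \<tau>))"
  have contW: "continuous_on (S \<times> {0..T}) W" for S
    unfolding W_def case_prod_unfold
    by (rule continuous_on_compose2[OF cont]) (use t1 in \<open>auto intro!: continuous_intros\<close>)
  \<comment> \<open>Continuity moves the increase to a time before \<open>T\<close>, so that a
    penalty normalised at \<open>\<tau>1\<close> can exclude the final time.\<close>
  have "\<exists>\<tau>1. 0 < \<tau>1 \<and> \<tau>1 < T \<and> W (0, 0) < W (0, \<tau>1)"
  proof -
    have "continuous_on {0..T} (\<lambda>\<tau>. W (0, \<tau>))"
      by (rule continuous_on_compose2[OF contW[of UNIV]]) (auto intro!: continuous_intros)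
    then have "((\<lambda>\<tau>. W (0, \<tau>)) \<longlongrightarrow> W (0, T)) (at T within {0..T})"
      using Tpos by (simp add: continuous_on)
    then have "((\<lambda>\<tau>. W (0, \<tau>)) \<longlongrightarrow> W (0, T)) (at_left T)"
      using Tpos by (simp add: at_within_Icc_at_left)
    moreover have "W (0, 0) < W (0, T)" using neg by (simp add: W_def)
    ultimately have "\<forall>\<^sub>F \<tau> in at_left T. W (0, 0) < W (0, \<tau>)"
      by (rule order_tendstoD)
    moreover have "\<forall>\<^sub>F \<tau> in at_left T. 0 < \<tau> \<and> \<tau> < T"
      using eventually_at_left_real[OF Tpos] by (simp add: greaterThanLessThan_iff)
    ultimately have "\<forall>\<^sub>F \<tau> in at_left T. 0 < \<tau> \<and> \<tau> < T \<and> W (0, 0) < W (0, \<tau>)"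
      by eventually_elim auto
    then show ?thesis
      using eventually_happens'[OF trivial_limit_at_left_real[of T]] by blast
  qed
  then obtain \<tau>1 where \<tau>1: "0 < \<tau>1" "\<tau>1 < T" "W (0, 0) < W (0, \<tau>1)" by blast
  \<comment> \<open>One third of the increase: the penalised value at \<open>(0, \<tau>1)\<close> is
    still \<open>W (0, 0) + 2 * \<eta>\<close>, while at time 0 it is at most
    \<open>W (0, 0) + \<eta>\<close>.\<close>
  define \<eta> where "\<eta> = (W (0, \<tau>1) - W (0, 0)) / 3"
  have \<eta>: "\<eta> > 0" using \<tau>1 by (simp add: \<eta>_def)
  obtain \<rho> where \<rho>: "0 < \<rho>" "\<rho> < r" "\<And>y. norm y \<le> \<rho> \<Longrightarrow> W (y, 0) \<le> W (0, 0) + \<eta>"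
  proof -
    have "continuous_on UNIV (\<lambda>y. W (y, 0))"
      by (rule continuous_on_compose2[OF contW[of UNIV]]) (use T in \<open>auto intro!: continuous_intros\<close>)
    then have "isCont (\<lambda>y. W (y, 0)) 0" by (simp add: continuous_on_eq_continuous_at)
    then obtain d where d: "d > 0" "\<And>y. dist y 0 < d \<Longrightarrow> dist (W (y, 0)) (W (0, 0)) < \<eta>"
      unfolding continuous_at_eps_delta using \<eta> by metis
    show thesis
    proof (rule that[of "min d r / 2"])
      fix y :: 'a assume "norm y \<le> min d r / 2"
      then have "dist y 0 < d" using d(1) r by auto
      from d(2)[OF this] show "W (y, 0) \<le> W (0, 0) + \<eta>" by (auto simp: dist_real_def)
    qed (use d(1) r in auto)
  qed
  define Q where "Q = cball (0::'a) \<rho> \<times> {0..T}"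
  have cQ: "compact Q" by (simp add: Q_def compact_Times)
  have contQ: "continuous_on Q W" by (simp add: Q_def contW)
  obtain Wm where Wm: "\<And>z. z \<in> Q \<Longrightarrow> W z \<le> Wm"
  proof -
    have "Q \<noteq> {}" using \<rho> T by (auto simp: Q_def)
    from continuous_attains_sup[OF cQ this contQ] show thesis using that by blast
  qed
  obtain N where N: "0 < N" "Wm - N * \<rho>\<^sup>2 < W (0, \<tau>1) - \<eta>"
  proof (rule that[of "(\<bar>Wm\<bar> + \<bar>W (0, \<tau>1)\<bar> + \<eta> + 1) / \<rho>\<^sup>2"])
    show "Wm - (\<bar>Wm\<bar> + \<bar>W (0, \<tau>1)\<bar> + \<eta> + 1) / \<rho>\<^sup>2 * \<rho>\<^sup>2 < W (0, \<tau>1) - \<eta>"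
      using \<rho> by simp
  qed (use \<rho> \<eta> in \<open>auto intro!: divide_pos_pos add_nonneg_pos add_nonneg_nonneg\<close>)
  obtain n where n: "Wm - \<eta> * (T / \<tau>1) ^ Suc n < W (0, \<tau>1) - \<eta>"
  proof -
    have 1: "1 < T / \<tau>1" using \<tau>1 by simp
    obtain n where "(\<bar>Wm\<bar> + \<bar>W (0, \<tau>1)\<bar> + \<eta>) / \<eta> < (T / \<tau>1) ^ n"
      using real_arch_pow[OF 1] by blast
    also have "\<dots> \<le> (T / \<tau>1) ^ Suc n" using 1 by (intro power_increasing) auto
    finally have "\<bar>Wm\<bar> + \<bar>W (0, \<tau>1)\<bar> + \<eta> < \<eta> * (T / \<tau>1) ^ Suc n"
      using \<eta> by (simp add: field_simps)
    then show thesis by (intro that[of n]) linarith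
  qed
  \<comment> \<open>The power of \<open>\<tau> / \<tau>1\<close> is increasing and keeps the maximum away from the final time.\<close>
  define \<Phi> where "\<Phi> = (\<lambda>(y, \<tau>). W (y, \<tau>) - N * (y \<bullet> y) - \<eta> * (\<tau> / \<tau>1) ^ Suc n)"
  have "continuous_on Q \<Phi>"
    unfolding \<Phi>_def case_prod_unfold using contQ \<tau>1 by (auto intro!: continuous_intros)
  moreover have "Q \<noteq> {}" using \<rho> T by (auto simp: Q_def)
  ultimately obtain y0 \<tau>0 where mem: "(y0, \<tau>0) \<in> Q" and max: "\<And>z. z \<in> Q \<Longrightarrow> \<Phi> z \<le> \<Phi> (y0, \<tau>0)"
    using continuous_attains_sup[OF cQ] by (metis surj_pair)
  have val: "W (0, \<tau>1) - \<eta> \<le> \<Phi> (y0, \<tau>0)"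
  proof -
    have "(0, \<tau>1) \<in> Q" using \<rho> \<tau>1 by (simp add: Q_def)
    from max[OF this] show ?thesis using \<tau>1 by (simp add: \<Phi>_def)
  qed
  have \<Phi>_eq: "\<Phi> (y0, \<tau>0) = W (y0, \<tau>0) - N * (norm y0)\<^sup>2 - \<eta> * (\<tau>0 / \<tau>1) ^ Suc n"
    by (simp add: \<Phi>_def power2_norm_eq_inner)
  have N_nonneg: "0 \<le> N * (norm y0)\<^sup>2" using N by simp
  have t0: "0 \<le> \<tau>0" "\<tau>0 \<le> T" and y0: "norm y0 \<le> \<rho>" using mem by (auto simp: Q_def)
  have "\<tau>0 \<noteq> 0"
  proof
    assume "\<tau>0 = 0"
    then have "\<Phi> (y0, \<tau>0) \<le> W (0, 0) + \<eta>"
      using \<rho>(3)[OF y0] N_nonneg unfolding \<Phi>_eq by (simp del: zero_le_mult_iff)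
    with val \<eta> show False by (simp add: \<eta>_def field_simps)
  qed
  moreover have "\<tau>0 \<noteq> T"
  proof
    assume "\<tau>0 = T"
    then have "\<Phi> (y0, \<tau>0) \<le> Wm - \<eta> * (T / \<tau>1) ^ Suc n"
      using Wm[OF mem] N_nonneg unfolding \<Phi>_eq by (simp del: zero_le_mult_iff)
    with val n show False by linarith
  qed
  moreover have "norm y0 \<noteq> \<rho>"
  proof
    assume "norm y0 = \<rho>"
    moreover have "0 \<le> \<eta> * (\<tau>0 / \<tau>1) ^ Suc n" using \<eta> t0 \<tau>1 by simp
    ultimately have "\<Phi> (y0, \<tau>0) \<le> Wm - N * \<rho>\<^sup>2"
      using Wm[OF mem] unfolding \<Phi>_eq by (simp del: power_Suc)
    with val N show False by linarith
  qed
  ultimately have int: "0 < \<tau>0" "\<tau>0 < T" "norm y0 < \<rho>" using t0 y0 by auto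
  define z0 where "z0 = (x1 + \<tau>0 *\<^sub>R b + y0, t1 + \<tau>0)"
  define \<phi> where "\<phi> = (\<lambda>z. N * ((fst z - x1 - (snd z - t1) *\<^sub>R b) \<bullet> (fst z - x1 - (snd z - t1) *\<^sub>R b))
      + \<eta> * ((snd z - t1) / \<tau>1) ^ Suc n)"
  define D\<phi> where "D\<phi> = (\<lambda>z. ((2 * N) *\<^sub>R (fst z - x1 - (snd z - t1) *\<^sub>R b),
      - (2 * N) * (b \<bullet> (fst z - x1 - (snd z - t1) *\<^sub>R b))
      + \<eta> * (real (Suc n) * ((snd z - t1) / \<tau>1) ^ n / \<tau>1)))"
  have grad: "C1_with_gradient (UNIV \<times> {0<..}) \<phi> D\<phi>"
    unfolding C1_with_gradient_def
  proof (intro conjI ballI)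
    show "GDERIV \<phi> z :> D\<phi> z" for z
      unfolding gderiv_def \<phi>_def D\<phi>_def
      apply (rule derivative_eq_intros refl)+
      using \<tau>1 apply simp
      apply (rule derivative_eq_intros refl)+
      apply (rule ext)
      using \<tau>1 apply (simp add: inner_prod_def field_simps)
      apply (simp add: algebra_simps inner_commute)
      done
    show "continuous_on (UNIV \<times> {0<..}) D\<phi>"
      unfolding D\<phi>_def using \<tau>1 by (intro continuous_intros) auto
  qed
  have z0: "z0 \<in> UNIV \<times> {0<..}" using int t1 by (simp add: z0_def)
  define V where "V = {z. norm (fst z - x1 - (snd z - t1) *\<^sub>R b) < \<rho> \<and> 0 < snd z - t1 \<and> snd z - t1 < T}"
  have "open V" unfolding V_def
    by (intro open_Collect_conj open_Collect_less) (auto intro!: continuous_intros)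
  moreover have "z0 \<in> V" using int by (simp add: V_def z0_def)
  ultimately have "\<forall>\<^sub>F z in at z0 within UNIV \<times> {0<..}. z \<in> V"
    unfolding eventually_at_topological by blast
  then have "\<forall>\<^sub>F z in at z0 within UNIV \<times> {0<..}. w z - \<phi> z \<le> w z0 - \<phi> z0"
  proof eventually_elim
    case (elim z)
    then have "(fst z - x1 - (snd z - t1) *\<^sub>R b, snd z - t1) \<in> Q" by (auto simp: Q_def V_def)
    from max[OF this] show ?case
      by (simp add: \<Phi>_def W_def \<phi>_def z0_def diff_diff_eq)
  qed
  with sub grad z0 have le: "(case z0 of (x, t) \<Rightarrow> \<lambda>(q, s). s + H x q) (D\<phi> z0) \<le> 0"
    unfolding viscosity_subsolution_def by blast
  have D: "D\<phi> (x1 + \<tau>0 *\<^sub>R b + y0, t1 + \<tau>0) = ((2 * N) *\<^sub>R y0, - (2 * N) * (b \<bullet> y0) + \<eta> * (real (Suc n) * (\<tau>0 / \<tau>1) ^ n / \<tau>1))"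
    by (simp add: D\<phi>_def)
  have "b \<bullet> ((2 * N) *\<^sub>R y0) \<le> H (x1 + \<tau>0 *\<^sub>R b + y0) ((2 * N) *\<^sub>R y0)"
    by (rule dir[of \<tau>0]) (use int \<rho> in auto)
  moreover have "0 < \<eta> * (real (Suc n) * (\<tau>0 / \<tau>1) ^ n / \<tau>1)"
    using \<eta> int \<tau>1 by (intro mult_pos_pos divide_pos_pos zero_less_power) auto
  ultimately show False using le unfolding z0_def by (simp add: D)
qed

text \<open>For nondecreasing \<open>\<theta>\<close> the function
  \<open>- \<theta> (D x + t - t0)\<close> is a subsolution, by the assumption on \<open>H\<close>
  with \<open>c\<close> the derivative of \<open>\<theta>\<close>. Hence
  \<open>w + \<theta> (D x + t - t0)\<close>, slightly penalised, attains its minimum at time 0,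
  where \<open>B\<close> bounds it. The choice of \<open>\<theta>\<close> is a smoothed
  \<open>k * max 0 r\<close>; smoothing and penalty disappear as \<open>\<kappa>\<close> tends to
  0.\<close>

lemma supersolution_lower_bound:
  fixes w :: "'a::euclidean_space \<times> real \<Rightarrow> real"
  assumes cont: "continuous_on (UNIV \<times> {0..}) w"
    and super: "viscosity_supersolution (UNIV \<times> {0<..}) (\<lambda>(x, t) (q, s). s + H x q) w"
    and lb: "\<And>x t. 0 \<le> t \<Longrightarrow> - G - K * t \<le> w (x, t)"
    and D: "C1_with_gradient UNIV D D'" "\<And>x. 0 \<le> D x"
    and coercive: "\<alpha> > 0" "\<And>x. \<alpha> * norm (x - x0) - \<beta> \<le> D x"
    and H: "\<And>x c. 0 \<le> c \<Longrightarrow> H x (- (c *\<^sub>R D' x)) \<le> c"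
    and k: "k > 0" and t0: "0 \<le> t0"
    and B: "\<And>x. B \<le> w (x, 0) + k * max 0 (D x - t0)"
  shows "B \<le> w (x0, t0) + k * D x0"
proof -
  have approx: "B \<le> w (x0, t0) + k * (D x0 + \<kappa>) + \<kappa> * (t0 + t0\<^sup>2)" if \<kappa>: "\<kappa> > 0" for \<kappa>
  proof (rule ccontr)
    assume neg: "\<not> ?thesis"
    \<comment> \<open>A smooth majorant of \<open>k * max 0 r\<close> that overshoots it by at most
      \<open>k * \<kappa>\<close> for \<open>r \<ge> 0\<close>.\<close>
    define \<theta> where "\<theta> = (\<lambda>r::real. k * (r + sqrt (\<kappa>\<^sup>2 + r\<^sup>2)) / 2)"
    have sqrt_ge: "\<bar>r\<bar> < sqrt (\<kappa>\<^sup>2 + r\<^sup>2)" for r :: real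
      using \<kappa> by (intro real_less_rsqrt) simp
    have sqrt_le: "sqrt (\<kappa>\<^sup>2 + r\<^sup>2) \<le> \<kappa> + \<bar>r\<bar>" for r :: real
      using \<kappa> sqrt_sum_squares_le_sum_abs[of \<kappa> r] by simp
    have \<theta>_ge: "k * max 0 r \<le> \<theta> r" for r
    proof -
      have "2 * max 0 r \<le> r + sqrt (\<kappa>\<^sup>2 + r\<^sup>2)" using sqrt_ge[of r] by (auto simp: max_def)
      from mult_left_mono[OF this less_imp_le[OF k]] show ?thesis by (simp add: \<theta>_def)
    qed
    have \<theta>_le: "\<theta> r \<le> k * (r + \<kappa>)" if "0 \<le> r" for r
    proof -
      have "r + sqrt (\<kappa>\<^sup>2 + r\<^sup>2) \<le> 2 * (r + \<kappa>)" using sqrt_le[of r] that \<kappa> by auto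
      from mult_left_mono[OF this less_imp_le[OF k]] show ?thesis by (simp add: \<theta>_def algebra_simps)
    qed
    define \<psi> where "\<psi> = (\<lambda>r::real. k * (1 + r / sqrt (\<kappa>\<^sup>2 + r\<^sup>2)) / 2)"
    have pos: "0 < \<kappa>\<^sup>2 + r\<^sup>2" for r :: real using \<kappa> by (intro add_pos_nonneg) auto
    have \<psi>_nonneg: "0 \<le> \<psi> r" for r
    proof -
      have "\<bar>r / sqrt (\<kappa>\<^sup>2 + r\<^sup>2)\<bar> \<le> 1"
        using sqrt_ge[of r] pos[of r] by (simp add: divide_le_eq_1)
      then have "0 \<le> 1 + r / sqrt (\<kappa>\<^sup>2 + r\<^sup>2)" by linarith
      then show ?thesis using k unfolding \<psi>_def by (intro divide_nonneg_pos mult_nonneg_nonneg) auto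
    qed
    have \<theta>_deriv: "(\<theta> has_real_derivative \<psi> r) (at r)" for r
      unfolding \<theta>_def \<psi>_def using pos[of r]
      by (auto intro!: derivative_eq_intros simp: divide_simps)
    have \<theta>_cont: "continuous_on S \<theta>" for S
      unfolding \<theta>_def by (intro continuous_intros) auto
    have D_cont: "continuous_on S D" for S
      using D(1) unfolding C1_with_gradient_def gderiv_def
      by (meson UNIV_I continuous_at_imp_continuous_on has_derivative_continuous)
    \<comment> \<open>The terms in \<open>\<kappa>\<close> make the comparison function a strict
      subsolution. The square also beats the lower bound of \<open>w\<close>, which decreases at
      most linearly in time, so the minimum is attained.\<close>
    define \<Psi> where "\<Psi> = (\<lambda>(x, t). w (x, t) + \<theta> (D x + t - t0) + \<kappa> * (t + t\<^sup>2))"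
    define V where "V = \<Psi> (x0, t0)"
    have VB: "V < B"
      using \<theta>_le[OF D(2)[of x0]] neg by (simp add: V_def \<Psi>_def)
    \<comment> \<open>Beyond time \<open>R\<close> the quadratic penalty dominates; before it, the
      growth of \<open>D\<close> confines minimisers to radius \<open>R'\<close>.\<close>
    define R where "R = (\<bar>V\<bar> + \<bar>G\<bar> + \<bar>K\<bar>) / \<kappa> + 1 + t0"
    define R' where "R' = (\<bar>t0\<bar> + (\<bar>V\<bar> + \<bar>G\<bar> + \<bar>K\<bar> * R) / k + \<bar>\<beta>\<bar>) / \<alpha>"
    have R: "0 \<le> R" "t0 \<le> R" using \<kappa> t0 by (auto simp: R_def)
    have R': "0 \<le> R'" using k coercive R by (simp add: R'_def)
    have outside: "V < \<Psi> (x, t)" if t: "0 \<le> t" and out: "\<not> (norm (x - x0) \<le> R' \<and> t \<le> R)" for x t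
    proof (cases "t \<le> R")
      case True
      with out have "R' < norm (x - x0)" by simp
      then have "R' * \<alpha> < \<alpha> * norm (x - x0)" using coercive(1) by (simp add: mult.commute)
      also have "\<dots> \<le> D x + \<beta>" using coercive(2)[of x] by simp
      finally have "t0 + (\<bar>V\<bar> + \<bar>G\<bar> + \<bar>K\<bar> * R) / k < D x"
        using coercive(1) by (simp add: R'_def)
      then have "(\<bar>V\<bar> + \<bar>G\<bar> + \<bar>K\<bar> * R) / k < D x + t - t0" using t by simp
      then have "\<bar>V\<bar> + \<bar>G\<bar> + \<bar>K\<bar> * R < k * (D x + t - t0)" using k by (simp add: field_simps)
      also have "\<dots> \<le> \<theta> (D x + t - t0)"
        using \<theta>_ge[of "D x + t - t0"] k by (smt (verit) mult_left_mono)
      finally have "\<bar>V\<bar> + \<bar>G\<bar> + \<bar>K\<bar> * R < \<theta> (D x + t - t0)" .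
      moreover have "K * t \<le> \<bar>K\<bar> * R" using t True by (intro mult_mono) auto
      moreover have "0 \<le> \<kappa> * (t + t\<^sup>2)" using \<kappa> t by simp
      ultimately show ?thesis using lb[OF t, of x] unfolding \<Psi>_def by simp
    next
      case False
      then have tR: "R < t" by simp
      then have t1: "1 \<le> t" using \<kappa> t0 unfolding R_def
        by (smt (verit) abs_ge_zero divide_nonneg_pos)
      have "(\<bar>V\<bar> + \<bar>G\<bar> + \<bar>K\<bar>) / \<kappa> \<le> t" using tR t0 by (simp add: R_def)
      then have "\<bar>V\<bar> + \<bar>G\<bar> + \<bar>K\<bar> \<le> \<kappa> * t" using \<kappa> by (simp add: field_simps)
      then have "(\<bar>V\<bar> + \<bar>G\<bar> + \<bar>K\<bar>) * t \<le> \<kappa> * t * t" using t by (intro mult_right_mono) auto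
      moreover have "\<bar>V\<bar> + \<bar>G\<bar> \<le> (\<bar>V\<bar> + \<bar>G\<bar>) * t" using t1 by (simp add: mult_le_cancel_left1)
      moreover have "K * t \<le> \<bar>K\<bar> * t" using t by (intro mult_right_mono) auto
      ultimately have "\<bar>V\<bar> + \<bar>G\<bar> + K * t \<le> \<kappa> * t\<^sup>2" by (simp add: algebra_simps power2_eq_square)
      moreover have "0 < \<kappa> * t" using \<kappa> t1 by simp
      moreover have "0 \<le> \<theta> (D x + t - t0)" using \<theta>_ge[of "D x + t - t0"] k
        by (smt (verit) max.cobounded1 mult_nonneg_nonneg)
      ultimately show ?thesis using lb[OF t, of x] unfolding \<Psi>_def by (simp add: algebra_simps)
    qed
    define Q where "Q = cball x0 R' \<times> {0..R}"
    have "compact Q" by (simp add: Q_def compact_Times)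
    moreover have memQ: "(x0, t0) \<in> Q" using R R' t0 by (simp add: Q_def)
    moreover have "continuous_on Q \<Psi>"
      unfolding \<Psi>_def case_prod_unfold
      by (intro continuous_intros continuous_on_compose2[OF \<theta>_cont[of UNIV]]
          continuous_on_compose2[OF cont] continuous_on_compose2[OF D_cont[of UNIV]])
        (auto simp: Q_def)
    ultimately obtain x1 t1 where m1: "(x1, t1) \<in> Q" and min1: "\<And>z. z \<in> Q \<Longrightarrow> \<Psi> (x1, t1) \<le> \<Psi> z"
      using continuous_attains_inf[of Q \<Psi>] by (metis empty_iff surj_pair)
    have leV: "\<Psi> (x1, t1) \<le> V" using min1[OF memQ] by (simp add: V_def)
    have t1: "0 \<le> t1" using m1 by (simp add: Q_def)
    have min: "\<Psi> (x1, t1) \<le> \<Psi> (x, t)" if "0 \<le> t" for x t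
    proof (cases "(x, t) \<in> Q")
      case False
      then have "V < \<Psi> (x, t)" using that by (intro outside) (auto simp: Q_def dist_norm norm_minus_commute)
      with leV show ?thesis by simp
    qed (rule min1)
    have "t1 \<noteq> 0"
    proof
      assume "t1 = 0"
      then have "w (x1, 0) + k * max 0 (D x1 - t0) \<le> \<Psi> (x1, t1)"
        using \<theta>_ge[of "D x1 - t0"] by (simp add: \<Psi>_def)
      with leV B[of x1] VB show False by linarith
    qed
    with t1 have t1: "0 < t1" by simp
    define \<phi> where "\<phi> = (\<lambda>z. - \<theta> (D (fst z) + snd z - t0) - \<kappa> * (snd z + (snd z)\<^sup>2))"
    define D\<phi> where "D\<phi> = (\<lambda>z. (- (\<psi> (D (fst z) + snd z - t0) *\<^sub>R D' (fst z)),
        - \<psi> (D (fst z) + snd z - t0) - \<kappa> * (1 + 2 * snd z)))"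
    have "C1_with_gradient (UNIV \<times> {0<..}) \<phi> D\<phi>"
      unfolding C1_with_gradient_def
    proof (intro conjI ballI)
      fix z :: "'a \<times> real"
      have "(D has_derivative (\<lambda>h. h \<bullet> D' (fst z))) (at (fst z))"
        using D(1) by (simp add: C1_with_gradient_def gderiv_def)
      then have D_fst: "((\<lambda>z. D (fst z)) has_derivative (\<lambda>h. fst h \<bullet> D' (fst z))) (at z)"
        by (rule has_derivative_compose[OF has_derivative_fst[OF has_derivative_ident]])
      have "((\<lambda>z. D (fst z) + snd z - t0) has_derivative (\<lambda>h. fst h \<bullet> D' (fst z) + snd h)) (at z)"
        by (auto intro!: derivative_eq_intros D_fst)
      from has_derivative_compose[OF this \<theta>_deriv[unfolded has_field_derivative_def]]
      have "((\<lambda>z. \<theta> (D (fst z) + snd z - t0)) has_derivative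
          (\<lambda>h. \<psi> (D (fst z) + snd z - t0) * (fst h \<bullet> D' (fst z) + snd h))) (at z)" by simp
      then show "GDERIV \<phi> z :> D\<phi> z"
        unfolding gderiv_def \<phi>_def D\<phi>_def
        by (auto intro!: derivative_eq_intros simp: inner_prod_def algebra_simps)
    next
      have cont_\<psi>: "continuous_on UNIV \<psi>" unfolding \<psi>_def using pos
        by (intro continuous_intros) (auto simp: less_imp_neq[THEN not_sym])
      have cont_D': "continuous_on UNIV D'" using D(1) by (simp add: C1_with_gradient_def)
      have cont_fst: "continuous_on UNIV (fst :: 'a \<times> real \<Rightarrow> 'a)" by (intro continuous_intros)
      have "continuous_on UNIV (\<lambda>z::'a \<times> real. D (fst z))"
        by (rule continuous_on_compose2[OF D_cont[of UNIV] cont_fst]) simp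
      then have cont_arg: "continuous_on UNIV (\<lambda>z::'a \<times> real. D (fst z) + snd z - t0)"
        by (intro continuous_intros)
      have "continuous_on UNIV (\<lambda>z::'a \<times> real. \<psi> (D (fst z) + snd z - t0))"
        by (rule continuous_on_compose2[OF cont_\<psi> cont_arg]) simp
      moreover have "continuous_on UNIV (\<lambda>z::'a \<times> real. D' (fst z))"
        by (rule continuous_on_compose2[OF cont_D' cont_fst]) simp
      ultimately have "continuous_on UNIV D\<phi>"
        unfolding D\<phi>_def by (intro continuous_intros)
      then show "continuous_on (UNIV \<times> {0<..}) D\<phi>"
        by (rule continuous_on_subset) simp
    qed
    moreover have "\<forall>\<^sub>F z in at (x1, t1) within UNIV \<times> {0<..}. w z - \<phi> z \<ge> w (x1, t1) - \<phi> (x1, t1)"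
      unfolding eventually_at_filter using min
      by (intro always_eventually) (auto simp: \<Psi>_def \<phi>_def algebra_simps)
    moreover have "(x1, t1) \<in> UNIV \<times> {0<..}" using t1 by simp
    ultimately have "(case (x1, t1) of (x, t) \<Rightarrow> \<lambda>(q, s). s + H x q) (D\<phi> (x1, t1)) \<ge> 0"
      using super unfolding viscosity_supersolution_def by blast
    moreover have "H x1 (- (\<psi> (D x1 + t1 - t0) *\<^sub>R D' x1)) \<le> \<psi> (D x1 + t1 - t0)"
      by (rule H[OF \<psi>_nonneg])
    moreover have "0 < \<kappa> * (1 + 2 * t1)" using \<kappa> t1 by simp
    ultimately show False by (simp add: D\<phi>_def)
  qed
  show ?thesis
  proof (rule field_le_epsilon)
    fix e :: real assume e: "0 < e"
    \<comment> \<open>The total coefficient of \<open>\<kappa>\<close> in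
      \<open>approx\<close>.\<close>
    define M where "M = k + t0 + t0\<^sup>2"
    have M: "M > 0" using k t0 by (simp add: M_def add_pos_nonneg)
    have "B \<le> w (x0, t0) + k * (D x0 + e / M) + e / M * (t0 + t0\<^sup>2)"
      by (rule approx) (use e M in simp)
    also have "\<dots> = w (x0, t0) + k * D x0 + e / M * M" by (simp add: M_def algebra_simps flip: add_divide_distrib)
    finally show "B \<le> w (x0, t0) + k * D x0 + e" using M by simp
  qed
qed

section \<open>Lipschitz functions and the essential supremum of the gradient\<close>

text \<open>Justifies the definite description in \<open>gradient\<close>: the representing vector
  exists by expansion in the basis and is unique.\<close>

lemma GDERIV_gradient:
  assumes "g differentiable at x"
  shows "GDERIV g x :> gradient g x"
proof -
  obtain g' where g': "(g has_derivative g') (at x)"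
    using assms by (auto simp: differentiable_def)
  then have lin: "linear g'" by (rule has_derivative_linear)
  have "g' h = h \<bullet> (\<Sum>b\<in>Basis. g' b *\<^sub>R b)" for h
  proof -
    have "g' h = g' (\<Sum>b\<in>Basis. (h \<bullet> b) *\<^sub>R b)" by (simp add: euclidean_representation)
    also have "\<dots> = (\<Sum>b\<in>Basis. (h \<bullet> b) * g' b)"
      using lin by (simp add: linear_sum linear_cmul)
    finally show ?thesis by (simp add: inner_sum_right mult.commute)
  qed
  then have g'_eq: "g' = (\<lambda>h. h \<bullet> (\<Sum>b\<in>Basis. g' b *\<^sub>R b))" by blast
  have "GDERIV g x :> (\<Sum>b\<in>Basis. g' b *\<^sub>R b)"
    unfolding gderiv_def using g' g'_eq by simp
  moreover have "d = d'" if "GDERIV g x :> d" "GDERIV g x :> d'" for d d'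
  proof -
    have "(\<lambda>h. h \<bullet> d) = (\<lambda>h. h \<bullet> d')"
      using that unfolding gderiv_def by (rule has_derivative_unique)
    then have "(d - d') \<bullet> (d - d') = 0" by (metis inner_diff_right right_minus_eq)
    then show ?thesis by simp
  qed
  ultimately show ?thesis unfolding gradient_def by (metis theI)
qed

lemma AE_lborel_translation:
  fixes p :: "'a::euclidean_space"
  assumes "AE z in lebesgue. P z"
  shows "AE z in lborel. P (p + z)"
proof -
  have "AE z in lborel. P z" using assms by (simp add: AE_completion_iff)
  then have "AE z in distr lborel borel ((+) p). P z" by (subst lborel_distr_plus)
  then show ?thesis by (rule AE_distrD[rotated]) simp
qed

text \<open>Averaging over small balls reduces the claim to a mean value estimate along a segment: the
  averaged function is differentiable, and its derivative is the average of the derivatives of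
  \<open>g\<close>, which exist almost everywhere.\<close>

lemma lipschitz_gradient_Linf_norm:
  fixes g :: "'a::euclidean_space \<Rightarrow> real"
  assumes lip: "K-lipschitz_on UNIV g" and L: "gradient_Linf_norm g = ereal L"
  shows "\<bar>g x - g y\<bar> \<le> L * norm (x - y)"
proof -
  define v where "v = y - x"
  have K: "\<bar>g p - g q\<bar> \<le> K * norm (p - q)" for p q
    using lipschitz_onD[OF lip, of p q] by (simp add: dist_norm)
  have K0: "0 \<le> K" by (rule lipschitz_on_nonneg[OF lip])
  have "continuous_on UNIV g" by (rule lipschitz_on_continuous_on[OF lip])
  then have [measurable]: "g \<in> borel_measurable borel" by (rule borel_measurable_continuous_onI)
  \<comment> \<open>Points without derivative carry the value \<open>\<infinity>\<close> in the
    essential supremum, so its finiteness already contains differentiability almost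
    everywhere.\<close>
  have AE: "AE z in lebesgue. g differentiable at z \<and> norm (gradient g z) \<le> L"
    using esssup_AE[where M = lebesgue and
        f = "\<lambda>x. if g differentiable at x then ereal (norm (gradient g x)) else \<infinity>"]
    unfolding gradient_Linf_norm_def[symmetric] L
    by eventually_elim (auto split: if_splits)
  have approx: "\<bar>g x - g y\<bar> \<le> L * norm v + 2 * K * r" if r: "r > 0" for r
  proof -
    define vol where "vol = measure lborel (cball (0::'a) r)"
    have vol: "vol > 0" using r by (simp add: vol_def content_cball_pos)
    define I where "I = (\<lambda>z::'a. indicator (cball 0 r) z :: real)"
    have I_int: "integrable lborel I" unfolding I_def
      using emeasure_lborel_cball_finite[of "0::'a" r] by (intro integrable_real_indicator) auto
    have I_meas [measurable]: "I \<in> borel_measurable borel" unfolding I_def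
      by (intro borel_measurable_indicator borel_closed closed_cball)
    have I_integral: "integral\<^sup>L lborel (\<lambda>z. c * I z) = c * vol" for c
      by (simp add: I_def vol_def)
    have I0: "0 \<le> I z" for z by (simp add: I_def)
    have I_bounded: "integrable lborel (\<lambda>z. I z * f z)"
      if [measurable]: "f \<in> borel_measurable borel" and c: "\<And>z. norm z \<le> r \<Longrightarrow> \<bar>f z\<bar> \<le> c" for f c
    proof (rule Bochner_Integration.integrable_bound[where f = "\<lambda>z. c * I z"])
      show "AE z in lborel. norm (I z * f z) \<le> norm (c * I z)"
        by (intro AE_I2) (auto simp: I_def indicator_def intro: order_trans[OF c abs_ge_self])
    qed (use I_int in auto)
    \<comment> \<open>Up to the factor \<open>vol\<close>, the mean of \<open>g\<close> over the
      ball centred at \<open>x + s *\<^sub>R v\<close>.\<close>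
    define F where "F = (\<lambda>s. integral\<^sup>L lborel (\<lambda>z. I z * g (x + s *\<^sub>R v + z)))"
    have F_int: "integrable lborel (\<lambda>z. I z * g (p + z))" for p
    proof (rule I_bounded)
      fix z :: 'a assume "norm z \<le> r"
      then have "K * norm z \<le> K * r" using K0 by (rule mult_left_mono)
      with K[of "p + z" p] show "\<bar>g (p + z)\<bar> \<le> \<bar>g p\<bar> + K * r" by simp
    qed simp
    have deriv: "\<exists>d. (F has_real_derivative d) (at s) \<and> \<bar>d\<bar> \<le> L * norm v * vol" for s
    proof -
      define q where "q = (\<lambda>h z. (g (x + s *\<^sub>R v + z + h *\<^sub>R v) - g (x + s *\<^sub>R v + z)) / h)"
      have [measurable]: "q h \<in> borel_measurable borel" for h unfolding q_def by measurable
      \<comment> \<open>Taking the limit along one fixed sequence gives a measurable function;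
        wherever \<open>g\<close> is differentiable it is the derivative in direction
        \<open>v\<close>.\<close>
      define f where "f = (\<lambda>z. lim (\<lambda>n. q (inverse (real (Suc n))) z))"
      have [measurable]: "f \<in> borel_measurable borel"
        unfolding f_def by (rule borel_measurable_lim_metric) measurable
      have qK: "\<bar>q h z\<bar> \<le> K * norm v" for h z
      proof (cases "h = 0")
        case False
        have "\<bar>g (x + s *\<^sub>R v + z + h *\<^sub>R v) - g (x + s *\<^sub>R v + z)\<bar> \<le> K * (\<bar>h\<bar> * norm v)"
          using K[of "x + s *\<^sub>R v + z + h *\<^sub>R v" "x + s *\<^sub>R v + z"] by simp
        then show ?thesis using False by (simp add: q_def field_simps)
      qed (use K0 in \<open>simp add: q_def\<close>)
      have conv: "AE z in lborel. (\<forall>h. (\<forall>n. h n \<noteq> 0) \<and> h \<longlonglongrightarrow> 0 \<longrightarrow> (\<lambda>n. q (h n) z) \<longlonglongrightarrow> f z)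
          \<and> \<bar>f z\<bar> \<le> L * norm v"
        using AE_lborel_translation[OF AE, of "x + s *\<^sub>R v"]
      proof eventually_elim
        case (elim z)
        define p where "p = x + s *\<^sub>R v + z"
        have "(g has_derivative (\<lambda>h. h \<bullet> gradient g p)) (at p)"
          using elim GDERIV_gradient[of g p] by (simp add: p_def gderiv_def)
        then have gd: "(g has_derivative (\<lambda>h. h \<bullet> gradient g p)) (at (p + 0 *\<^sub>R v))" by simp
        have "((\<lambda>h. p + h *\<^sub>R v) has_derivative (\<lambda>h. h *\<^sub>R v)) (at 0)"
          by (auto intro!: derivative_eq_intros)
        from has_derivative_compose[OF this gd]
        have "((\<lambda>h. g (p + h *\<^sub>R v)) has_real_derivative (v \<bullet> gradient g p)) (at 0)"
          by (simp add: has_field_derivative_def mult_commute_abs)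
        then have lim: "((\<lambda>h. q h z) \<longlongrightarrow> v \<bullet> gradient g p) (at 0)"
          by (simp add: DERIV_def q_def p_def)
        have seq: "(\<lambda>n. q (h n) z) \<longlonglongrightarrow> v \<bullet> gradient g p" if "\<forall>n. h n \<noteq> 0" "h \<longlonglongrightarrow> 0" for h
          using lim that by (auto simp: tendsto_at_iff_sequentially o_def)
        have "f z = v \<bullet> gradient g p"
          unfolding f_def by (rule limI[OF seq]) (simp, rule LIMSEQ_inverse_real_of_nat)
        moreover have "\<bar>v \<bullet> gradient g p\<bar> \<le> norm v * norm (gradient g p)"
          by (rule Cauchy_Schwarz_ineq2)
        moreover have "norm v * norm (gradient g p) \<le> norm v * L"
          using elim by (intro mult_left_mono) (auto simp: p_def)
        ultimately show ?case using seq by (simp add: mult.commute)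
      qed
      define d where "d = integral\<^sup>L lborel (\<lambda>z. I z * f z)"
      have quot: "(F (s + h) - F s) / h = integral\<^sup>L lborel (\<lambda>z. I z * q h z)" for h
      proof -
        have "F (s + h) - F s = integral\<^sup>L lborel
            (\<lambda>z. I z * g (x + (s + h) *\<^sub>R v + z) - I z * g (x + s *\<^sub>R v + z))"
          unfolding F_def by (rule Bochner_Integration.integral_diff[symmetric]) (rule F_int)+
        then have "(F (s + h) - F s) / h = integral\<^sup>L lborel
            (\<lambda>z. (I z * g (x + (s + h) *\<^sub>R v + z) - I z * g (x + s *\<^sub>R v + z)) / h)" by simp
        also have "\<dots> = integral\<^sup>L lborel (\<lambda>z. I z * q h z)"
          by (intro Bochner_Integration.integral_cong refl)
            (simp add: q_def algebra_simps diff_divide_distrib)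
        finally show ?thesis .
      qed
      have "((\<lambda>h. (F (s + h) - F s) / h) \<longlongrightarrow> d) (at 0)"
        unfolding quot d_def tendsto_at_iff_sequentially o_def
      proof (intro allI impI)
        fix h :: "nat \<Rightarrow> real" assume h: "\<forall>n. h n \<in> UNIV - {0}" "h \<longlonglongrightarrow> 0"
        show "(\<lambda>n. integral\<^sup>L lborel (\<lambda>z. I z * q (h n) z)) \<longlonglongrightarrow> integral\<^sup>L lborel (\<lambda>z. I z * f z)"
        proof (rule integral_dominated_convergence[where w = "\<lambda>z. K * norm v * I z"])
          show "AE z in lborel. (\<lambda>n. I z * q (h n) z) \<longlonglongrightarrow> I z * f z"
            using conv by eventually_elim (use h in \<open>auto intro!: tendsto_mult\<close>)
          show "AE z in lborel. norm (I z * q (h n) z) \<le> K * norm v * I z" for n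
            using mult_right_mono[OF qK[of "h n"] I0]
            by (intro AE_I2) (simp add: abs_mult I0 mult.commute)
        qed (use I_int in auto)
      qed
      then have "(F has_real_derivative d) (at s)" by (simp add: DERIV_def)
      moreover have "\<bar>d\<bar> \<le> integral\<^sup>L lborel (\<lambda>z. L * norm v * I z)"
      proof -
        have "\<bar>d\<bar> \<le> integral\<^sup>L lborel (\<lambda>z. \<bar>I z * f z\<bar>)"
          unfolding d_def by (rule integral_abs_bound)
        also have "\<dots> \<le> integral\<^sup>L lborel (\<lambda>z. L * norm v * I z)"
        proof (rule integral_mono_AE)
          have bnd: "AE z in lborel. \<bar>I z * f z\<bar> \<le> L * norm v * I z"
            using conv by eventually_elim
              (use I0 mult_right_mono in \<open>fastforce simp: abs_mult mult.commute\<close>)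
          show "integrable lborel (\<lambda>z. L * norm v * I z)" using I_int by simp
          show "integrable lborel (\<lambda>z. \<bar>I z * f z\<bar>)"
          proof (rule Bochner_Integration.integrable_bound[where f = "\<lambda>z. L * norm v * I z"])
            show "AE z in lborel. norm \<bar>I z * f z\<bar> \<le> norm (L * norm v * I z)"
              using bnd by eventually_elim simp
          qed (use I_int in auto)
          show "AE z in lborel. \<bar>I z * f z\<bar> \<le> L * norm v * I z" by (rule bnd)
        qed
        finally show ?thesis .
      qed
      ultimately show ?thesis using I_integral by auto
    qed
    obtain d where d: "\<And>s. (F has_real_derivative d s) (at s)" "\<And>s. \<bar>d s\<bar> \<le> L * norm v * vol"
      using deriv by metis
    obtain s where "F 1 - F 0 = (1 - 0) * d s"
      using MVT2[of 0 1 F d] d(1) by auto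
    then have F_diff: "\<bar>F 1 - F 0\<bar> \<le> L * norm v * vol" using d(2)[of s] by simp
    \<comment> \<open>The error of replacing the mean by the value of \<open>g\<close> at the two
      endpoints, at most \<open>K * r\<close> for each.\<close>
    define e where "e = (\<lambda>z. I z * ((g (y + z) - g y) - (g (x + z) - g x)))"
    have e_le: "\<bar>e z\<bar> \<le> 2 * K * r * I z" for z
    proof (cases "norm z \<le> r")
      case True
      then have "K * norm z \<le> K * r" using K0 by (rule mult_left_mono)
      with K[of "y + z" y] K[of "x + z" x]
      have "\<bar>(g (y + z) - g y) - (g (x + z) - g x)\<bar> \<le> 2 * K * r" by simp
      then show ?thesis using True by (simp add: e_def I_def)
    qed (simp add: e_def I_def)
    have "vol * (g y - g x) = (F 1 - F 0) - integral\<^sup>L lborel e"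
    proof -
      have "F 1 - F 0 = integral\<^sup>L lborel (\<lambda>z. I z * g (y + z) - I z * g (x + z))"
        unfolding F_def v_def
        using Bochner_Integration.integral_diff[OF F_int[of y] F_int[of x]] by simp
      also have "\<dots> = integral\<^sup>L lborel (\<lambda>z. (g y - g x) * I z + e z)"
        by (intro Bochner_Integration.integral_cong refl) (simp add: e_def algebra_simps)
      also have "\<dots> = (g y - g x) * vol + integral\<^sup>L lborel e"
      proof -
        have "integrable lborel e"
        proof (rule Bochner_Integration.integrable_bound[where f = "\<lambda>z. 2 * K * r * I z"])
          show "e \<in> borel_measurable lborel" unfolding e_def by measurable
          show "AE z in lborel. norm (e z) \<le> norm (2 * K * r * I z)"
            using order_trans[OF e_le abs_ge_self] by simp
        qed (use I_int in simp)
        then show ?thesis using I_int I_integral[of "g y - g x"] by simp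
      qed
      finally show ?thesis by (simp add: mult.commute)
    qed
    moreover have "\<bar>integral\<^sup>L lborel e\<bar> \<le> 2 * K * r * vol"
    proof -
      have "\<bar>integral\<^sup>L lborel e\<bar> \<le> integral\<^sup>L lborel (\<lambda>z. 2 * K * r * I z)"
        by (rule order_trans[OF integral_abs_bound], rule integral_mono')
          (use I_int e_le order_trans[OF abs_ge_zero e_le] in auto)
      then show ?thesis unfolding I_integral .
    qed
    ultimately have "\<bar>vol * (g y - g x)\<bar> \<le> vol * (L * norm v + 2 * K * r)"
      using F_diff by (simp add: algebra_simps)
    then show ?thesis using vol by (simp add: abs_mult abs_minus_commute)
  qed
  show ?thesis
  proof (rule field_le_epsilon)
    fix e :: real assume e: "0 < e"
    have "\<bar>g x - g y\<bar> \<le> L * norm v + 2 * K * (e / (2 * (K + 1)))"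
      by (rule approx) (use e K0 in simp)
    also have "2 * K * (e / (2 * (K + 1))) \<le> e"
      using e K0 by (simp add: field_simps)
    finally show "\<bar>g x - g y\<bar> \<le> L * norm (x - y) + e" by (simp add: v_def norm_minus_commute)
  qed
qed

section \<open>Flattened coordinates\<close>

text \<open>A quadratic spline of class C1. Its derivative is the hat function on [1/10, 3/5] with
  peak 4 at 7/20, whose integral is 1.\<close>

definition smooth_step :: "real \<Rightarrow> real" where
  "smooth_step r = 2 * (max 0 (2 * r - 1/5))\<^sup>2 - 4 * (max 0 (2 * r - 7/10))\<^sup>2 + 2 * (max 0 (2 * r - 6/5))\<^sup>2"

definition smooth_step_deriv :: "real \<Rightarrow> real" where
  "smooth_step_deriv r = 8 * max 0 (2 * r - 1/5) - 16 * max 0 (2 * r - 7/10) + 8 * max 0 (2 * r - 6/5)"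

lemma has_real_derivative_max_0_power2:
  "((\<lambda>r::real. (max 0 r)\<^sup>2) has_real_derivative 2 * max 0 r) (at r)"
proof (cases r "0::real" rule: linorder_cases)
  case less
  have d: "((\<lambda>r. 0) has_real_derivative 2 * max 0 r) (at r)" using less by simp
  have ev: "\<forall>\<^sub>F x in nhds r. (max 0 x)\<^sup>2 = (0::real)"
    using less eventually_nhds_in_open[of "{..<0}" r] by (auto elim!: eventually_mono)
  show ?thesis using d by (subst DERIV_cong_ev[OF refl ev refl])
next
  case greater
  have d: "((\<lambda>r. r\<^sup>2) has_real_derivative 2 * max 0 r) (at r)"
    using greater by (auto intro!: derivative_eq_intros)
  have ev: "\<forall>\<^sub>F x in nhds r. (max 0 x)\<^sup>2 = x\<^sup>2"
    using greater eventually_nhds_in_open[of "{0<..}" r] by (auto elim!: eventually_mono)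
  show ?thesis using d by (subst DERIV_cong_ev[OF refl ev refl])
next
  case equal
  have "((\<lambda>h::real. (max 0 h)\<^sup>2 / h) \<longlongrightarrow> 0) (at 0)"
  proof (rule Lim_null_comparison)
    show "\<forall>\<^sub>F h::real in at 0. norm ((max 0 h)\<^sup>2 / h) \<le> \<bar>h\<bar>"
      by (intro always_eventually allI) (auto simp: max_def power2_eq_square)
    show "((\<lambda>h::real. \<bar>h\<bar>) \<longlongrightarrow> 0) (at 0)" by (intro tendsto_eq_intros) auto
  qed
  then show ?thesis using equal by (simp add: DERIV_def)
qed

lemma smooth_step_has_derivative:
  "(smooth_step has_real_derivative smooth_step_deriv r) (at r)"
proof -
  have "((\<lambda>r. (max 0 (2 * r - c))\<^sup>2) has_real_derivative 4 * max 0 (2 * r - c)) (at r)" for c :: real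
  proof -
    have "((\<lambda>r. 2 * r - c) has_real_derivative 2) (at r)" by (auto intro!: derivative_eq_intros)
    from DERIV_chain2[OF has_real_derivative_max_0_power2 this] show ?thesis by simp
  qed
  from DERIV_add[OF DERIV_diff[OF DERIV_cmult[OF this, of 2] DERIV_cmult[OF this, of 4]]
      DERIV_cmult[OF this, of 2]]
  show ?thesis unfolding smooth_step_def[abs_def] smooth_step_deriv_def by (simp add: algebra_simps)
qed

lemma continuous_smooth_step_deriv: "continuous_on S smooth_step_deriv"
  unfolding smooth_step_deriv_def[abs_def] by (intro continuous_intros)

lemma smooth_step_eq_0: "r \<le> 1/10 \<Longrightarrow> smooth_step r = 0 \<and> smooth_step_deriv r = 0"
  by (simp add: smooth_step_def smooth_step_deriv_def max_def)

lemma smooth_step_eq_1: "3/5 \<le> r \<Longrightarrow> smooth_step r = 1 \<and> smooth_step_deriv r = 0"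
  by (simp add: smooth_step_def smooth_step_deriv_def max_def power2_eq_square algebra_simps)

lemma smooth_step_deriv_bounds: "0 \<le> smooth_step_deriv r" "smooth_step_deriv r \<le> 4"
  by (auto simp: smooth_step_deriv_def max_def)

lemma smooth_step_bounds: "0 \<le> smooth_step r" "smooth_step r \<le> 1"
proof -
  have mono: "smooth_step p \<le> smooth_step q" if "p \<le> q" for p q
    using that smooth_step_has_derivative smooth_step_deriv_bounds
    by (rule_tac DERIV_nonneg_imp_nondecreasing) blast+
  show "0 \<le> smooth_step r"
    using mono[of "min r (1/10)" r] smooth_step_eq_0[of "min r (1/10)"] by simp
  show "smooth_step r \<le> 1"
    using mono[of r "max r (3/5)"] smooth_step_eq_1[of "max r (3/5)"] by simp
qed

text \<open>\<open>arctan \<circ> tan\<close> provides the signed distance to the nearest half-integer, and the cut-off removes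
  its jumps without changing it near the half-integers.\<close>

definition sawtooth :: "real \<Rightarrow> real" where
  "sawtooth u = (1 - smooth_step ((sin (2 * pi * u))\<^sup>2)) * (arctan (tan (2 * pi * u)) / (2 * pi))"

definition sawtooth_deriv :: "real \<Rightarrow> real" where
  "sawtooth_deriv u = 1 - smooth_step ((sin (2 * pi * u))\<^sup>2)
     - smooth_step_deriv ((sin (2 * pi * u))\<^sup>2) * (2 * sin (2 * pi * u) * cos (2 * pi * u)) * arctan (tan (2 * pi * u))"

text \<open>Handles the jumps of \<open>arctan (tan _)\<close>: around each of them the cut-off
  factor of \<open>sawtooth\<close> is identically 0, so function and derivative vanish
  nearby.\<close>

lemma sin_squared_large_nhds:
  assumes "cos (2 * pi * u) = 0"
  shows "\<forall>\<^sub>F v in nhds u. 3/5 \<le> (sin (2 * pi * v))\<^sup>2"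
proof -
  have "isCont (\<lambda>v. (sin (2 * pi * v))\<^sup>2) u" by (intro continuous_intros)
  moreover have "3/5 < (sin (2 * pi * u))\<^sup>2" using assms by (simp add: sin_squared_eq)
  ultimately have "\<forall>\<^sub>F v in nhds u. 3/5 < (sin (2 * pi * v))\<^sup>2"
    unfolding isCont_def tendsto_at_iff_tendsto_nhds[of "\<lambda>v. (sin (2 * pi * v))\<^sup>2"]
    by (rule order_tendstoD(1))
  then show ?thesis by eventually_elim simp
qed

lemma sawtooth_has_derivative: "(sawtooth has_real_derivative sawtooth_deriv u) (at u)"
proof (cases "cos (2 * pi * u) = 0")
  case True
  have "sawtooth_deriv u = 0"
    using smooth_step_eq_1[of "(sin (2 * pi * u))\<^sup>2"] True by (simp add: sawtooth_deriv_def sin_squared_eq)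
  then have d: "((\<lambda>_. 0) has_real_derivative sawtooth_deriv u) (at u)" by simp
  have ev: "\<forall>\<^sub>F v in nhds u. sawtooth v = 0"
    using sin_squared_large_nhds[OF True] by eventually_elim (simp add: sawtooth_def smooth_step_eq_1)
  show ?thesis using d by (subst DERIV_cong_ev[OF refl ev refl])
next
  case False
  have "((\<lambda>u. (sin (2 * pi * u))\<^sup>2) has_real_derivative 2 * sin (2 * pi * u) * cos (2 * pi * u) * (2 * pi)) (at u)"
    by (auto intro!: derivative_eq_intros)
  from DERIV_chain2[OF smooth_step_has_derivative this]
  have S: "((\<lambda>u. smooth_step ((sin (2 * pi * u))\<^sup>2)) has_real_derivative
      smooth_step_deriv ((sin (2 * pi * u))\<^sup>2) * (2 * sin (2 * pi * u) * cos (2 * pi * u) * (2 * pi))) (at u)" .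
  have "((\<lambda>u. 2 * pi * u) has_real_derivative 2 * pi) (at u)"
    by (auto intro!: derivative_eq_intros)
  from DERIV_chain2[OF DERIV_tan[OF False] this]
  have "((\<lambda>u. tan (2 * pi * u)) has_real_derivative inverse ((cos (2 * pi * u))\<^sup>2) * (2 * pi)) (at u)" .
  from DERIV_chain2[OF DERIV_arctan this]
  have "((\<lambda>u. arctan (tan (2 * pi * u))) has_real_derivative
      inverse (1 + (tan (2 * pi * u))\<^sup>2) * (inverse ((cos (2 * pi * u))\<^sup>2) * (2 * pi))) (at u)" .
  moreover have "inverse (1 + (tan (2 * pi * u))\<^sup>2) * (inverse ((cos (2 * pi * u))\<^sup>2) * (2 * pi)) = 2 * pi"
    using False tan_sec[OF False] by (simp add: power_inverse)
  ultimately have A: "((\<lambda>u. arctan (tan (2 * pi * u))) has_real_derivative 2 * pi) (at u)" by simp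
  show ?thesis unfolding sawtooth_def[abs_def]
    by (rule DERIV_cong[OF DERIV_mult[OF DERIV_diff[OF DERIV_const S] DERIV_cdivide[OF A]]])
      (simp add: sawtooth_deriv_def divide_simps; simp add: algebra_simps)
qed

lemma isCont_sawtooth_deriv: "isCont sawtooth_deriv u"
proof (cases "cos (2 * pi * u) = 0")
  case True
  have "\<forall>\<^sub>F v in nhds u. sawtooth_deriv v = 0"
    using sin_squared_large_nhds[OF True]
    by eventually_elim (simp add: sawtooth_deriv_def smooth_step_eq_1)
  then show ?thesis by (simp add: isCont_cong[of sawtooth_deriv "\<lambda>_. 0"])
next
  case False
  have 1: "isCont smooth_step r" "isCont smooth_step_deriv r" for r
    using DERIV_isCont[OF smooth_step_has_derivative] continuous_smooth_step_deriv[of UNIV]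
    by (auto simp: continuous_on_eq_continuous_at)
  have 2: "isCont (\<lambda>u. tan (2 * pi * u)) u"
    using False by (intro continuous_intros) auto
  have 3: "isCont (\<lambda>u. (sin (2 * pi * u))\<^sup>2) u" by (intro continuous_intros)
  show ?thesis unfolding sawtooth_deriv_def[abs_def]
    by (intro continuous_intros isCont_o2[OF 3 1(1)] isCont_o2[OF 3 1(2)] isCont_o2[OF 2 isCont_arctan])
qed

lemma sawtooth_bound: "\<bar>sawtooth u\<bar> \<le> 1/4"
proof -
  have "\<bar>arctan (tan (2 * pi * u)) / (2 * pi)\<bar> \<le> 1/4"
  proof -
    have "\<bar>arctan (tan (2 * pi * u))\<bar> \<le> pi / 2"
      using arctan_bounded[of "tan (2 * pi * u)"] by linarith
    then show ?thesis by (simp add: field_simps)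
  qed
  moreover have "\<bar>1 - smooth_step ((sin (2 * pi * u))\<^sup>2)\<bar> \<le> 1"
    using smooth_step_bounds[of "(sin (2 * pi * u))\<^sup>2"] by simp
  ultimately show ?thesis
    unfolding sawtooth_def abs_mult by (metis abs_ge_zero mult_1 mult_mono zero_le_one)
qed

lemma sawtooth_deriv_bound: "\<bar>sawtooth_deriv u\<bar> \<le> 8"
proof -
  \<comment> \<open>This bounds the arctangent by 7/4, and the final bound is 1 + 4 * 1 * (7/4) =
    8.\<close>
  have "pi \<le> 7/2" using pi_approx by simp
  then have "\<bar>arctan (tan (2 * pi * u))\<bar> \<le> 7/4"
    using arctan_bounded[of "tan (2 * pi * u)"] by linarith
  moreover have "\<bar>2 * sin (2 * pi * u) * cos (2 * pi * u)\<bar> \<le> 1"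
    using abs_sin_le_one[of "2 * (2 * pi * u)"] unfolding sin_double .
  moreover have "\<bar>smooth_step_deriv ((sin (2 * pi * u))\<^sup>2)\<bar> \<le> 4"
    using smooth_step_deriv_bounds[of "(sin (2 * pi * u))\<^sup>2"] by simp
  ultimately have "\<bar>smooth_step_deriv ((sin (2 * pi * u))\<^sup>2)\<bar> * \<bar>2 * sin (2 * pi * u) * cos (2 * pi * u)\<bar>
      * \<bar>arctan (tan (2 * pi * u))\<bar> \<le> 4 * 1 * (7/4)"
    by (intro mult_mono) auto
  then have "\<bar>smooth_step_deriv ((sin (2 * pi * u))\<^sup>2) * (2 * sin (2 * pi * u) * cos (2 * pi * u))
      * arctan (tan (2 * pi * u))\<bar> \<le> 7" by (simp add: abs_mult)
  then show ?thesis
    using smooth_step_bounds[of "(sin (2 * pi * u))\<^sup>2"] unfolding sawtooth_deriv_def by linarith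
qed

lemma sawtooth_periodic: "n \<in> \<int> \<Longrightarrow> sawtooth (u + n) = sawtooth u"
proof -
  assume "n \<in> \<int>"
  then obtain m where m: "n = of_int m" by (rule Ints_cases)
  have eq: "2 * pi * (u + n) = 2 * pi * u + pi * of_int (2 * m)" by (simp add: m algebra_simps)
  have "(sin (2 * pi * (u + n)))\<^sup>2 = (sin (2 * pi * u))\<^sup>2"
    unfolding eq sin_add by (simp only: sin_npi_int cos_npi_int) simp
  moreover have "tan (2 * pi * (u + n)) = tan (2 * pi * u)"
    unfolding eq using tan_periodic_int[of "2 * pi * u" "2 * m"] by (simp add: mult.commute)
  ultimately show ?thesis by (simp add: sawtooth_def)
qed

lemma sin_pi_squared_shift:
  assumes "m \<in> \<int>"
  shows "(sin (pi * (u + m)))\<^sup>2 = (sin (pi * u))\<^sup>2"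
proof -
  obtain k where k: "m = of_int k" using assms by (rule Ints_cases)
  have eq: "pi * (u + m) = pi * u + pi * of_int k" by (simp add: k algebra_simps)
  show ?thesis unfolding eq sin_add
    by (simp add: sin_npi_int cos_npi_int)
qed

text \<open>The tolerance 1/50 covers tubes of half-width 1/100 even after a coordinate has been
  doubled. With \<open>pi \<le> 7/2\<close> the sine is at most 7/100, and 49/10000 is below
  1/200.\<close>

lemma sin_pi_squared_small:
  assumes "m \<in> \<int>" "\<bar>u - m\<bar> \<le> 1/50"
  shows "(sin (pi * u))\<^sup>2 \<le> 1/200"
proof -
  have "(sin (pi * u))\<^sup>2 = (sin (pi * (u - m)))\<^sup>2"
    using sin_pi_squared_shift[of m "u - m"] assms(1) by simp
  moreover have "\<bar>sin (pi * (u - m))\<bar> \<le> 7/100"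
  proof -
    have "\<bar>sin (pi * (u - m))\<bar> \<le> \<bar>pi * (u - m)\<bar>" by (rule abs_sin_x_le_abs_x)
    also have "\<dots> \<le> (7/2) * (1/50)"
      unfolding abs_mult using pi_approx assms(2) by (intro mult_mono) auto
    finally show ?thesis by simp
  qed
  then have "\<bar>sin (pi * (u - m))\<bar>\<^sup>2 \<le> (7/100)\<^sup>2" by (rule power_mono) simp
  ultimately show ?thesis by (simp add: power2_eq_square)
qed

lemma sin_pi_squared_large:
  assumes "m \<in> \<int>" "\<bar>u - 1/2 - m\<bar> \<le> 1/50"
  shows "3/5 \<le> (sin (pi * u))\<^sup>2"
proof -
  have "sin (pi * u) = cos (pi * (u - 1/2))"
    by (simp add: right_diff_distrib cos_diff)
  then have "(sin (pi * u))\<^sup>2 = 1 - (sin (pi * (u - 1/2)))\<^sup>2" by (simp add: sin_squared_eq)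
  moreover have "(sin (pi * (u - 1/2)))\<^sup>2 \<le> 1/200"
    by (rule sin_pi_squared_small) (use assms in auto)
  ultimately show ?thesis by simp
qed

section \<open>Line families and their tubes\<close>

definition line_base :: "3 \<Rightarrow> real ^ 3" where
  "line_base i = vector [if i = 3 then 1/2 else 0, if i = 3 then 1/2 else 0, if i = 2 then 1/2 else 0]"

text \<open>All lattice translates of the line in direction \<open>i\<close> at once: its own
  coordinate is free, the others are fixed modulo 1.\<close>

definition line_family :: "3 \<Rightarrow> (real ^ 3) set" where
  "line_family i = {x. \<forall>j. j \<noteq> i \<longrightarrow> x $ j - line_base i $ j \<in> \<int>}"

lemma in_linesI:
  "l \<in> {line1, line2, line3} \<Longrightarrow> y \<in> l \<Longrightarrow> z \<in> integer_lattice \<Longrightarrow> y + z \<in> lines"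
  unfolding lines_def by (rule UN_I, assumption, rule UN_I, assumption, rule image_eqI[where x = y]) simp

lemma lines_eq_Union_line_family: "lines = (\<Union>i. line_family i)"
proof (intro equalityI subsetI)
  fix x assume "x \<in> lines"
  then obtain s z where z: "z \<in> integer_lattice"
    and "x = vector [s, 0, 0] + z \<or> x = vector [0, s, 1/2] + z \<or> x = vector [1/2, 1/2, s] + z"
    unfolding lines_def line1_def line2_def line3_def by blast
  then have "x \<in> line_family 1 \<or> x \<in> line_family 2 \<or> x \<in> line_family 3"
    by (auto simp: line_family_def line_base_def forall_3 integer_lattice_def)
  then show "x \<in> (\<Union>i. line_family i)" by blast
next
  fix x assume "x \<in> (\<Union>i. line_family i)"
  then obtain i where i: "x \<in> line_family i" by blast
  consider "i = 1" | "i = 2" | "i = 3" using exhaust_3 by blast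
  then show "x \<in> lines"
  proof cases
    case 1
    have "x = vector [x $ 1, 0, 0] + vector [0, x $ 2, x $ 3]" by (simp add: vec_eq_iff forall_3)
    moreover have "vector [x $ 1, 0, 0] \<in> line1" by (simp add: line1_def)
    moreover have "vector [0, x $ 2, x $ 3] \<in> (integer_lattice :: (real ^ 3) set)"
      using i 1 by (simp add: line_family_def line_base_def forall_3 integer_lattice_def)
    ultimately show ?thesis using in_linesI[of line1] by (metis insert_iff)
  next
    case 2
    have "x = vector [0, x $ 2, 1/2] + vector [x $ 1, 0, x $ 3 - 1/2]" by (simp add: vec_eq_iff forall_3)
    moreover have "vector [0, x $ 2, 1/2] \<in> line2" by (simp add: line2_def)
    moreover have "vector [x $ 1, 0, x $ 3 - 1/2] \<in> (integer_lattice :: (real ^ 3) set)"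
      using i 2 by (simp add: line_family_def line_base_def forall_3 integer_lattice_def)
    ultimately show ?thesis using in_linesI[of line2] by (metis insert_iff)
  next
    case 3
    have "x = vector [1/2, 1/2, x $ 3] + vector [x $ 1 - 1/2, x $ 2 - 1/2, 0]"
      by (simp add: vec_eq_iff forall_3)
    moreover have "vector [1/2, 1/2, x $ 3] \<in> line3" by (simp add: line3_def)
    moreover have "vector [x $ 1 - 1/2, x $ 2 - 1/2, 0] \<in> (integer_lattice :: (real ^ 3) set)"
      using i 3 by (simp add: line_family_def line_base_def forall_3 integer_lattice_def)
    ultimately show ?thesis using in_linesI[of line3] by (metis insert_iff)
  qed
qed

text \<open>The cross-section is a square, not a disc: this contains the Euclidean neighbourhood and
  lets each transverse coordinate be treated alone.\<close>

definition tube :: "real \<Rightarrow> 3 \<Rightarrow> (real ^ 3) set" where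
  "tube d i = {x. \<forall>j. j \<noteq> i \<longrightarrow> (\<exists>m\<in>\<int>. \<bar>x $ j - line_base i $ j - m\<bar> < d)}"

lemma line_family_subset_tube: "0 < d \<Longrightarrow> line_family i \<subseteq> tube d i"
  unfolding line_family_def tube_def by force

lemma neighborhood_lines_subset_tubes: "neighborhood d lines \<subseteq> (\<Union>i. tube d i)"
proof
  fix x assume "x \<in> neighborhood d lines"
  then obtain y i where y: "y \<in> line_family i" "dist y x < d"
    by (auto simp: neighborhood_def lines_eq_Union_line_family)
  have "x \<in> tube d i"
    unfolding tube_def
  proof (intro CollectI allI impI)
    fix j assume "j \<noteq> i"
    then have "y $ j - line_base i $ j \<in> \<int>" using y by (simp add: line_family_def)
    moreover have "\<bar>x $ j - y $ j\<bar> < d"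
      using component_le_norm_cart[of "x - y" j] y(2) by (simp add: dist_norm norm_minus_commute)
    ultimately show "\<exists>m\<in>\<int>. \<bar>x $ j - line_base i $ j - m\<bar> < d"
      by (intro bexI[of _ "y $ j - line_base i $ j"]) auto
  qed
  then show "x \<in> (\<Union>i. tube d i)" by blast
qed

text \<open>A smooth periodic substitute for the squared distance. It vanishes exactly on
  \<open>line_family i\<close> and is at least 1 as soon as one transverse coordinate is off by half
  a period.\<close>

definition line_gap :: "3 \<Rightarrow> real ^ 3 \<Rightarrow> real" where
  "line_gap i x = (\<Sum>j\<in>UNIV - {i}. (sin (pi * (x $ j - line_base i $ j)))\<^sup>2)"

text \<open>The functions \<open>h\<^sub>i\<close> of the introduction.\<close>

definition flat_coord :: "3 \<Rightarrow> real ^ 3 \<Rightarrow> real" where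
  "flat_coord i x = x $ i - sawtooth (x $ i) * smooth_step (line_gap i x)"

definition flat_coord_grad :: "3 \<Rightarrow> real ^ 3 \<Rightarrow> real ^ 3" where
  "flat_coord_grad i x =
     axis i 1 - (sawtooth_deriv (x $ i) * smooth_step (line_gap i x)) *\<^sub>R axis i 1
     - (sawtooth (x $ i) * smooth_step_deriv (line_gap i x)) *\<^sub>R
       (\<Sum>j\<in>UNIV - {i}. (pi * sin (2 * (pi * (x $ j - line_base i $ j)))) *\<^sub>R axis j 1)"

lemma GDERIV_sum:
  "(\<And>j. j \<in> A \<Longrightarrow> GDERIV (f j) x :> d j) \<Longrightarrow> GDERIV (\<lambda>x. \<Sum>j\<in>A. f j x) x :> (\<Sum>j\<in>A. d j)"
  unfolding gderiv_def inner_sum_right by (rule has_derivative_sum)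

lemma GDERIV_component: "GDERIV (\<lambda>x::real ^ 'n. x $ j) x :> axis j 1"
  unfolding gderiv_def
  using bounded_linear_imp_has_derivative[OF bounded_linear_vec_nth]
  by (simp add: inner_axis)

lemma GDERIV_line_gap:
  "GDERIV (line_gap i) x :> (\<Sum>j\<in>UNIV - {i}. (pi * sin (2 * (pi * (x $ j - line_base i $ j)))) *\<^sub>R axis j 1)"
  unfolding line_gap_def[abs_def]
proof (rule GDERIV_sum)
  fix j
  have "((\<lambda>u. (sin (pi * (u - line_base i $ j)))\<^sup>2) has_real_derivative
      pi * sin (2 * (pi * (u - line_base i $ j)))) (at u)" for u
    unfolding sin_double by (auto intro!: derivative_eq_intros simp: algebra_simps)
  from GDERIV_DERIV_compose[OF GDERIV_component this]
  show "GDERIV (\<lambda>x. (sin (pi * (x $ j - line_base i $ j)))\<^sup>2) x :>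
      (pi * sin (2 * (pi * (x $ j - line_base i $ j)))) *\<^sub>R axis j 1" .
qed

lemma GDERIV_flat_coord: "GDERIV (flat_coord i) x :> flat_coord_grad i x"
proof -
  have saw: "GDERIV (\<lambda>x. sawtooth (x $ i)) x :> sawtooth_deriv (x $ i) *\<^sub>R axis i 1"
    by (rule GDERIV_DERIV_compose[OF GDERIV_component sawtooth_has_derivative])
  have step: "GDERIV (\<lambda>x. smooth_step (line_gap i x)) x :> smooth_step_deriv (line_gap i x) *\<^sub>R
      (\<Sum>j\<in>UNIV - {i}. (pi * sin (2 * (pi * (x $ j - line_base i $ j)))) *\<^sub>R axis j 1)"
    by (rule GDERIV_DERIV_compose[OF GDERIV_line_gap smooth_step_has_derivative])
  show ?thesis
    unfolding flat_coord_def[abs_def]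
    by (rule GDERIV_subst[OF GDERIV_diff[OF GDERIV_component GDERIV_mult[OF saw step]]])
      (simp add: flat_coord_grad_def mult.commute)
qed

lemma continuous_flat_coord_grad: "continuous_on S (flat_coord_grad i)"
proof -
  have gap: "continuous_on UNIV (line_gap i)"
    unfolding line_gap_def[abs_def] by (intro continuous_intros)
  have comp: "continuous_on UNIV (\<lambda>x::real ^ 3. x $ i)" by (intro continuous_intros)
  have saw: "continuous_on UNIV sawtooth" "continuous_on UNIV sawtooth_deriv"
    using DERIV_isCont[OF sawtooth_has_derivative] isCont_sawtooth_deriv
    by (auto simp: continuous_on_eq_continuous_at)
  have step: "continuous_on UNIV smooth_step"
    using DERIV_isCont[OF smooth_step_has_derivative] by (auto simp: continuous_on_eq_continuous_at)
  have "continuous_on UNIV (\<lambda>x. sawtooth_deriv (x $ i))" "continuous_on UNIV (\<lambda>x. sawtooth (x $ i))"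
    by (rule continuous_on_compose2[OF saw(2) comp], simp) (rule continuous_on_compose2[OF saw(1) comp], simp)
  moreover have "continuous_on UNIV (\<lambda>x. smooth_step (line_gap i x))"
    by (rule continuous_on_compose2[OF step gap]) simp
  moreover have "continuous_on UNIV (\<lambda>x. smooth_step_deriv (line_gap i x))"
    by (rule continuous_on_compose2[OF continuous_smooth_step_deriv[of UNIV] gap]) simp
  ultimately have "continuous_on UNIV (flat_coord_grad i)"
    unfolding flat_coord_grad_def[abs_def] by (intro continuous_intros)
  then show ?thesis by (rule continuous_on_subset) simp
qed

lemma flat_coord_periodic:
  assumes "z \<in> integer_lattice"
  shows "flat_coord i (x + z) = flat_coord i x + z $ i"
proof -
  have z: "z $ j \<in> \<int>" for j using assms by (simp add: integer_lattice_def)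
  have "line_gap i (x + z) = line_gap i x"
    unfolding line_gap_def
  proof (rule sum.cong[OF refl])
    fix j
    have eq: "(x + z) $ j - line_base i $ j = (x $ j - line_base i $ j) + z $ j" by simp
    show "(sin (pi * ((x + z) $ j - line_base i $ j)))\<^sup>2 = (sin (pi * (x $ j - line_base i $ j)))\<^sup>2"
      unfolding eq by (rule sin_pi_squared_shift[OF z])
  qed
  then show ?thesis by (simp add: flat_coord_def sawtooth_periodic[OF z])
qed

lemma flat_coord_near: "\<bar>flat_coord i x - x $ i\<bar> \<le> 1/4"
proof -
  have "\<bar>sawtooth (x $ i)\<bar> * \<bar>smooth_step (line_gap i x)\<bar> \<le> 1/4 * 1"
    using sawtooth_bound smooth_step_bounds[of "line_gap i x"] by (intro mult_mono) auto
  then show ?thesis by (simp add: flat_coord_def abs_mult)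
qed

text \<open>The three terms contribute at most 1, 8 and 12. The rounder 33 is small enough, because
  three such gradients stay below 100 and \<open>1 / \<delta>\<close> exceeds 100.\<close>

lemma flat_coord_grad_bound: "norm (flat_coord_grad i x) \<le> 33"
proof -
  have pi: "pi \<le> 4" using pi_approx by simp
  have "\<bar>sawtooth_deriv (x $ i)\<bar> * \<bar>smooth_step (line_gap i x)\<bar> \<le> 8 * 1"
    using sawtooth_deriv_bound smooth_step_bounds[of "line_gap i x"] by (intro mult_mono) auto
  then have saw: "norm ((sawtooth_deriv (x $ i) * smooth_step (line_gap i x)) *\<^sub>R (axis i 1 :: real ^ 3)) \<le> 8"
    by (simp add: abs_mult)
  have "norm (\<Sum>j\<in>UNIV - {i}. (pi * sin (2 * (pi * (x $ j - line_base i $ j)))) *\<^sub>R (axis j 1 :: real ^ 3))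
      \<le> (\<Sum>j\<in>UNIV - {i}. 4)"
  proof (rule sum_norm_le)
    fix j
    have "pi * \<bar>sin (2 * (pi * (x $ j - line_base i $ j)))\<bar> \<le> 4 * 1"
      using pi by (intro mult_mono) auto
    then show "norm ((pi * sin (2 * (pi * (x $ j - line_base i $ j)))) *\<^sub>R (axis j 1 :: real ^ 3)) \<le> 4"
      by (simp add: abs_mult)
  qed
  moreover have "(\<Sum>j\<in>UNIV - {i}. 4 :: real) \<le> 12"
    using card_mono[of UNIV "UNIV - {i}"] by simp
  moreover have "\<bar>sawtooth (x $ i) * smooth_step_deriv (line_gap i x)\<bar> \<le> 1/4 * 4"
    unfolding abs_mult using sawtooth_bound smooth_step_deriv_bounds[of "line_gap i x"]
    by (intro mult_mono) auto
  ultimately have "norm ((sawtooth (x $ i) * smooth_step_deriv (line_gap i x)) *\<^sub>R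
       (\<Sum>j\<in>UNIV - {i}. (pi * sin (2 * (pi * (x $ j - line_base i $ j)))) *\<^sub>R (axis j 1 :: real ^ 3))) \<le> 1 * 12"
    unfolding norm_scaleR by (intro mult_mono) simp_all
  moreover note saw
  moreover have "norm (axis i 1 :: real ^ 3) = 1" by simp
  ultimately show ?thesis
    unfolding flat_coord_grad_def
    using norm_triangle_ineq4[of "axis i 1 - (sawtooth_deriv (x $ i) * smooth_step (line_gap i x)) *\<^sub>R axis i 1"
        "(sawtooth (x $ i) * smooth_step_deriv (line_gap i x)) *\<^sub>R
       (\<Sum>j\<in>UNIV - {i}. (pi * sin (2 * (pi * (x $ j - line_base i $ j)))) *\<^sub>R (axis j 1 :: real ^ 3))"]
      norm_triangle_ineq4[of "axis i 1 :: real ^ 3" "(sawtooth_deriv (x $ i) * smooth_step (line_gap i x)) *\<^sub>R axis i 1"]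
    by linarith
qed

text \<open>Each summand of \<open>line_gap i x\<close> is at most 1/200, so the gap stays in the
  range where \<open>smooth_step\<close> and its derivative vanish and the coordinate is left
  untouched.\<close>

lemma flat_coord_grad_own_tube:
  assumes "x \<in> tube (1/100) i"
  shows "flat_coord_grad i x = axis i 1"
proof -
  have "line_gap i x \<le> (\<Sum>j\<in>UNIV - {i}. 1/200)"
    unfolding line_gap_def
  proof (rule sum_mono)
    fix j assume "j \<in> UNIV - {i}"
    then obtain m where "m \<in> \<int>" "\<bar>x $ j - line_base i $ j - m\<bar> < 1/100"
      using assms by (auto simp: tube_def)
    then show "(sin (pi * (x $ j - line_base i $ j)))\<^sup>2 \<le> 1/200"
      by (intro sin_pi_squared_small) auto
  qed
  also have "\<dots> \<le> 1/10" using card_mono[of UNIV "UNIV - {i}"] by simp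
  finally have "line_gap i x \<le> 1/10" .
  from smooth_step_eq_0[OF this] show ?thesis by (simp add: flat_coord_grad_def)
qed

lemma exists_3: "(\<exists>i::3. P i) \<longleftrightarrow> P 1 \<or> P 2 \<or> P 3"
  by (metis exhaust_3)

text \<open>The geometric separation of the families: in the direction \<open>j\<close> different
  from both, they are shifted by half a period.\<close>

lemma line_base_other:
  assumes "i \<noteq> l"
  obtains j where "j \<noteq> i" "j \<noteq> l" "line_base l $ j - line_base i $ j = 1/2 \<or> line_base l $ j - line_base i $ j = - 1/2"
proof -
  have "\<exists>j. j \<noteq> i \<and> j \<noteq> l \<and> (line_base l $ j - line_base i $ j = 1/2 \<or> line_base l $ j - line_base i $ j = - 1/2)"
    using exhaust_3[of i] exhaust_3[of l] assms
    by (elim disjE) (simp_all add: exists_3 line_base_def)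
  then show thesis using that by blast
qed

lemma line_base_own: "line_base l $ i = 0 \<or> line_base l $ i = 1/2"
  using exhaust_3[of i] by (elim disjE) (auto simp: line_base_def)

text \<open>In the separating direction \<open>j\<close> the gap is large, so the cut-off is locally
  constant 1. Moreover \<open>x $ i\<close> is close to a multiple of 1/2, where
  \<open>sawtooth\<close> has slope 1 and cancels the slope of the coordinate.\<close>

lemma flat_coord_grad_other_tube:
  assumes x: "x \<in> tube (1/100) l" and il: "i \<noteq> l"
  shows "flat_coord_grad i x = 0"
proof -
  obtain j where j: "j \<noteq> i" "j \<noteq> l"
    and half: "line_base l $ j - line_base i $ j = 1/2 \<or> line_base l $ j - line_base i $ j = - 1/2"
    using line_base_other[OF il] .
  obtain m where m: "m \<in> \<int>" "\<bar>x $ j - line_base l $ j - m\<bar> < 1/100"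
    using x j by (auto simp: tube_def)
  have "3/5 \<le> (sin (pi * (x $ j - line_base i $ j)))\<^sup>2"
    using half
  proof
    assume "line_base l $ j - line_base i $ j = 1/2"
    then show ?thesis using m by (intro sin_pi_squared_large[of m]; (assumption | linarith))
  next
    assume "line_base l $ j - line_base i $ j = - 1/2"
    then show ?thesis using m by (intro sin_pi_squared_large[of "m + -1"] Ints_add; (linarith | simp))
  qed
  also have "\<dots> \<le> line_gap i x"
    unfolding line_gap_def using j by (intro member_le_sum) auto
  finally have step: "smooth_step (line_gap i x) = 1 \<and> smooth_step_deriv (line_gap i x) = 0"
    by (rule smooth_step_eq_1)
  obtain n where n: "n \<in> \<int>" "\<bar>x $ i - line_base l $ i - n\<bar> < 1/100"
    using x il by (auto simp: tube_def)
  \<comment> \<open>Doubling turns multiples of 1/2 into integers and the tolerance 1/100 into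
    1/50.\<close>
  have "(sin (pi * (2 * x $ i)))\<^sup>2 \<le> 1/200"
  proof (rule sin_pi_squared_small)
    have "2 * line_base l $ i = 0 \<or> 2 * line_base l $ i = 1" using line_base_own[of l i] by auto
    then show "2 * line_base l $ i + 2 * n \<in> \<int>" by (elim disjE) (simp_all add: n(1))
  qed (use n in linarith)
  then have "(sin (2 * pi * x $ i))\<^sup>2 \<le> 1/10" by (simp add: algebra_simps)
  from smooth_step_eq_0[OF this] have "sawtooth_deriv (x $ i) = 1"
    by (simp add: sawtooth_deriv_def)
  with step show ?thesis by (simp add: flat_coord_grad_def)
qed

section \<open>Propagation bounds\<close>

lemma GDERIV_scaleR:
  assumes "GDERIV f (c *\<^sub>R x) :> d"
  shows "GDERIV (\<lambda>x. f (c *\<^sub>R x)) x :> c *\<^sub>R d"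
proof -
  have "((\<lambda>x. c *\<^sub>R x) has_derivative (\<lambda>h. c *\<^sub>R h)) (at x)" by (auto intro!: derivative_eq_intros)
  from has_derivative_compose[OF this assms[unfolded gderiv_def]]
  show ?thesis unfolding gderiv_def by simp
qed

section \<open>The dual norms that govern travel\<close>

definition l1_norm :: "real ^ 'n \<Rightarrow> real" where
  "l1_norm x = (\<Sum>i\<in>UNIV. \<bar>x $ i\<bar>)"

lemma norm_le_l1_norm: "norm x \<le> l1_norm x"
  unfolding l1_norm_def by (rule norm_le_l1_cart)

lemma l1_norm_scaleR: "l1_norm (c *\<^sub>R x) = \<bar>c\<bar> * l1_norm x"
  by (simp add: l1_norm_def abs_mult sum_distrib_left)

lemma l1_norm_nonneg: "0 \<le> l1_norm x"
  by (simp add: l1_norm_def sum_nonneg)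

lemma l1_norm_minus_commute: "l1_norm (x - y) = l1_norm (y - x)"
  by (simp add: l1_norm_def abs_minus_commute)

lemma inner_le_l1_infnorm: "x \<bullet> y \<le> l1_norm x * infnorm (y :: real ^ 'n)"
proof -
  have "x \<bullet> y = (\<Sum>i\<in>UNIV. x $ i * y $ i)" by (simp add: inner_vec_def)
  also have "\<dots> \<le> (\<Sum>i\<in>UNIV. \<bar>x $ i\<bar> * infnorm y)"
  proof (rule sum_mono)
    fix i
    have "x $ i * y $ i \<le> \<bar>x $ i\<bar> * \<bar>y $ i\<bar>" by (metis abs_ge_self abs_mult)
    also have "\<dots> \<le> \<bar>x $ i\<bar> * infnorm y"
      by (intro mult_left_mono component_le_infnorm_cart) simp
    finally show "x $ i * y $ i \<le> \<bar>x $ i\<bar> * infnorm y" .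
  qed
  also have "\<dots> = l1_norm x * infnorm y" by (simp add: l1_norm_def sum_distrib_right)
  finally show ?thesis .
qed

lemma infnorm_le_cart: "(\<And>i. \<bar>(x :: real ^ 'n) $ i\<bar> \<le> c) \<Longrightarrow> infnorm x \<le> c"
  unfolding infnorm_cart by (rule cSup_least) auto

lemma infnorm_attained_cart: "\<exists>i. infnorm (x :: real ^ 'n) = \<bar>x $ i\<bar>"
proof -
  have eq: "{\<bar>x $ i\<bar> |i. i \<in> UNIV} = range (\<lambda>i. \<bar>x $ i\<bar>)" by auto
  have "infnorm x = Max (range (\<lambda>i. \<bar>x $ i\<bar>))"
    unfolding infnorm_cart eq by (rule cSup_eq_Max) auto
  moreover have "Max (range (\<lambda>i. \<bar>x $ i\<bar>)) \<in> range (\<lambda>i. \<bar>x $ i\<bar>)" by (rule Max_in) auto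
  ultimately show ?thesis by (metis rangeE)
qed

lemma Cauchy_viscosity_solution_continuous:
  "Cauchy_viscosity_solution H g w \<Longrightarrow> continuous_on (UNIV \<times> {0..}) w"
  unfolding Cauchy_viscosity_solution_def using lipschitz_on_continuous_on by blast

locale line_medium =
  fixes \<delta> :: real and a :: "real ^ 3 \<Rightarrow> real"
  assumes \<delta>: "0 < \<delta>" "\<delta> < 1/100"
    and a_ge: "\<And>y. \<delta> \<le> a y"
    and a_le: "\<And>y. a y \<le> 1 + \<delta>"
    and a_cont: "continuous_on UNIV a"
    and a_periodic: "periodic a"
    and a_outside: "\<And>y. y \<notin> neighborhood \<delta> lines \<Longrightarrow> 1 \<le> a y"
    and a_lines: "\<And>y. y \<in> lines \<Longrightarrow> a y = \<delta>"
begin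

lemma a_pos: "0 < a y"
  using a_ge[of y] \<delta> by linarith

lemma a_line_family: "y \<in> line_family i \<Longrightarrow> a y = \<delta>"
  by (rule a_lines) (auto simp: lines_eq_Union_line_family)

text \<open>In a tube only one gradient is nonzero and it is a unit vector, so \<open>M\<close> is
  the bound and \<open>a x \<ge> \<delta>\<close> suffices. Outside the neighbourhood
  \<open>a x \<ge> 1\<close>, and 3 * 33 = 99 is below \<open>1 / \<delta>\<close>.\<close>

lemma flat_coord_combination_bound:
  assumes c: "\<And>i. \<bar>c i\<bar> \<le> M"
  shows "norm (\<Sum>i\<in>UNIV. c i *\<^sub>R flat_coord_grad i x) \<le> M / \<delta> * a x"
proof -
  have M: "0 \<le> M" using c[of 1] by linarith
  show ?thesis
  proof (cases "x \<in> neighborhood \<delta> lines")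
    case True
    then obtain l where l: "x \<in> tube \<delta> l" using neighborhood_lines_subset_tubes by blast
    then have l': "x \<in> tube (1/100) l" using \<delta>(2) unfolding tube_def by (blast intro: less_trans)
    have "(\<Sum>i\<in>UNIV. c i *\<^sub>R flat_coord_grad i x) = (\<Sum>i\<in>UNIV. if i = l then c l *\<^sub>R axis l 1 else 0)"
      by (rule sum.cong) (auto simp: flat_coord_grad_own_tube[OF l'] flat_coord_grad_other_tube[OF l'])
    then have "norm (\<Sum>i\<in>UNIV. c i *\<^sub>R flat_coord_grad i x) = \<bar>c l\<bar>" by simp
    also have "\<dots> \<le> M" by (rule c)
    also have "\<dots> = M / \<delta> * \<delta>" using \<delta> by simp
    also have "\<dots> \<le> M / \<delta> * a x" using M \<delta> a_ge by (intro mult_left_mono) auto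
    finally show ?thesis .
  next
    case False
    have "norm (\<Sum>i\<in>UNIV. c i *\<^sub>R flat_coord_grad i x) \<le> (\<Sum>i\<in>(UNIV :: 3 set). M * 33)"
    proof (rule sum_norm_le)
      fix i
      show "norm (c i *\<^sub>R flat_coord_grad i x) \<le> M * 33"
        unfolding norm_scaleR using c flat_coord_grad_bound M by (intro mult_mono) auto
    qed
    also have "\<dots> \<le> M * (1 / \<delta>)"
    proof -
      have "99 \<le> 1 / \<delta>" using \<delta> by (simp add: field_simps)
      from mult_left_mono[OF this M] show ?thesis by simp
    qed
    also have "\<dots> \<le> M / \<delta> * a x" using mult_left_mono[OF a_outside[OF False], of "M / \<delta>"] M \<delta> by simp
    finally show ?thesis .
  qed
qed

text \<open>Speed strictly below \<open>1 / m\<close> leaves slack in \<open>norm b * a < 1\<close>.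
  By compactness of the segment this persists on a tube of uniform radius, which is what
  \<open>subsolution_decreasing_along_ray\<close> asks for.\<close>

lemma segment_step_strict:
  assumes cont: "continuous_on (UNIV \<times> {0..}) w"
    and sub: "viscosity_subsolution (UNIV \<times> {0<..}) (\<lambda>(x, t) (q, s). s + 1 / a ((1 / \<epsilon>) *\<^sub>R x) * norm q) w"
    and \<epsilon>: "0 < \<epsilon>" and t1: "0 \<le> t1"
    and m: "\<And>s. 0 \<le> s \<Longrightarrow> s \<le> 1 \<Longrightarrow> a (p + s *\<^sub>R (p' - p)) \<le> m"
    and T: "m * (\<epsilon> * norm (p' - p)) < T"
  shows "w (\<epsilon> *\<^sub>R p', t1 + T) \<le> w (\<epsilon> *\<^sub>R p, t1)"
proof -
  have mpos: "0 < m" using m[of 0] a_pos[of p] by simp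
  have T0: "0 < T" using T mpos \<epsilon> by (smt (verit) mult_nonneg_nonneg norm_ge_zero)
  define b where "b = (\<epsilon> / T) *\<^sub>R (p' - p)"
  have b: "norm b * m < 1" unfolding b_def norm_scaleR using T T0 \<epsilon> by (simp add: mult_ac)
  define A where "A = (\<lambda>\<tau>. \<epsilon> *\<^sub>R p + \<tau> *\<^sub>R b) ` {0..T}"
  have "compact A" unfolding A_def by (intro compact_continuous_image continuous_intros) simp
  moreover have "open {x. norm b * a ((1 / \<epsilon>) *\<^sub>R x) < 1}"
    by (intro open_Collect_less continuous_intros continuous_on_compose2[OF a_cont]) auto
  moreover have "A \<subseteq> {x. norm b * a ((1 / \<epsilon>) *\<^sub>R x) < 1}"
  proof
    fix x assume "x \<in> A"
    then obtain \<tau> where \<tau>: "0 \<le> \<tau>" "\<tau> \<le> T" "x = \<epsilon> *\<^sub>R p + \<tau> *\<^sub>R b" by (auto simp: A_def)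
    then have "(1 / \<epsilon>) *\<^sub>R x = p + (\<tau> / T) *\<^sub>R (p' - p)"
      using \<epsilon> T0 by (simp add: b_def scaleR_add_right)
    moreover have "a (p + (\<tau> / T) *\<^sub>R (p' - p)) \<le> m" using \<tau> T0 by (intro m) auto
    ultimately have "norm b * a ((1 / \<epsilon>) *\<^sub>R x) \<le> norm b * m" by (intro mult_left_mono) auto
    with b show "x \<in> {x. norm b * a ((1 / \<epsilon>) *\<^sub>R x) < 1}" by simp
  qed
  ultimately obtain r where r: "r > 0" "(\<Union>x\<in>A. ball x r) \<subseteq> {x. norm b * a ((1 / \<epsilon>) *\<^sub>R x) < 1}"
    by (rule compact_subset_open_imp_ball_epsilon_subset)
  have "w (\<epsilon> *\<^sub>R p + T *\<^sub>R b, t1 + T) \<le> w (\<epsilon> *\<^sub>R p, t1)"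
  proof (rule subsolution_decreasing_along_ray[OF cont sub r(1)])
    fix \<tau> x q assume \<tau>: "0 \<le> \<tau>" "\<tau> \<le> T" "norm (x - (\<epsilon> *\<^sub>R p + \<tau> *\<^sub>R b)) < r"
    then have "x \<in> (\<Union>x\<in>A. ball x r)" by (auto simp: A_def dist_norm norm_minus_commute)
    with r(2) have "norm b * a ((1 / \<epsilon>) *\<^sub>R x) < 1" by blast
    then have nb: "norm b \<le> 1 / a ((1 / \<epsilon>) *\<^sub>R x)" using a_pos by (simp add: field_simps)
    have "b \<bullet> q \<le> norm b * norm q" by (rule norm_cauchy_schwarz)
    also have "\<dots> \<le> 1 / a ((1 / \<epsilon>) *\<^sub>R x) * norm q" by (rule mult_right_mono[OF nb]) simp
    finally show "b \<bullet> q \<le> 1 / a ((1 / \<epsilon>) *\<^sub>R x) * norm q" .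
  qed (use T0 t1 in auto)
  moreover have "\<epsilon> *\<^sub>R p + T *\<^sub>R b = \<epsilon> *\<^sub>R p'" using T0 by (simp add: b_def algebra_simps)
  ultimately show ?thesis by simp
qed

text \<open>An extra time \<open>\<eta>\<close> restores the strict inequality, and the Lipschitz
  bound in time makes its cost \<open>K * \<eta>\<close> arbitrarily small. Exact travel time
  matters on the lines, where \<open>T\<close> is exactly the cost.\<close>

lemma segment_step:
  assumes w: "Cauchy_viscosity_solution (\<lambda>x q. 1 / a ((1 / \<epsilon>) *\<^sub>R x) * norm q) g w"
    and \<epsilon>: "0 < \<epsilon>" and t1: "0 \<le> t1"
    and m: "\<And>s. 0 \<le> s \<Longrightarrow> s \<le> 1 \<Longrightarrow> a (p + s *\<^sub>R (p' - p)) \<le> m"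
    and T: "m * (\<epsilon> * norm (p' - p)) \<le> T"
  shows "w (\<epsilon> *\<^sub>R p', t1 + T) \<le> w (\<epsilon> *\<^sub>R p, t1)"
proof (rule field_le_epsilon)
  fix e :: real assume e: "0 < e"
  obtain K where K: "K-lipschitz_on (UNIV \<times> {0..}) w"
    using w by (auto simp: Cauchy_viscosity_solution_def)
  have K0: "0 \<le> K" by (rule lipschitz_on_nonneg[OF K])
  define \<eta> where "\<eta> = e / (K + 1)"
  have \<eta>: "0 < \<eta>" using e K0 by (simp add: \<eta>_def)
  have T0: "0 \<le> T" using T m[of 0] a_pos[of p] \<epsilon>
    by (smt (verit) mult_nonneg_nonneg norm_ge_zero scaleR_zero_left add_0_right)
  have "w (\<epsilon> *\<^sub>R p', t1 + (T + \<eta>)) \<le> w (\<epsilon> *\<^sub>R p, t1)"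
  proof (rule segment_step_strict[OF _ _ \<epsilon> t1 m])
    show "viscosity_subsolution (UNIV \<times> {0<..}) (\<lambda>(x, t) (q, s). s + 1 / a ((1 / \<epsilon>) *\<^sub>R x) * norm q) w"
      using w unfolding Cauchy_viscosity_solution_def viscosity_solution_def by blast
  qed (use T \<eta> Cauchy_viscosity_solution_continuous[OF w] in auto)
  moreover have "\<bar>w (\<epsilon> *\<^sub>R p', t1 + T) - w (\<epsilon> *\<^sub>R p', t1 + (T + \<eta>))\<bar> \<le> K * \<eta>"
    using lipschitz_onD[OF K, of "(\<epsilon> *\<^sub>R p', t1 + T)" "(\<epsilon> *\<^sub>R p', t1 + (T + \<eta>))"] t1 T0 \<eta>
    by (simp add: dist_Pair_Pair dist_real_def)
  moreover have "K * \<eta> \<le> e" using K0 e by (simp add: \<eta>_def field_simps)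
  ultimately show "w (\<epsilon> *\<^sub>R p', t1 + T) \<le> w (\<epsilon> *\<^sub>R p, t1) + e" by linarith
qed

text \<open>Slowness at most 2 and a displacement of norm at most 3, via the \<open>l1_norm\<close>,
  give the cost 6.\<close>

lemma jump_step:
  assumes w: "Cauchy_viscosity_solution (\<lambda>x q. 1 / a ((1 / \<epsilon>) *\<^sub>R x) * norm q) g w"
    and \<epsilon>: "0 < \<epsilon>" and t1: "0 \<le> t1" and near: "\<And>i. \<bar>(p' - p) $ i\<bar> \<le> 1" and T: "6 * \<epsilon> \<le> T"
  shows "w (\<epsilon> *\<^sub>R p', t1 + T) \<le> w (\<epsilon> *\<^sub>R p, t1)"
proof (rule segment_step[OF w \<epsilon> t1, where m = 2])
  show "a (p + s *\<^sub>R (p' - p)) \<le> 2" for s using a_le[of "p + s *\<^sub>R (p' - p)"] \<delta> by simp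
  have "norm (p' - p) \<le> (\<Sum>i\<in>(UNIV :: 3 set). 1)"
    using norm_le_l1_norm[of "p' - p"] sum_mono[of UNIV "\<lambda>i. \<bar>(p' - p) $ i\<bar>" "\<lambda>_. 1", OF near]
    by (simp add: l1_norm_def)
  then have "norm (p' - p) * \<epsilon> \<le> 3 * \<epsilon>" using \<epsilon> by (intro mult_right_mono) auto
  then show "2 * (\<epsilon> * norm (p' - p)) \<le> T" using T by (simp add: mult.commute)
qed

lemma line_step:
  assumes w: "Cauchy_viscosity_solution (\<lambda>x q. 1 / a ((1 / \<epsilon>) *\<^sub>R x) * norm q) g w"
    and \<epsilon>: "0 < \<epsilon>" and t1: "0 \<le> t1" and p: "p \<in> line_family i" and T: "T = \<delta> * (\<epsilon> * \<bar>r\<bar>)"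
  shows "w (\<epsilon> *\<^sub>R (p + r *\<^sub>R axis i 1), t1 + T) \<le> w (\<epsilon> *\<^sub>R p, t1)"
proof (rule segment_step[OF w \<epsilon> t1, where m = \<delta>])
  fix s
  have "p + s *\<^sub>R (p + r *\<^sub>R axis i 1 - p) \<in> line_family i"
    using p by (auto simp: line_family_def axis_def)
  then show "a (p + s *\<^sub>R (p + r *\<^sub>R axis i 1 - p)) \<le> \<delta>" by (simp add: a_line_family)
qed (use T in simp)

text \<open>Travelling along one line of each direction costs \<open>\<delta>\<close> times the \<open>l\<^sup>1\<close> distance, and the four
  transitions between lines cost \<open>O(\<epsilon>)\<close>.\<close>

lemma upper_bound_oscillating:
  assumes w: "Cauchy_viscosity_solution (\<lambda>x q. 1 / a ((1 / \<epsilon>) *\<^sub>R x) * norm q) g w"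
    and \<epsilon>: "0 < \<epsilon>" and t: "\<delta> * l1_norm (y - x) + 24 * \<epsilon> \<le> t"
  shows "w (x, t) \<le> g y"
proof -
  define X Y where "X = (1 / \<epsilon>) *\<^sub>R x" and "Y = (1 / \<epsilon>) *\<^sub>R y"
  define T where "T = (\<lambda>i. \<delta> * (\<epsilon> * \<bar>X $ i - Y $ i\<bar>))"
  define fl where "fl = (\<lambda>u::real. of_int \<lfloor>u\<rfloor> :: real)"
  have fl_Ints: "fl u \<in> \<int>" and fl_le: "fl u \<le> u" "u \<le> fl u + 1" for u
    by (simp_all add: fl_def real_of_int_floor_add_one_ge)
  have T0: "0 \<le> T i" for i using \<delta> \<epsilon> by (simp add: T_def)
  have T_sum: "T 1 + T 2 + T 3 = \<delta> * l1_norm (y - x)"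
  proof -
    have "\<epsilon> * \<bar>X $ i - Y $ i\<bar> = \<bar>(y - x) $ i\<bar>" for i
      using \<epsilon> by (simp add: X_def Y_def field_simps abs_minus_commute flip: diff_divide_distrib)
    then show ?thesis by (simp add: T_def l1_norm_def sum_3 distrib_left)
  qed
  \<comment> \<open>Four jumps at \<open>6 * \<epsilon>\<close> each account for
    \<open>24 * \<epsilon>\<close>; all surplus time is spent in the first jump, from
    \<open>Y\<close> to \<open>p1\<close>.\<close>
  define s0 where "s0 = t - (T 1 + T 2 + T 3) - 18 * \<epsilon>"
  have s0: "6 * \<epsilon> \<le> s0" using t T_sum by (simp add: s0_def)
  \<comment> \<open>Each \<open>p\<close> is a point of the required family next to the position
    reached so far: rounding down supplies the lattice translate, 1/2 is added where the base line
    has it, and the coordinate still to be travelled is taken from \<open>Y\<close>.\<close>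
  define p1 p2 p3 :: "real ^ 3" where "p1 = vector [Y $ 1, fl (Y $ 2), fl (Y $ 3)]"
    and "p2 = vector [fl (X $ 1), Y $ 2, fl (Y $ 3) + 1/2]"
    and "p3 = vector [fl (X $ 1) + 1/2, fl (X $ 2) + 1/2, Y $ 3]"
  define q1 q2 q3 :: "real ^ 3" where "q1 = p1 + (X $ 1 - Y $ 1) *\<^sub>R axis 1 1"
    and "q2 = p2 + (X $ 2 - Y $ 2) *\<^sub>R axis 2 1" and "q3 = p3 + (X $ 3 - Y $ 3) *\<^sub>R axis 3 1"
  have fam: "p1 \<in> line_family 1" "p2 \<in> line_family 2" "p3 \<in> line_family 3"
    by (auto simp: line_family_def line_base_def forall_3 p1_def p2_def p3_def fl_Ints)
  note comps = p1_def p2_def p3_def q1_def q2_def q3_def axis_def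
  have "\<bar>(p1 - Y) $ i\<bar> \<le> 1" "\<bar>(p2 - q1) $ i\<bar> \<le> 1" "\<bar>(p3 - q2) $ i\<bar> \<le> 1" "\<bar>(X - q3) $ i\<bar> \<le> 1" for i
    using exhaust_3[of i] fl_le[of "Y $ 2"] fl_le[of "Y $ 3"] fl_le[of "X $ 1"] fl_le[of "X $ 2"]
    by (auto simp: comps abs_le_iff)
  note near = this
  \<comment> \<open>The chain follows the trajectory backwards in time, from \<open>X\<close> to
    \<open>Y\<close>.\<close>
  have "w (x, t) = w (\<epsilon> *\<^sub>R X, s0 + T 1 + 6 * \<epsilon> + T 2 + 6 * \<epsilon> + T 3 + 6 * \<epsilon>)"
    using \<epsilon> by (simp add: X_def s0_def)
  also have "\<dots> \<le> w (\<epsilon> *\<^sub>R q3, s0 + T 1 + 6 * \<epsilon> + T 2 + 6 * \<epsilon> + T 3)"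
    using s0 T0[of 1] T0[of 2] T0[of 3] \<epsilon> by (intro jump_step[OF w \<epsilon> _ near(4)]) auto
  also have "\<dots> \<le> w (\<epsilon> *\<^sub>R p3, s0 + T 1 + 6 * \<epsilon> + T 2 + 6 * \<epsilon>)"
    unfolding q3_def using s0 T0[of 1] T0[of 2] \<epsilon>
    by (intro line_step[OF w \<epsilon> _ fam(3)]) (auto simp: T_def)
  also have "\<dots> \<le> w (\<epsilon> *\<^sub>R q2, s0 + T 1 + 6 * \<epsilon> + T 2)"
    using s0 T0[of 1] T0[of 2] \<epsilon> by (intro jump_step[OF w \<epsilon> _ near(3)]) auto
  also have "\<dots> \<le> w (\<epsilon> *\<^sub>R p2, s0 + T 1 + 6 * \<epsilon>)"
    unfolding q2_def using s0 T0[of 1] \<epsilon>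
    by (intro line_step[OF w \<epsilon> _ fam(2)]) (auto simp: T_def)
  also have "\<dots> \<le> w (\<epsilon> *\<^sub>R q1, s0 + T 1)"
    using s0 T0[of 1] \<epsilon> by (intro jump_step[OF w \<epsilon> _ near(2)]) auto
  also have "\<dots> \<le> w (\<epsilon> *\<^sub>R p1, s0)"
    unfolding q1_def using s0 \<epsilon> by (intro line_step[OF w \<epsilon> _ fam(1)]) (auto simp: T_def)
  also have "\<dots> \<le> w (\<epsilon> *\<^sub>R Y, 0)"
    using jump_step[OF w \<epsilon> _ near(1) s0, of 0] by simp
  also have "\<dots> = g y" using w \<epsilon> by (simp add: Y_def Cauchy_viscosity_solution_def)
  finally show ?thesis .
qed

end

text \<open>By Hoelder duality every constant velocity with \<open>l1_norm\<close> at most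
  \<open>1 / \<delta>\<close> is admissible, so a straight ray does. Its tube radius is arbitrary
  because the Hamiltonian does not depend on position.\<close>

lemma upper_bound_infnorm:
  fixes w :: "(real ^ 'n) \<times> real \<Rightarrow> real"
  assumes w: "Cauchy_viscosity_solution (\<lambda>x q. infnorm q / \<delta>) g w"
    and \<delta>: "0 < \<delta>" and t: "\<delta> * l1_norm (y - x) \<le> t"
  shows "w (x, t) \<le> g y"
proof (cases "t = 0")
  case True
  then have "l1_norm (y - x) = 0"
    using t \<delta> l1_norm_nonneg[of "y - x"] by (simp add: mult_le_0_iff)
  then have "x = y" using norm_le_l1_norm[of "y - x"] by simp
  then show ?thesis using w True by (simp add: Cauchy_viscosity_solution_def)
next
  case False
  then have t0: "0 < t" using t \<delta> l1_norm_nonneg[of "y - x"] by (smt (verit) mult_nonneg_nonneg)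
  define b where "b = (1 / t) *\<^sub>R (x - y)"
  have b: "l1_norm b \<le> 1 / \<delta>"
    using t t0 \<delta> unfolding b_def l1_norm_scaleR l1_norm_minus_commute[of x y]
    by (simp add: field_simps)
  have "w (y + t *\<^sub>R b, 0 + t) \<le> w (y, 0)"
  proof (rule subsolution_decreasing_along_ray[where r = 1])
    show "viscosity_subsolution (UNIV \<times> {0<..}) (\<lambda>(x, t) (q, s). s + infnorm q / \<delta>) w"
      using w unfolding Cauchy_viscosity_solution_def viscosity_solution_def by blast
    fix q :: "real ^ 'n"
    show "b \<bullet> q \<le> infnorm q / \<delta>"
      using inner_le_l1_infnorm[of b q] mult_right_mono[OF b infnorm_pos_le[of q]] by simp
  qed (use t0 Cauchy_viscosity_solution_continuous[OF w] in auto)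
  then show ?thesis using w t0 by (simp add: b_def Cauchy_viscosity_solution_def)
qed

text \<open>A smoothing of \<open>\<delta>\<close> times the \<open>l\<^sup>1\<close> distance in perturbed coordinates \<open>h\<close> serves as the test
  function; the case without perturbation covers the effective equation.\<close>

lemma lower_bound:
  fixes h :: "'n::finite \<Rightarrow> real ^ 'n \<Rightarrow> real" and G :: "'n \<Rightarrow> real ^ 'n \<Rightarrow> real ^ 'n"
  assumes w: "Cauchy_viscosity_solution H g w"
    and g: "bounded (range g)" and L: "0 \<le> L" "\<And>x y. \<bar>g x - g y\<bar> \<le> L * norm (x - y)"
    and h: "\<And>i x. GDERIV (h i) x :> G i x" "\<And>i. continuous_on UNIV (G i)"
      "\<And>i x. \<bar>h i x - x $ i\<bar> \<le> 1/4"
    and \<delta>: "0 < \<delta>" and \<epsilon>: "0 < \<epsilon>"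
    and H: "\<And>x s c. (\<And>i. \<bar>s i\<bar> \<le> \<delta>) \<Longrightarrow> 0 \<le> c \<Longrightarrow>
      H x (- (c *\<^sub>R (\<Sum>i\<in>UNIV. s i *\<^sub>R G i ((1 / \<epsilon>) *\<^sub>R x)))) \<le> c"
    and t: "0 \<le> t" and B: "\<And>y. \<delta> * l1_norm (y - x0) \<le> t \<Longrightarrow> B \<le> g y"
  shows "B - 3/2 * CARD('n) * (L + 1) * \<epsilon> \<le> w (x0, t)"
proof -
  define N where "N = real CARD('n)"
  define r where "r = (\<lambda>i x. h i ((1 / \<epsilon>) *\<^sub>R x) - h i ((1 / \<epsilon>) *\<^sub>R x0))"
  \<comment> \<open>\<open>sqrt (1 + u\<^sup>2)\<close> smooths \<open>\<bar>u\<bar>\<close>, and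
    the factor \<open>\<epsilon>\<close> undoes the rescaling. The coefficients
    \<open>\<sigma>\<close> of its gradient are bounded by \<open>\<delta>\<close>, as the
    assumption on \<open>H\<close> demands.\<close>
  define D where "D = (\<lambda>x. \<Sum>i\<in>UNIV. \<epsilon> * \<delta> * sqrt (1 + (r i x)\<^sup>2))"
  define \<sigma> where "\<sigma> = (\<lambda>i x. \<delta> * (r i x / sqrt (1 + (r i x)\<^sup>2)))"
  define D' where "D' = (\<lambda>x. \<Sum>i\<in>UNIV. \<sigma> i x *\<^sub>R G i ((1 / \<epsilon>) *\<^sub>R x))"
  have sq_pos: "0 < 1 + u\<^sup>2" for u :: real by (rule add_pos_nonneg) auto
  have sq_ge: "\<bar>u\<bar> \<le> sqrt (1 + u\<^sup>2)" for u :: real by (rule real_le_rsqrt) simp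
  have r_deriv: "GDERIV (r i) x :> (1 / \<epsilon>) *\<^sub>R G i ((1 / \<epsilon>) *\<^sub>R x)" for i x
    unfolding r_def
    using GDERIV_diff[OF GDERIV_scaleR[OF h(1)] GDERIV_const] by simp
  have D_deriv: "GDERIV D x :> D' x" for x
    unfolding D_def D'_def
  proof (rule GDERIV_sum)
    fix i
    have "((\<lambda>u. \<epsilon> * \<delta> * sqrt (1 + u\<^sup>2)) has_real_derivative \<epsilon> * \<delta> * (u / sqrt (1 + u\<^sup>2))) (at u)" for u
      using sq_pos[of u] by (auto intro!: derivative_eq_intros simp: field_simps)
    from GDERIV_DERIV_compose[OF r_deriv this]
    have "GDERIV (\<lambda>x. \<epsilon> * \<delta> * sqrt (1 + (r i x)\<^sup>2)) x :>
        (\<epsilon> * \<delta> * (r i x / sqrt (1 + (r i x)\<^sup>2))) *\<^sub>R ((1 / \<epsilon>) *\<^sub>R G i ((1 / \<epsilon>) *\<^sub>R x))" .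
    then show "GDERIV (\<lambda>x. \<epsilon> * \<delta> * sqrt (1 + (r i x)\<^sup>2)) x :> \<sigma> i x *\<^sub>R G i ((1 / \<epsilon>) *\<^sub>R x)"
      using \<epsilon> by (simp add: \<sigma>_def)
  qed
  have D_cont: "continuous_on UNIV D'"
  proof -
    have "continuous_on UNIV (r i)" for i
      using r_deriv unfolding gderiv_def
      by (meson continuous_at_imp_continuous_on has_derivative_continuous)
    moreover have "continuous_on UNIV (\<lambda>x. G i ((1 / \<epsilon>) *\<^sub>R x))" for i
      by (rule continuous_on_compose2[OF h(2)]) (auto intro!: continuous_intros)
    moreover have "sqrt (1 + u\<^sup>2) \<noteq> 0" for u :: real using sq_pos[of u] by simp
    ultimately show ?thesis
      unfolding D'_def \<sigma>_def by (intro continuous_intros) auto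
  qed
  have \<sigma>_le: "\<bar>\<sigma> i x\<bar> \<le> \<delta>" for i x
  proof -
    have "\<bar>r i x / sqrt (1 + (r i x)\<^sup>2)\<bar> \<le> 1"
      using sq_ge[of "r i x"] sq_pos[of "r i x"] by (simp add: divide_le_eq_1)
    from mult_left_mono[OF this less_imp_le[OF \<delta>]] show ?thesis
      using \<delta> by (simp add: \<sigma>_def abs_mult)
  qed
  \<comment> \<open>Each \<open>h i\<close> is off by at most 1/4, so a difference loses at most
    1/2, which is \<open>\<epsilon> * \<delta> / 2\<close> per coordinate after scaling.\<close>
  have D_lower: "\<delta> * l1_norm (x - x0) - N * (\<epsilon> * \<delta> / 2) \<le> D x" for x
  proof -
    have "(\<Sum>i\<in>UNIV. \<delta> * \<bar>(x - x0) $ i\<bar> - \<epsilon> * \<delta> / 2) \<le> D x"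
      unfolding D_def
    proof (rule sum_mono)
      fix i
      have "\<bar>((1 / \<epsilon>) *\<^sub>R x) $ i - ((1 / \<epsilon>) *\<^sub>R x0) $ i\<bar> - 1/2 \<le> \<bar>r i x\<bar>"
        using h(3)[of i "(1 / \<epsilon>) *\<^sub>R x"] h(3)[of i "(1 / \<epsilon>) *\<^sub>R x0"] unfolding r_def by linarith
      moreover have "\<bar>((1 / \<epsilon>) *\<^sub>R x) $ i - ((1 / \<epsilon>) *\<^sub>R x0) $ i\<bar> = \<bar>(x - x0) $ i\<bar> / \<epsilon>"
        using \<epsilon> by (simp add: abs_divide flip: diff_divide_distrib)
      ultimately have "\<bar>(x - x0) $ i\<bar> / \<epsilon> - 1/2 \<le> sqrt (1 + (r i x)\<^sup>2)"
        using sq_ge[of "r i x"] by simp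
      from mult_left_mono[OF this, of "\<epsilon> * \<delta>"]
      show "\<delta> * \<bar>(x - x0) $ i\<bar> - \<epsilon> * \<delta> / 2 \<le> \<epsilon> * \<delta> * sqrt (1 + (r i x)\<^sup>2)"
        using \<epsilon> \<delta> by (simp add: right_diff_distrib)
    qed
    then show ?thesis by (simp add: l1_norm_def sum_subtractf sum_distrib_left N_def)
  qed
  have D_x0: "D x0 = N * (\<epsilon> * \<delta>)" by (simp add: D_def r_def N_def)
  obtain Gb where Gb: "\<And>x. \<bar>g x\<bar> \<le> Gb" using g by (auto simp: bounded_iff)
  obtain K where K: "K-lipschitz_on (UNIV \<times> {0..}) w"
    using w by (auto simp: Cauchy_viscosity_solution_def)
  have w0: "w (x, 0) = g x" for x using w by (simp add: Cauchy_viscosity_solution_def)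
  \<comment> \<open>Steep enough for the penalty to compensate the variation of \<open>g\<close>
    outside the ball; the added 1 keeps \<open>k\<close> positive when \<open>L = 0\<close>.\<close>
  define k where "k = (L + 1) / \<delta>"
  have k: "0 < k" "L \<le> k * \<delta>" using L \<delta> by (auto simp: k_def)
  have "B - k * (N * (\<epsilon> * \<delta> / 2)) \<le> w (x0, t) + k * D x0"
  proof (rule supersolution_lower_bound[where w = w and H = H and D = D and D' = D'
        and \<alpha> = \<delta> and \<beta> = "N * (\<epsilon> * \<delta> / 2)" and G = Gb and K = K])
    show "continuous_on (UNIV \<times> {0..}) w" by (rule Cauchy_viscosity_solution_continuous[OF w])
    show "viscosity_supersolution (UNIV \<times> {0<..}) (\<lambda>(x, t) (q, s). s + H x q) w"
      using w unfolding Cauchy_viscosity_solution_def viscosity_solution_def by blast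
    show "- Gb - K * s \<le> w (x, s)" if "0 \<le> s" for x s
      using lipschitz_onD[OF K, of "(x, s)" "(x, 0)"] that Gb[of x] w0[of x]
      by (simp add: dist_Pair_Pair dist_real_def)
    show "C1_with_gradient UNIV D D'" using D_deriv D_cont by (simp add: C1_with_gradient_def)
    show "0 \<le> D x" for x unfolding D_def using \<epsilon> \<delta> by (intro sum_nonneg mult_nonneg_nonneg) auto
    show "\<delta> * norm (x - x0) - N * (\<epsilon> * \<delta> / 2) \<le> D x" for x
      using D_lower[of x] mult_left_mono[OF norm_le_l1_norm[of "x - x0"] less_imp_le[OF \<delta>]]
      by linarith
    show "H x (- (c *\<^sub>R D' x)) \<le> c" if "0 \<le> c" for x c
      unfolding D'_def using \<sigma>_le that by (rule H)
    fix x
    define R where "R = l1_norm (x - x0)"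
    have R0: "0 \<le> R" by (simp add: R_def l1_norm_nonneg)
    have "B - k * max 0 (\<delta> * R - t) \<le> g x"
    proof (cases "\<delta> * R \<le> t")
      case True
      then show ?thesis using B[of x] by (simp add: R_def)
    next
      case False
      then have R: "0 < R" "t < \<delta> * R" using \<delta> R0 t by (auto simp: order_less_le)
      \<comment> \<open>Chosen so that \<open>y\<close> is the point of the segment from
        \<open>x0\<close> to \<open>x\<close> on the boundary of the \<open>l1_norm\<close>
        ball.\<close>
      define \<theta> where "\<theta> = t / (\<delta> * R)"
      have \<theta>: "0 \<le> \<theta>" "\<theta> \<le> 1" using R t \<delta> by (auto simp: \<theta>_def)
      define y where "y = x0 + \<theta> *\<^sub>R (x - x0)"
      have "\<delta> * l1_norm (y - x0) = t"
        using R \<delta> \<theta> by (simp add: y_def l1_norm_scaleR flip: R_def) (simp add: \<theta>_def)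
      then have By: "B \<le> g y" by (intro B) simp
      have "x - y = (1 - \<theta>) *\<^sub>R (x - x0)" by (simp add: y_def algebra_simps)
      then have "norm (x - y) \<le> (1 - \<theta>) * R"
        using norm_le_l1_norm[of "x - y"] \<theta> by (simp add: l1_norm_scaleR R_def)
      then have "L * norm (x - y) \<le> L * ((1 - \<theta>) * R)" using L by (intro mult_left_mono)
      also have "\<dots> \<le> (k * \<delta>) * ((1 - \<theta>) * R)" using k \<theta> R by (intro mult_right_mono) auto
      also have "\<dots> = k * (\<delta> * R - t)"
      proof -
        have "\<theta> * (\<delta> * R) = t" using R \<delta> by (simp add: \<theta>_def)
        then show ?thesis by (simp add: algebra_simps)
      qed
      finally show ?thesis using By L(2)[of x y] R by simp
    qed
    moreover have "k * max 0 (\<delta> * R - t) \<le> k * (max 0 (D x - t) + N * (\<epsilon> * \<delta> / 2))"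
    proof (rule mult_left_mono)
      have "0 \<le> N * (\<epsilon> * \<delta> / 2)" using \<epsilon> \<delta> by (simp add: N_def)
      then show "max 0 (\<delta> * R - t) \<le> max 0 (D x - t) + N * (\<epsilon> * \<delta> / 2)"
        using D_lower[of x] by (simp add: R_def max_def)
    qed (use k in simp)
    ultimately show "B - k * (N * (\<epsilon> * \<delta> / 2)) \<le> w (x, 0) + k * max 0 (D x - t)"
      by (simp add: w0 distrib_left)
  qed (use \<delta> k t in auto)
  \<comment> \<open>The smoothing at the centre contributes one unit
    \<open>N * (L + 1) * \<epsilon>\<close>, the perturbation of the coordinates half a
    unit.\<close>
  moreover have "k * (N * (\<epsilon> * \<delta> / 2)) + k * D x0 = 3/2 * N * (L + 1) * \<epsilon>"
    using \<delta> by (simp add: D_x0 k_def field_simps)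
  ultimately show ?thesis by (simp add: N_def)
qed

section \<open>The effective Hamiltonian\<close>

text \<open>An upper bound on the pointwise Lipschitz constant. It implies the subsolution
  inequality for \<open>norm q / a\<close> and survives maxima, local gluing and translation
  directly, without test functions.\<close>

definition slope_le :: "('a::real_normed_vector \<Rightarrow> real) \<Rightarrow> 'a \<Rightarrow> real \<Rightarrow> bool" where
  "slope_le f x b \<longleftrightarrow> (\<forall>e>0. \<exists>d>0. \<forall>y. norm (y - x) < d \<longrightarrow> \<bar>f y - f x\<bar> \<le> (b + e) * norm (y - x))"

lemma slope_leD:
  assumes "slope_le f x b" "0 < e"
  obtains d where "d > 0" "\<And>y. norm (y - x) < d \<Longrightarrow> \<bar>f y - f x\<bar> \<le> (b + e) * norm (y - x)"
  using assms unfolding slope_le_def by blast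

lemma slope_le_mono:
  assumes "slope_le f x b" "b \<le> c"
  shows "slope_le f x c"
  unfolding slope_le_def
proof (intro allI impI)
  fix e :: real assume "0 < e"
  with assms(1) obtain d where d: "d > 0" "\<And>y. norm (y - x) < d \<Longrightarrow> \<bar>f y - f x\<bar> \<le> (b + e) * norm (y - x)"
    by (rule slope_leD) blast
  have "(b + e) * norm (y - x) \<le> (c + e) * norm (y - x)" for y
    using assms(2) by (intro mult_right_mono) auto
  with d show "\<exists>d>0. \<forall>y. norm (y - x) < d \<longrightarrow> \<bar>f y - f x\<bar> \<le> (c + e) * norm (y - x)"
    by (meson order_trans)
qed

lemma slope_le_isCont:
  assumes "slope_le f x b"
  shows "isCont f x"
proof -
  obtain d where d: "d > 0" "\<And>y. norm (y - x) < d \<Longrightarrow> \<bar>f y - f x\<bar> \<le> (b + 1) * norm (y - x)"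
    using slope_leD[OF assms zero_less_one] by blast
  have "((\<lambda>y. f y - f x) \<longlongrightarrow> 0) (at x)"
  proof (rule Lim_null_comparison)
    show "\<forall>\<^sub>F y in at x. norm (f y - f x) \<le> (b + 1) * norm (y - x)"
      using d unfolding eventually_at dist_norm by (intro exI[of _ d]) auto
    have "((\<lambda>y. (b + 1) * norm (y - x)) \<longlongrightarrow> (b + 1) * norm (x - x)) (at x)"
      by (intro tendsto_intros)
    then show "((\<lambda>y. (b + 1) * norm (y - x)) \<longlongrightarrow> 0) (at x)" by simp
  qed
  then show ?thesis by (simp add: isCont_def LIM_zero_iff)
qed

lemma slope_le_local:
  assumes "slope_le f x b" "0 < d" "\<And>y. norm (y - x) < d \<Longrightarrow> g y = f y"
  shows "slope_le g x b"
  unfolding slope_le_def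
proof (intro allI impI)
  fix e :: real assume "0 < e"
  with assms(1) obtain r where r: "r > 0" "\<And>y. norm (y - x) < r \<Longrightarrow> \<bar>f y - f x\<bar> \<le> (b + e) * norm (y - x)"
    by (rule slope_leD) blast
  show "\<exists>d>0. \<forall>y. norm (y - x) < d \<longrightarrow> \<bar>g y - g x\<bar> \<le> (b + e) * norm (y - x)"
    using r assms(2,3) by (intro exI[of _ "min d r"]) auto
qed

lemma slope_le_max:
  assumes "slope_le f x b" "slope_le g x b"
  shows "slope_le (\<lambda>y. max (f y) (g y)) x b"
  unfolding slope_le_def
proof (intro allI impI)
  fix e :: real assume e: "0 < e"
  obtain r where r: "r > 0" "\<And>y. norm (y - x) < r \<Longrightarrow> \<bar>f y - f x\<bar> \<le> (b + e) * norm (y - x)"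
    using assms(1) e by (rule slope_leD) blast
  obtain s where s: "s > 0" "\<And>y. norm (y - x) < s \<Longrightarrow> \<bar>g y - g x\<bar> \<le> (b + e) * norm (y - x)"
    using assms(2) e by (rule slope_leD) blast
  show "\<exists>d>0. \<forall>y. norm (y - x) < d \<longrightarrow> \<bar>max (f y) (g y) - max (f x) (g x)\<bar> \<le> (b + e) * norm (y - x)"
  proof (intro exI[of _ "min r s"] conjI allI impI)
    fix y assume "norm (y - x) < min r s"
    then show "\<bar>max (f y) (g y) - max (f x) (g x)\<bar> \<le> (b + e) * norm (y - x)"
      using r(2)[of y] s(2)[of y] by (auto simp: max_def abs_le_iff)
  qed (use r s in auto)
qed

lemma slope_le_GDERIV:
  assumes "GDERIV f x :> d" "norm d \<le> b"
  shows "slope_le f x b"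
  unfolding slope_le_def
proof (intro allI impI)
  fix e :: real assume e: "0 < e"
  obtain r where r: "r > 0" "\<And>y. norm (y - x) < r \<Longrightarrow> \<bar>f y - f x - (y - x) \<bullet> d\<bar> \<le> e * norm (y - x)"
    using assms(1) e unfolding gderiv_def has_derivative_at_alt by auto
  show "\<exists>d>0. \<forall>y. norm (y - x) < d \<longrightarrow> \<bar>f y - f x\<bar> \<le> (b + e) * norm (y - x)"
  proof (intro exI[of _ r] conjI allI impI)
    fix y assume "norm (y - x) < r"
    moreover have "\<bar>(y - x) \<bullet> d\<bar> \<le> norm (y - x) * b"
      using Cauchy_Schwarz_ineq2[of "y - x" d] assms(2) by (meson mult_left_mono norm_ge_zero order_trans)
    ultimately show "\<bar>f y - f x\<bar> \<le> (b + e) * norm (y - x)"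
      using r(2)[of y] by (simp add: algebra_simps)
  qed (use r in auto)
qed

lemma slope_le_translation:
  assumes "slope_le f (x - z) b"
  shows "slope_le (\<lambda>y. f (y - z) + c) x b"
  unfolding slope_le_def
proof (intro allI impI)
  fix e :: real assume "0 < e"
  with assms obtain r where r: "r > 0"
    "\<And>y. norm (y - (x - z)) < r \<Longrightarrow> \<bar>f y - f (x - z)\<bar> \<le> (b + e) * norm (y - (x - z))"
    by (rule slope_leD) blast
  show "\<exists>d>0. \<forall>y. norm (y - x) < d \<longrightarrow> \<bar>f (y - z) + c - (f (x - z) + c)\<bar> \<le> (b + e) * norm (y - x)"
    using r(1) r(2)[of "_ - z"] by (intro exI[of _ r]) simp
qed

text \<open>The slope is centred at a point, so a short interval containing it is split there;
  bisection in the form of \<open>Bolzano\<close> then adds up the increments along the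
  segment.\<close>

lemma slope_le_segment:
  assumes "\<And>x. x \<in> closed_segment p q \<Longrightarrow> slope_le f x b"
  shows "\<bar>f q - f p\<bar> \<le> b * norm (q - p)"
proof (rule field_le_epsilon)
  fix \<epsilon> :: real assume \<epsilon>: "0 < \<epsilon>"
  define e where "e = \<epsilon> / (norm (q - p) + 1)"
  have n1: "0 < norm (q - p) + 1" by (simp add: add_nonneg_pos)
  have e: "0 < e" using \<epsilon> n1 by (simp add: e_def)
  define \<gamma> where "\<gamma> = (\<lambda>s::real. p + s *\<^sub>R (q - p))"
  have \<gamma>: "norm (\<gamma> s - \<gamma> t) = \<bar>s - t\<bar> * norm (q - p)" for s t
    by (simp add: \<gamma>_def flip: norm_scaleR) (simp add: algebra_simps)
  have "\<bar>f (\<gamma> 1) - f (\<gamma> 0)\<bar> \<le> (b + e) * ((1 - 0) * norm (q - p))"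
  proof (rule Bolzano[where P = "\<lambda>s t. \<bar>f (\<gamma> t) - f (\<gamma> s)\<bar> \<le> (b + e) * ((t - s) * norm (q - p))"])
    fix s t u :: real
    assume "\<bar>f (\<gamma> t) - f (\<gamma> s)\<bar> \<le> (b + e) * ((t - s) * norm (q - p))"
      "\<bar>f (\<gamma> u) - f (\<gamma> t)\<bar> \<le> (b + e) * ((u - t) * norm (q - p))"
    moreover have "(b + e) * ((t - s) * norm (q - p)) + (b + e) * ((u - t) * norm (q - p))
        = (b + e) * ((u - s) * norm (q - p))" by (simp add: algebra_simps)
    ultimately show "\<bar>f (\<gamma> u) - f (\<gamma> s)\<bar> \<le> (b + e) * ((u - s) * norm (q - p))" by linarith
  next
    fix x :: real assume x: "0 \<le> x" "x \<le> 1"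
    then have "\<gamma> x \<in> closed_segment p q"
      by (auto simp: \<gamma>_def in_segment algebra_simps intro!: exI[of _ x])
    then obtain d where d: "d > 0"
      "\<And>y. norm (y - \<gamma> x) < d \<Longrightarrow> \<bar>f y - f (\<gamma> x)\<bar> \<le> (b + e) * norm (y - \<gamma> x)"
      using slope_leD[OF assms e] by blast
    show "\<exists>d>0. \<forall>s t. s \<le> x \<and> x \<le> t \<and> t - s < d \<longrightarrow>
        \<bar>f (\<gamma> t) - f (\<gamma> s)\<bar> \<le> (b + e) * ((t - s) * norm (q - p))"
    proof (intro exI[of _ "d / (norm (q - p) + 1)"] conjI allI impI)
      fix s t assume st: "s \<le> x \<and> x \<le> t \<and> t - s < d / (norm (q - p) + 1)"
      have near: "norm (\<gamma> r - \<gamma> x) < d" if "s \<le> r" "r \<le> t" for r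
      proof -
        have "\<bar>r - x\<bar> * norm (q - p) \<le> (t - s) * (norm (q - p) + 1)"
          using st that by (intro mult_mono) auto
        also have "\<dots> < d" using st n1 by (simp add: field_simps)
        finally show ?thesis by (simp add: \<gamma>)
      qed
      have "\<bar>f (\<gamma> t) - f (\<gamma> x)\<bar> \<le> (b + e) * ((t - x) * norm (q - p))"
        using d(2)[OF near[of t]] st by (simp add: \<gamma>)
      moreover have "\<bar>f (\<gamma> s) - f (\<gamma> x)\<bar> \<le> (b + e) * ((x - s) * norm (q - p))"
        using d(2)[OF near[of s]] st by (simp add: \<gamma>)
      moreover have "(b + e) * ((t - x) * norm (q - p)) + (b + e) * ((x - s) * norm (q - p))
          = (b + e) * ((t - s) * norm (q - p))" by (simp add: algebra_simps)
      ultimately show "\<bar>f (\<gamma> t) - f (\<gamma> s)\<bar> \<le> (b + e) * ((t - s) * norm (q - p))" by linarith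
    qed (use d n1 in simp)
  qed simp
  moreover have "e * norm (q - p) \<le> \<epsilon>" using \<epsilon> n1 by (simp add: e_def field_simps)
  ultimately show "\<bar>f q - f p\<bar> \<le> b * norm (q - p) + \<epsilon>"
    by (simp add: \<gamma>_def algebra_simps)
qed

text \<open>The slope bound is stable under suprema because it amounts to a Lipschitz bound on small
  balls that is uniform in the family.\<close>

lemma slope_le_SUP:
  fixes F :: "('a::real_normed_vector \<Rightarrow> real) set"
  assumes slope: "\<And>f y. f \<in> F \<Longrightarrow> slope_le f y (b y)" and b: "continuous_on UNIV b"
    and ne: "F \<noteq> {}" and bdd: "\<And>y. bdd_above ((\<lambda>f. f y) ` F)"
  shows "slope_le (\<lambda>y. SUP f\<in>F. f y) x (b x)"
  unfolding slope_le_def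
proof (intro allI impI)
  fix e :: real assume e: "0 < e"
  have "isCont b x" using b by (simp add: continuous_on_eq_continuous_at)
  then obtain d where d: "d > 0" "\<And>y. dist y x < d \<Longrightarrow> dist (b y) (b x) < e"
    unfolding continuous_at_eps_delta using e by metis
  show "\<exists>d>0. \<forall>y. norm (y - x) < d \<longrightarrow> \<bar>(SUP f\<in>F. f y) - (SUP f\<in>F. f x)\<bar> \<le> (b x + e) * norm (y - x)"
  proof (intro exI[of _ d] conjI allI impI)
    fix y assume y: "norm (y - x) < d"
    have lip: "\<bar>f y - f x\<bar> \<le> (b x + e) * norm (y - x)" if f: "f \<in> F" for f
    proof (rule slope_le_segment)
      fix z assume "z \<in> closed_segment x y"
      then have "norm (z - x) \<le> norm (y - x)" using segment_bound1 by blast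
      then have "b z \<le> b x + e" using d(2)[of z] y by (simp add: dist_norm)
      with slope[OF f] show "slope_le f z (b x + e)" by (rule slope_le_mono)
    qed
    have le: "(SUP f\<in>F. f u) \<le> (SUP f\<in>F. f v) + (b x + e) * norm (y - x)"
      if "\<And>f. f \<in> F \<Longrightarrow> f u \<le> f v + (b x + e) * norm (y - x)" for u v
    proof (rule cSUP_least[OF ne])
      fix f assume f: "f \<in> F"
      have "f v \<le> (SUP f\<in>F. f v)" by (rule cSUP_upper[OF f bdd])
      with that[OF f] show "f u \<le> (SUP f\<in>F. f v) + (b x + e) * norm (y - x)" by linarith
    qed
    have "f y \<le> f x + (b x + e) * norm (y - x)" "f x \<le> f y + (b x + e) * norm (y - x)" if "f \<in> F" for f
      using lip[OF that] by (auto simp: abs_le_iff)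
    from le[where u = y and v = x, OF this(1)] le[where u = x and v = y, OF this(2)]
    show "\<bar>(SUP f\<in>F. f y) - (SUP f\<in>F. f x)\<bar> \<le> (b x + e) * norm (y - x)" by (auto simp: abs_le_iff)
  qed (use d in simp)
qed

text \<open>On a small step from \<open>x\<close> against \<open>d\<close> the test function falls
  at rate \<open>norm d\<close>. At a local maximum of \<open>f - \<psi>\<close> the function
  \<open>f\<close> falls at least as fast, and its slope caps that rate.\<close>

lemma slope_le_imp_gradient_le:
  assumes f: "slope_le f x b" and b: "0 \<le> b" and \<psi>: "GDERIV \<psi> x :> d"
    and touch: "\<forall>\<^sub>F y in at x. f y - \<psi> y \<le> f x - \<psi> x"
  shows "norm d \<le> b"
proof (cases "d = 0")
  case False
  show ?thesis
  proof (rule field_le_epsilon)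
    fix \<epsilon> :: real assume \<epsilon>: "0 < \<epsilon>"
    then have e: "0 < \<epsilon> / 2" by simp
    obtain r1 where r1: "r1 > 0" "\<And>y. norm (y - x) < r1 \<Longrightarrow> \<bar>f y - f x\<bar> \<le> (b + \<epsilon> / 2) * norm (y - x)"
      using f e by (rule slope_leD) blast
    obtain r2 where r2: "r2 > 0"
      "\<And>y. norm (y - x) < r2 \<Longrightarrow> \<bar>\<psi> y - \<psi> x - (y - x) \<bullet> d\<bar> \<le> \<epsilon> / 2 * norm (y - x)"
      using \<psi> e unfolding gderiv_def has_derivative_at_alt by (metis real_norm_def)
    obtain r3 where r3: "r3 > 0" "\<And>y. y \<noteq> x \<Longrightarrow> dist y x < r3 \<Longrightarrow> f y - \<psi> y \<le> f x - \<psi> x"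
      using touch unfolding eventually_at by auto
    define s where "s = min (min r1 r2) r3 / 2"
    have s: "0 < s" "s < r1" "s < r2" "s < r3" using r1 r2 r3 by (auto simp: s_def)
    define y where "y = x - (s / norm d) *\<^sub>R d"
    have yx: "norm (y - x) = s" using False s by (simp add: y_def)
    have dist: "dist y x < r3" and neq: "y \<noteq> x" using yx s by (auto simp: dist_norm)
    have "(y - x) \<bullet> d = - (s * norm d)"
      using False by (simp add: y_def dot_square_norm power2_eq_square)
    moreover have "\<bar>\<psi> y - \<psi> x - (y - x) \<bullet> d\<bar> \<le> \<epsilon> / 2 * s" using r2(2)[of y] yx s by simp
    ultimately have "\<psi> y - \<psi> x \<le> - (s * norm d) + \<epsilon> / 2 * s" by linarith
    moreover have "- ((b + \<epsilon> / 2) * s) \<le> f y - f x" using r1(2)[of y] yx s by (simp add: abs_le_iff)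
    moreover have "f y - \<psi> y \<le> f x - \<psi> x" by (rule r3(2)[OF neq dist])
    ultimately have "s * norm d \<le> s * (b + \<epsilon>)" by (simp add: algebra_simps)
    then show "norm d \<le> b + \<epsilon>" using s by simp
  qed
qed (use b in simp)

lemma closed_line_family: "closed (line_family i)"
proof -
  have "line_family i = (\<Inter>j\<in>UNIV - {i}. (\<lambda>x. x $ j - line_base i $ j) -` \<int>)"
    by (auto simp: line_family_def)
  also have "closed \<dots>"
    by (intro closed_INT ballI closed_vimage continuous_intros closed_Ints)
  finally show ?thesis .
qed

lemma line_family_translation:
  "y \<in> line_family i \<Longrightarrow> z \<in> integer_lattice \<Longrightarrow> y + z \<in> line_family i"
  by (auto simp: line_family_def integer_lattice_def add_diff_eq[symmetric] add.commute[of "_ $ _" "z $ _"])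

lemma uminus_integer_lattice: "z \<in> integer_lattice \<Longrightarrow> - z \<in> integer_lattice"
  by (simp add: integer_lattice_def)

lemma integer_lattice_to_unit_cube:
  obtains z where "z \<in> integer_lattice" "(x :: real ^ 'n) + z \<in> cbox 0 1"
proof
  show "(\<chi> i. - of_int \<lfloor>x $ i\<rfloor>) \<in> integer_lattice" by (simp add: integer_lattice_def)
  have "0 \<le> x $ i - of_int \<lfloor>x $ i\<rfloor> \<and> x $ i - of_int \<lfloor>x $ i\<rfloor> \<le> 1" for i
    using of_int_floor_le[of "x $ i"] real_of_int_floor_add_one_ge[of "x $ i"] by linarith
  then show "x + (\<chi> i. - of_int \<lfloor>x $ i\<rfloor>) \<in> cbox 0 1" by (simp add: mem_box_cart)
qed

section \<open>Two-sided bounds on the cell constant\<close>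

context line_medium begin

abbreviation hamiltonian :: "real ^ 3 \<Rightarrow> real ^ 3 \<Rightarrow> real" where
  "hamiltonian y q \<equiv> 1 / a y * norm q"

definition calibration :: "real ^ 3 \<Rightarrow> real ^ 3 \<Rightarrow> real" where
  "calibration p x = (\<Sum>i\<in>UNIV. p $ i * flat_coord i x)"

definition calibration_grad :: "real ^ 3 \<Rightarrow> real ^ 3 \<Rightarrow> real ^ 3" where
  "calibration_grad p x = (\<Sum>i\<in>UNIV. p $ i *\<^sub>R flat_coord_grad i x)"

lemma GDERIV_calibration: "GDERIV (calibration p) x :> calibration_grad p x"
  unfolding calibration_def[abs_def] calibration_grad_def
proof (rule GDERIV_sum)
  fix i
  show "GDERIV (\<lambda>x. p $ i * flat_coord i x) x :> p $ i *\<^sub>R flat_coord_grad i x"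
    using GDERIV_mult[OF GDERIV_const GDERIV_flat_coord, of "p $ i"] by simp
qed

lemma calibration_grad_le: "norm (calibration_grad p x) \<le> infnorm p / \<delta> * a x"
  unfolding calibration_grad_def
  by (rule flat_coord_combination_bound) (rule component_le_infnorm_cart)

lemma calibration_periodic:
  "z \<in> integer_lattice \<Longrightarrow> calibration p (x + z) = calibration p x + p \<bullet> z"
  by (simp add: calibration_def flat_coord_periodic inner_vec_def distrib_left sum.distrib)

lemma calibration_grad_line_family:
  assumes "x \<in> line_family l"
  shows "calibration_grad p x = p $ l *\<^sub>R axis l 1"
proof -
  have x: "x \<in> tube (1/100) l" using assms line_family_subset_tube by (metis subsetD zero_less_divide_1_iff zero_less_numeral)
  have "calibration_grad p x = (\<Sum>i\<in>UNIV. if i = l then p $ l *\<^sub>R axis l 1 else 0)"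
    unfolding calibration_grad_def
    by (rule sum.cong) (auto simp: flat_coord_grad_own_tube[OF x] flat_coord_grad_other_tube[OF x])
  then show ?thesis by simp
qed

text \<open>\<open>calibration p x - p \<bullet> x\<close> is periodic, so \<open>v\<close> minus
  this function has a global minimum. There it is an admissible test function, and
  \<open>calibration_grad_le\<close> controls the Hamiltonian.\<close>

lemma cell_constant_le:
  assumes "cell_problem_solution hamiltonian p c v"
  shows "c \<le> infnorm p / \<delta>"
proof -
  define \<phi> where "\<phi> = (\<lambda>x. calibration p x - p \<bullet> x)"
  define D\<phi> where "D\<phi> = (\<lambda>x. calibration_grad p x - p)"
  have deriv: "GDERIV \<phi> x :> D\<phi> x" for x
  proof -
    have "GDERIV (\<lambda>x. p \<bullet> x) x :> p"
      unfolding gderiv_def by (auto intro!: derivative_eq_intros simp: inner_commute)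
    with GDERIV_calibration show ?thesis unfolding \<phi>_def D\<phi>_def by (rule GDERIV_diff)
  qed
  have C1: "C1_with_gradient UNIV \<phi> D\<phi>"
    unfolding C1_with_gradient_def D\<phi>_def calibration_grad_def
    using deriv by (auto simp: D\<phi>_def calibration_grad_def intro!: continuous_intros continuous_flat_coord_grad)
  have v: "continuous_on UNIV v" "periodic v" "viscosity_supersolution UNIV (\<lambda>y q. hamiltonian y (p + q) - c) v"
    using assms by (auto simp: cell_problem_solution_def viscosity_solution_def)
  have "continuous_on UNIV \<phi>" using deriv unfolding gderiv_def
    by (meson continuous_at_imp_continuous_on has_derivative_continuous)
  with v(1) have "continuous_on (cbox 0 1) (\<lambda>x. v x - \<phi> x)"
    by (intro continuous_intros) (auto intro: continuous_on_subset)
  moreover have "cbox 0 1 \<noteq> ({} :: (real ^ 3) set)" using integer_lattice_to_unit_cube by blast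
  ultimately obtain x where min: "\<And>y. y \<in> cbox 0 1 \<Longrightarrow> v x - \<phi> x \<le> v y - \<phi> y"
    using continuous_attains_inf[OF compact_cbox, of 0 "1 :: real ^ 3"] by blast
  have "v y - \<phi> y \<ge> v x - \<phi> x" for y
  proof -
    obtain z where z: "z \<in> integer_lattice" "y + z \<in> cbox 0 1" by (rule integer_lattice_to_unit_cube)
    have "v (y + z) = v y" using v(2) z(1) by (simp add: periodic_def)
    moreover have "\<phi> (y + z) = \<phi> y" using z(1) by (simp add: \<phi>_def calibration_periodic inner_add_right)
    ultimately show ?thesis using min[OF z(2)] by simp
  qed
  then have "\<forall>\<^sub>F y in at x within UNIV. v y - \<phi> y \<ge> v x - \<phi> x" by (intro always_eventually allI)
  with v(3) C1 have "hamiltonian x (p + D\<phi> x) - c \<ge> 0"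
    unfolding viscosity_supersolution_def by blast
  moreover have "hamiltonian x (p + D\<phi> x) \<le> infnorm p / \<delta>"
    using calibration_grad_le[of p x] a_pos[of x] by (simp add: D\<phi>_def field_simps)
  ultimately show ?thesis by linarith
qed

text \<open>Makes the travel estimate available for correctors. Freezing time gives a spatial test
  function for \<open>v\<close>; freezing position, where the function is affine in time, forces the
  time derivative to be \<open>- c\<close>.\<close>

lemma cell_subsolution_imp_Cauchy:
  assumes "viscosity_subsolution UNIV (\<lambda>y q. hamiltonian y (p + q) - c) v"
  shows "viscosity_subsolution (UNIV \<times> {0<..}) (\<lambda>(x, t) (q, s). s + hamiltonian x q)
           (\<lambda>(x, t). p \<bullet> x + v x - c * t)"
  unfolding viscosity_subsolution_def
proof (intro allI ballI impI)
  let ?w = "\<lambda>(x, t). p \<bullet> x + v x - c * t"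
  fix \<phi> :: "(real ^ 3) \<times> real \<Rightarrow> real" and D\<phi> z
  assume z: "z \<in> UNIV \<times> {0<..}" and C1: "C1_with_gradient (UNIV \<times> {0<..}) \<phi> D\<phi>"
    and max: "\<forall>\<^sub>F y in at z within UNIV \<times> {0<..}. ?w y - \<phi> y \<le> ?w z - \<phi> z"
  obtain x t where xt: "z = (x, t)" "0 < t" using z by auto
  have deriv: "(\<phi> has_derivative (\<lambda>h. h \<bullet> D\<phi> (y, t))) (at (y, t))" for y
    using C1 xt by (auto simp: C1_with_gradient_def gderiv_def)
  obtain r where r: "r > 0" "\<And>y. y \<in> UNIV \<times> {0<..} \<Longrightarrow> y \<noteq> z \<Longrightarrow> dist y z < r \<Longrightarrow> ?w y - \<phi> y \<le> ?w z - \<phi> z"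
    using max unfolding eventually_at by auto
  define \<psi> where "\<psi> = (\<lambda>y. \<phi> (y, t) - p \<bullet> y)"
  define D\<psi> where "D\<psi> = (\<lambda>y. fst (D\<phi> (y, t)) - p)"
  have "C1_with_gradient UNIV \<psi> D\<psi>"
    unfolding C1_with_gradient_def
  proof (intro conjI ballI)
    fix y :: "real ^ 3"
    have "((\<lambda>y. (y, t)) has_derivative (\<lambda>h. (h, 0))) (at y)" by (auto intro!: derivative_eq_intros)
    from has_derivative_compose[where g = \<phi>, OF this, OF deriv]
    have "((\<lambda>y. \<phi> (y, t)) has_derivative (\<lambda>h. h \<bullet> fst (D\<phi> (y, t)))) (at y)"
      by (simp add: inner_prod_def)
    then show "GDERIV \<psi> y :> D\<psi> y"
      unfolding gderiv_def \<psi>_def D\<psi>_def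
      by (auto intro!: derivative_eq_intros simp: inner_diff_right inner_commute)
    have "continuous_on UNIV (\<lambda>y. D\<phi> (y, t))"
      by (rule continuous_on_compose2[of "UNIV \<times> {0<..}" D\<phi>])
        (use C1 xt in \<open>auto simp: C1_with_gradient_def intro!: continuous_intros\<close>)
    then show "continuous_on UNIV D\<psi>" unfolding D\<psi>_def by (intro continuous_intros)
  qed
  moreover have "\<forall>\<^sub>F y in at x within UNIV. v y - \<psi> y \<le> v x - \<psi> x"
    unfolding eventually_at
  proof (intro exI[of _ r] conjI ballI impI)
    fix y assume "y \<noteq> x \<and> dist y x < r"
    then have "?w (y, t) - \<phi> (y, t) \<le> ?w z - \<phi> z"
      using xt by (intro r(2)) (auto simp: dist_Pair_Pair)
    then show "v y - \<psi> y \<le> v x - \<psi> x" by (simp add: xt \<psi>_def)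
  qed (rule r(1))
  ultimately have "hamiltonian x (p + D\<psi> x) - c \<le> 0"
    using assms unfolding viscosity_subsolution_def by blast
  moreover have "snd (D\<phi> (x, t)) = - c"
  proof -
    have "((\<lambda>s. (x, s)) has_derivative (\<lambda>h. (0, h))) (at t)" by (auto intro!: derivative_eq_intros)
    from has_derivative_compose[where g = \<phi>, OF this, OF deriv]
    have "((\<lambda>s. \<phi> (x, s)) has_real_derivative snd (D\<phi> (x, t))) (at t)"
      by (simp add: inner_prod_def has_field_derivative_def mult_commute_abs)
    then have "((\<lambda>s. - c * s - \<phi> (x, s)) has_real_derivative (- c - snd (D\<phi> (x, t)))) (at t)"
      by (auto intro!: derivative_eq_intros)
    moreover have "\<forall>s. \<bar>t - s\<bar> < min r t \<longrightarrow> - c * s - \<phi> (x, s) \<le> - c * t - \<phi> (x, t)"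
    proof (intro allI impI)
      fix s assume s: "\<bar>t - s\<bar> < min r t"
      show "- c * s - \<phi> (x, s) \<le> - c * t - \<phi> (x, t)"
      proof (cases "s = t")
        case False
        then have "?w (x, s) - \<phi> (x, s) \<le> ?w z - \<phi> z"
          using xt s by (intro r(2)) (auto simp: dist_Pair_Pair dist_real_def)
        then show ?thesis by (simp add: xt)
      qed simp
    qed
    ultimately have "- c - snd (D\<phi> (x, t)) = 0"
      using r(1) xt(2) by (intro DERIV_local_max[of _ _ t "min r t"]) auto
    then show ?thesis by simp
  qed
  ultimately show "(case z of (x, t) \<Rightarrow> \<lambda>(q, s). s + hamiltonian x q) (D\<phi> z) \<le> 0"
    by (simp add: xt D\<psi>_def split: prod.split) (metis fst_conv snd_conv add.commute diff_le_0_iff_le uminus_add_conv_diff)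
qed

text \<open>One period along a line of direction \<open>i\<close>, either way, takes any time above
  \<open>\<delta>\<close>. The periodic \<open>v\<close> returns to its value, so monotonicity along
  the path leaves only the change of \<open>p \<bullet> x - c * t\<close>.\<close>

lemma cell_constant_ge:
  assumes sol: "cell_problem_solution hamiltonian p c v"
  shows "infnorm p / \<delta> \<le> c"
proof -
  have v: "continuous_on UNIV v" "periodic v" "viscosity_subsolution UNIV (\<lambda>y q. hamiltonian y (p + q) - c) v"
    using sol by (auto simp: cell_problem_solution_def viscosity_solution_def)
  define w where "w = (\<lambda>(x, t). p \<bullet> x + v x - c * t)"
  have w_cont: "continuous_on (UNIV \<times> {0..}) w"
    unfolding w_def case_prod_unfold
    by (intro continuous_intros continuous_on_compose2[OF v(1)]) auto
  have comp: "r * p $ i \<le> c * T" if r: "r = 1 \<or> r = -1" and T: "\<delta> < T" for r i T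
  proof -
    define y :: "real ^ 3" where "y = line_base i"
    have "w (1 *\<^sub>R (y + r *\<^sub>R axis i 1), 0 + T) \<le> w (1 *\<^sub>R y, 0)"
    proof (rule segment_step_strict[where m = \<delta>, OF w_cont])
      show "viscosity_subsolution (UNIV \<times> {0<..}) (\<lambda>(x, t) (q, s). s + 1 / a ((1 / 1) *\<^sub>R x) * norm q) w"
        using cell_subsolution_imp_Cauchy[OF v(3)] unfolding w_def by simp
      show "a (y + s *\<^sub>R (y + r *\<^sub>R axis i 1 - y)) \<le> \<delta>" for s
      proof -
        have "y + s *\<^sub>R (y + r *\<^sub>R axis i 1 - y) \<in> line_family i"
          by (auto simp: y_def line_family_def axis_def)
        then show ?thesis by (simp add: a_line_family)
      qed
    qed (use r T in auto)
    moreover have "v (y + r *\<^sub>R axis i 1) = v y"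
    proof -
      have "r *\<^sub>R axis i 1 \<in> (integer_lattice :: (real ^ 3) set)"
        using r by (auto simp: integer_lattice_def axis_def)
      then show ?thesis using v(2) by (simp add: periodic_def)
    qed
    ultimately show ?thesis by (simp add: w_def inner_add_right inner_axis)
  qed
  have comp': "r * p $ i \<le> c * \<delta>" if "r = 1 \<or> r = -1" for r i
  proof (rule field_le_epsilon)
    fix e :: real assume e: "0 < e"
    define T where "T = \<delta> + e / (\<bar>c\<bar> + 1)"
    have "0 < e / (\<bar>c\<bar> + 1)" using e by (intro divide_pos_pos) auto
    then have "r * p $ i \<le> c * T" by (intro comp[OF that]) (simp add: T_def)
    also have "c * T \<le> c * \<delta> + e"
    proof -
      have "c * (e / (\<bar>c\<bar> + 1)) \<le> (\<bar>c\<bar> + 1) * (e / (\<bar>c\<bar> + 1))"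
        using e by (intro mult_right_mono) auto
      then show ?thesis by (simp add: T_def distrib_left)
    qed
    finally show "r * p $ i \<le> c * \<delta> + e" .
  qed
  have "infnorm p \<le> c * \<delta>"
    by (rule infnorm_le_cart) (use comp'[of 1] comp'[of "-1"] in \<open>auto simp: abs_le_iff\<close>)
  then show ?thesis using \<delta> by (simp add: field_simps)
qed

end

section \<open>Existence of a corrector\<close>

context line_medium begin

text \<open>Perron's method with the smooth subsolution as an obstacle on the lines in a direction \<open>i\<close> that
  maximises \<open>\<bar>p\<^sub>i\<bar>\<close>. No bump can be added on these lines, but there the derivative \<open>p\<^sub>i\<close> along the line
  already gives the supersolution property.\<close>

definition perron_family :: "real ^ 3 \<Rightarrow> 3 \<Rightarrow> (real ^ 3 \<Rightarrow> real) set" where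
  "perron_family p i = {f. (\<forall>x. slope_le f x (infnorm p / \<delta> * a x)) \<and>
     (\<forall>y\<in>line_family i. f y \<le> calibration p y)}"

definition perron :: "real ^ 3 \<Rightarrow> 3 \<Rightarrow> real ^ 3 \<Rightarrow> real" where
  "perron p i x = (SUP f\<in>perron_family p i. f x)"

lemma calibration_perron_family: "calibration p \<in> perron_family p i"
  unfolding perron_family_def using slope_le_GDERIV[OF GDERIV_calibration calibration_grad_le] by simp

text \<open>The obstacle caps every member at the single point \<open>line_base i\<close>, and the
  uniform slope bound spreads the cap along segments.\<close>

lemma perron_family_bdd: "bdd_above ((\<lambda>f. f x) ` perron_family p i)"
proof (rule bdd_aboveI2)
  fix f assume f: "f \<in> perron_family p i"
  have M: "0 \<le> infnorm p / \<delta>" using \<delta> infnorm_pos_le[of p] by simp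
  have base: "line_base i \<in> line_family i" by (simp add: line_family_def)
  have "\<bar>f x - f (line_base i)\<bar> \<le> infnorm p / \<delta> * (1 + \<delta>) * norm (x - line_base i)"
  proof (rule slope_le_segment)
    fix y
    have "slope_le f y (infnorm p / \<delta> * a y)" using f by (simp add: perron_family_def)
    moreover have "infnorm p / \<delta> * a y \<le> infnorm p / \<delta> * (1 + \<delta>)" using M a_le by (intro mult_left_mono)
    ultimately show "slope_le f y (infnorm p / \<delta> * (1 + \<delta>))" by (rule slope_le_mono)
  qed
  moreover have "f (line_base i) \<le> calibration p (line_base i)" using f base by (simp add: perron_family_def)
  ultimately show "f x \<le> calibration p (line_base i) + infnorm p / \<delta> * (1 + \<delta>) * norm (x - line_base i)"
    by linarith
qed

lemma le_perron: "f \<in> perron_family p i \<Longrightarrow> f x \<le> perron p i x"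
  unfolding perron_def by (rule cSUP_upper[OF _ perron_family_bdd])

lemma slope_le_perron: "slope_le (perron p i) x (infnorm p / \<delta> * a x)"
  unfolding perron_def[abs_def]
proof (rule slope_le_SUP[where b = "\<lambda>x. infnorm p / \<delta> * a x"])
  show "slope_le f y (infnorm p / \<delta> * a y)" if "f \<in> perron_family p i" for f y
    using that by (simp add: perron_family_def)
  show "continuous_on UNIV (\<lambda>x. infnorm p / \<delta> * a x)" using a_cont by (intro continuous_intros)
  show "perron_family p i \<noteq> {}" using calibration_perron_family by blast
qed (rule perron_family_bdd)

lemma perron_on_lines:
  assumes "y \<in> line_family i"
  shows "perron p i y = calibration p y"
proof (rule antisym)
  show "perron p i y \<le> calibration p y"
    unfolding perron_def
  proof (rule cSUP_least)
    show "perron_family p i \<noteq> {}" using calibration_perron_family by blast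
  qed (use assms in \<open>simp add: perron_family_def\<close>)
  show "calibration p y \<le> perron p i y" by (rule le_perron[OF calibration_perron_family])
qed

text \<open>The Perron function shifted by \<open>z\<close> and raised by
  \<open>p \<bullet> z\<close> belongs to the family again, since \<open>a\<close> is periodic and
  the obstacle obeys the same shift law; maximality gives the inequality.\<close>

lemma perron_translation_le:
  assumes z: "z \<in> integer_lattice"
  shows "perron p i x + p \<bullet> z \<le> perron p i (x + z)"
proof -
  define f where "f = (\<lambda>y. perron p i (y - z) + p \<bullet> z)"
  have mz: "- z \<in> integer_lattice" using z by (rule uminus_integer_lattice)
  have "f \<in> perron_family p i"
    unfolding perron_family_def
  proof (intro CollectI conjI allI ballI)
    fix y
    have "a (y - z) = a y" using a_periodic mz by (metis periodic_def diff_conv_add_uminus)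
    then show "slope_le f y (infnorm p / \<delta> * a y)"
      unfolding f_def using slope_le_translation[OF slope_le_perron[of p i "y - z"]] by simp
  next
    fix y assume y: "y \<in> line_family i"
    then have "y - z \<in> line_family i" using line_family_translation[OF y mz] by simp
    then have "f y = calibration p (y + - z) + p \<bullet> z" by (simp add: f_def perron_on_lines)
    also have "\<dots> = calibration p y" by (simp add: calibration_periodic[OF mz] inner_minus_right del: add_uminus_conv_diff)
    finally show "f y \<le> calibration p y" by simp
  qed
  from le_perron[OF this, of "x + z"] show ?thesis by (simp add: f_def)
qed

lemma perron_translation:
  assumes "z \<in> integer_lattice"
  shows "perron p i (x + z) = perron p i x + p \<bullet> z"
  using perron_translation_le[OF assms, of p i x]
    perron_translation_le[OF uminus_integer_lattice[OF assms], of p i "x + z"]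
  by simp

text \<open>A strict failure leaves room to raise the test function to a bump that still satisfies
  the slope bound but exceeds the Perron function at \<open>x\<close>. As
  \<open>line_family i\<close> is closed, the bump can avoid the obstacle.\<close>

lemma perron_supersolution_off_lines:
  assumes \<psi>: "C1_with_gradient UNIV \<psi> D\<psi>"
    and touch: "\<forall>\<^sub>F y in at x. perron p i y - \<psi> y \<ge> perron p i x - \<psi> x"
    and x: "x \<notin> line_family i"
  shows "infnorm p / \<delta> * a x \<le> norm (D\<psi> x)"
proof (rule ccontr)
  assume neg: "\<not> ?thesis"
  let ?c = "infnorm p / \<delta>" and ?\<phi> = "perron p i"
  \<comment> \<open>A quarter of the gap; three quarters absorb the variation of
    \<open>D\<psi>\<close>, the gradient of the bump and the variation of \<open>a\<close>.\<close>
  define e where "e = (?c * a x - norm (D\<psi> x)) / 4"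
  have e: "0 < e" using neg by (simp add: e_def)
  have D\<psi>_cont: "isCont D\<psi> x" using \<psi> by (simp add: C1_with_gradient_def continuous_on_eq_continuous_at)
  have "isCont (\<lambda>y. ?c * a y) x"
    using a_cont by (intro continuous_intros) (simp add: continuous_on_eq_continuous_at)
  then obtain r1 where r1: "r1 > 0" "\<And>y. dist y x < r1 \<Longrightarrow> dist (?c * a y) (?c * a x) < e"
    unfolding continuous_at_eps_delta using e by metis
  obtain r2 where r2: "r2 > 0" "\<And>y. dist y x < r2 \<Longrightarrow> dist (D\<psi> y) (D\<psi> x) < e"
    using D\<psi>_cont unfolding continuous_at_eps_delta using e by metis
  obtain r3 where r3: "r3 > 0" "\<And>y. y \<noteq> x \<Longrightarrow> dist y x < r3 \<Longrightarrow> ?\<phi> y - \<psi> y \<ge> ?\<phi> x - \<psi> x"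
    using touch unfolding eventually_at by auto
  have "open (- line_family i)" using closed_line_family by (simp add: open_Compl)
  then obtain r4 where r4: "r4 > 0" "ball x r4 \<subseteq> - line_family i"
    using x by (metis ComplI openE)
  define \<rho> where "\<rho> = min (min r1 r2) (min r3 r4)"
  have \<rho>: "0 < \<rho>" "\<rho> \<le> r1" "\<rho> \<le> r2" "\<rho> \<le> r3" "\<rho> \<le> r4" using r1 r2 r3 r4 by (auto simp: \<rho>_def)
  define \<kappa> where "\<kappa> = e / (2 * \<rho>)"
  have \<kappa>: "0 < \<kappa>" using e \<rho> by (simp add: \<kappa>_def)
  \<comment> \<open>The test function lifted to the Perron value at \<open>x\<close> plus a
    paraboloid that is positive within \<open>\<rho> / 2\<close> and negative beyond;
    \<open>2 * \<kappa> * \<rho> = e\<close> limits its gradient.\<close>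
  define \<beta> where "\<beta> = (\<lambda>y. \<psi> y + (?\<phi> x - \<psi> x) + \<kappa> * (\<rho>\<^sup>2 / 4 - (y - x) \<bullet> (y - x)))"
  have \<beta>_deriv: "GDERIV \<beta> y :> D\<psi> y - (2 * \<kappa>) *\<^sub>R (y - x)" for y
  proof -
    have "(\<psi> has_derivative (\<lambda>h. h \<bullet> D\<psi> y)) (at y)" using \<psi> by (simp add: C1_with_gradient_def gderiv_def)
    then show ?thesis
      unfolding gderiv_def \<beta>_def
      by (auto intro!: derivative_eq_intros simp: algebra_simps inner_commute)
  qed
  have \<beta>_slope: "slope_le \<beta> y (?c * a y)" if y: "norm (y - x) < \<rho>" for y
  proof (rule slope_le_GDERIV[OF \<beta>_deriv])
    have "norm (D\<psi> y) < norm (D\<psi> x) + e"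
      using r2(2)[of y] y \<rho> norm_triangle_sub[of "D\<psi> y" "D\<psi> x"] by (simp add: dist_norm)
    moreover have "2 * \<kappa> * norm (y - x) \<le> e"
    proof -
      have "2 * \<kappa> * norm (y - x) \<le> 2 * \<kappa> * \<rho>" using y \<kappa> by (intro mult_left_mono) auto
      then show ?thesis using \<rho> by (simp add: \<kappa>_def)
    qed
    moreover have "?c * a x - e < ?c * a y"
      using r1(2)[of y] y \<rho> by (simp add: dist_norm abs_less_iff)
    moreover have "norm (D\<psi> y - (2 * \<kappa>) *\<^sub>R (y - x)) \<le> norm (D\<psi> y) + 2 * \<kappa> * norm (y - x)"
      using norm_triangle_ineq4[of "D\<psi> y" "(2 * \<kappa>) *\<^sub>R (y - x)"] \<kappa> by simp
    moreover have "norm (D\<psi> x) + 4 * e = ?c * a x"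
    proof -
      have "4 * (r / 4) = r" for r :: real by simp
      from this[of "?c * a x - norm (D\<psi> x)"] show ?thesis unfolding e_def by linarith
    qed
    ultimately show "norm (D\<psi> y - (2 * \<kappa>) *\<^sub>R (y - x)) \<le> ?c * a y" using e by linarith
  qed
  have \<beta>_less: "\<beta> y < ?\<phi> y" if y: "norm (y - x) < \<rho>" "\<rho> / 2 < norm (y - x)" for y
  proof -
    have "y \<noteq> x" using y \<rho> by auto
    then have "?\<phi> x - \<psi> x \<le> ?\<phi> y - \<psi> y" using y \<rho> by (intro r3(2)) (auto simp: dist_norm)
    moreover have "(\<rho> / 2)\<^sup>2 < (norm (y - x))\<^sup>2" using y \<rho> by (intro power_strict_mono) auto
    then have "\<rho>\<^sup>2 / 4 - (y - x) \<bullet> (y - x) < 0" by (simp add: power2_norm_eq_inner power_divide)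
    then have "\<kappa> * (\<rho>\<^sup>2 / 4 - (y - x) \<bullet> (y - x)) < 0" using \<kappa> by (simp add: mult_pos_neg)
    ultimately show ?thesis unfolding \<beta>_def by linarith
  qed
  \<comment> \<open>Since \<open>\<beta>\<close> is below the Perron function between radii
    \<open>\<rho> / 2\<close> and \<open>\<rho>\<close>, the two pieces agree near the gluing
    sphere.\<close>
  define f where "f = (\<lambda>y. if norm (y - x) < \<rho> then max (?\<phi> y) (\<beta> y) else ?\<phi> y)"
  have "f \<in> perron_family p i"
    unfolding perron_family_def
  proof (intro CollectI conjI allI ballI)
    fix y
    show "slope_le f y (?c * a y)"
    proof (cases "norm (y - x) < \<rho>")
      case True
      have "slope_le (\<lambda>y. max (?\<phi> y) (\<beta> y)) y (?c * a y)"
        by (rule slope_le_max[OF slope_le_perron \<beta>_slope[OF True]])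
      moreover have "0 < \<rho> - norm (y - x)" using True by simp
      moreover have "f u = max (?\<phi> u) (\<beta> u)" if "norm (u - y) < \<rho> - norm (y - x)" for u
        using that norm_triangle_ineq[of "u - y" "y - x"] by (simp add: f_def)
      ultimately show ?thesis by (rule slope_le_local)
    next
      case False
      show ?thesis
      proof (rule slope_le_local[OF slope_le_perron])
        show "0 < \<rho> / 2" using \<rho> by simp
        fix u assume "norm (u - y) < \<rho> / 2"
        then have "\<rho> / 2 < norm (u - x)"
          using False norm_triangle_ineq[of "y - u" "u - x"] by (simp add: norm_minus_commute)
        then show "f u = ?\<phi> u" using \<beta>_less[of u] by (simp add: f_def)
      qed
    qed
  next
    fix y assume y: "y \<in> line_family i"
    have "\<not> norm (y - x) < \<rho>"
    proof
      assume "norm (y - x) < \<rho>"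
      then have "y \<in> ball x r4" using \<rho> by (simp add: dist_norm norm_minus_commute)
      then show False using r4(2) y by blast
    qed
    then show "f y \<le> calibration p y" using y by (simp add: f_def perron_on_lines)
  qed
  from le_perron[OF this, of x] have "\<beta> x \<le> ?\<phi> x" using \<rho> by (simp add: f_def)
  moreover have "0 < \<kappa> * (\<rho>\<^sup>2 / 4)" using \<kappa> \<rho> by simp
  ultimately show False by (simp add: \<beta>_def)
qed

lemma perron_supersolution_on_lines:
  assumes i: "infnorm p = \<bar>p $ i\<bar>"
    and \<psi>: "GDERIV \<psi> x :> d"
    and touch: "\<forall>\<^sub>F y in at x. perron p i y - \<psi> y \<ge> perron p i x - \<psi> x"
    and x: "x \<in> line_family i"
  shows "infnorm p / \<delta> * a x \<le> norm d"
proof -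
  have line: "x + s *\<^sub>R axis i 1 \<in> line_family i" for s
    using x by (auto simp: line_family_def axis_def)
  have curve: "((\<lambda>s. x + s *\<^sub>R axis i 1) has_derivative (\<lambda>h. h *\<^sub>R axis i 1)) (at (0::real))"
    by (auto intro!: derivative_eq_intros)
  have along: "((\<lambda>s. f (x + s *\<^sub>R axis i 1)) has_real_derivative D $ i) (at 0)"
    if "GDERIV f x :> D" for f D
  proof -
    have "(f has_derivative (\<lambda>h. h \<bullet> D)) (at (x + 0 *\<^sub>R axis i 1))" using that by (simp add: gderiv_def)
    from has_derivative_compose[where g = f, OF curve this]
    show ?thesis
      by (simp add: has_field_derivative_def inner_axis' mult_commute_abs)
  qed
  \<comment> \<open>On the line the Perron function may be replaced by the differentiable
    \<open>calibration p\<close>, so touching from below becomes a critical point of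
    \<open>F\<close> at 0.\<close>
  define F where "F = (\<lambda>s. calibration p (x + s *\<^sub>R axis i 1) - \<psi> (x + s *\<^sub>R axis i 1))"
  have F: "(F has_real_derivative (calibration_grad p x $ i - d $ i)) (at 0)"
    unfolding F_def by (rule DERIV_diff[OF along[OF GDERIV_calibration] along[OF \<psi>]])
  obtain r where r: "r > 0" "\<And>y. y \<noteq> x \<Longrightarrow> dist y x < r \<Longrightarrow> perron p i y - \<psi> y \<ge> perron p i x - \<psi> x"
    using touch unfolding eventually_at by auto
  have "\<forall>s. \<bar>0 - s\<bar> < r \<longrightarrow> F 0 \<le> F s"
  proof (intro allI impI)
    fix s :: real assume s: "\<bar>0 - s\<bar> < r"
    show "F 0 \<le> F s"
    proof (cases "s = 0")
      case False
      then have "perron p i (x + s *\<^sub>R axis i 1) - \<psi> (x + s *\<^sub>R axis i 1) \<ge> perron p i x - \<psi> x"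
        using s by (intro r(2)) (auto simp: dist_norm axis_eq_0_iff)
      then show ?thesis using perron_on_lines[OF line] perron_on_lines[OF x] by (simp add: F_def)
    qed simp
  qed
  with F r(1) have "calibration_grad p x $ i - d $ i = 0" by (rule DERIV_local_min)
  then have "d $ i = p $ i" using calibration_grad_line_family[OF x, of p] by simp
  then have "infnorm p \<le> norm d" using i component_le_norm_cart[of d i] by simp
  then show ?thesis using a_line_family[OF x] \<delta> by simp
qed

lemma cell_problem_solution_exists: "\<exists>v. cell_problem_solution hamiltonian p (infnorm p / \<delta>) v"
proof -
  obtain i where i: "infnorm p = \<bar>p $ i\<bar>" using infnorm_attained_cart by blast
  let ?c = "infnorm p / \<delta>"
  have c: "0 \<le> ?c" using \<delta> infnorm_pos_le[of p] by simp
  define v where "v = (\<lambda>x. perron p i x - p \<bullet> x)"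
  have add_linear: "GDERIV (\<lambda>y. \<phi> y + p \<bullet> y) y :> p + D\<phi> y"
    if "C1_with_gradient UNIV \<phi> D\<phi>" for \<phi> D\<phi> y
  proof -
    have "GDERIV \<phi> y :> D\<phi> y" using that by (simp add: C1_with_gradient_def)
    moreover have "GDERIV (\<lambda>x. p \<bullet> x) y :> p"
      unfolding gderiv_def by (auto intro!: derivative_eq_intros simp: inner_commute)
    ultimately show ?thesis using GDERIV_add by (metis add.commute)
  qed
  have "periodic v"
    by (simp add: periodic_def v_def perron_translation inner_add_right)
  moreover have "continuous_on UNIV v"
    unfolding v_def using slope_le_isCont[OF slope_le_perron]
    by (intro continuous_intros) (simp add: continuous_at_imp_continuous_on)
  moreover have "viscosity_subsolution UNIV (\<lambda>y q. hamiltonian y (p + q) - ?c) v"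
    unfolding viscosity_subsolution_def
  proof (intro allI ballI impI)
    fix \<phi> D\<phi> and x :: "real ^ 3"
    assume C1: "C1_with_gradient UNIV \<phi> D\<phi>"
      and max: "\<forall>\<^sub>F y in at x within UNIV. v y - \<phi> y \<le> v x - \<phi> x"
    have "norm (p + D\<phi> x) \<le> ?c * a x"
    proof (rule slope_le_imp_gradient_le[OF slope_le_perron _ add_linear[OF C1]])
      show "0 \<le> ?c * a x" by (rule mult_nonneg_nonneg[OF c less_imp_le[OF a_pos]])
      show "\<forall>\<^sub>F y in at x. perron p i y - (\<phi> y + p \<bullet> y) \<le> perron p i x - (\<phi> x + p \<bullet> x)"
        using max by eventually_elim (simp add: v_def)
    qed
    then show "hamiltonian x (p + D\<phi> x) - ?c \<le> 0" using a_pos[of x] by (simp add: field_simps)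
  qed
  moreover have "viscosity_supersolution UNIV (\<lambda>y q. hamiltonian y (p + q) - ?c) v"
    unfolding viscosity_supersolution_def
  proof (intro allI ballI impI)
    fix \<phi> D\<phi> and x :: "real ^ 3"
    assume C1: "C1_with_gradient UNIV \<phi> D\<phi>"
      and "\<forall>\<^sub>F y in at x within UNIV. v y - \<phi> y \<ge> v x - \<phi> x"
    then have touch: "\<forall>\<^sub>F y in at x. perron p i y - (\<phi> y + p \<bullet> y) \<ge> perron p i x - (\<phi> x + p \<bullet> x)"
      by (elim eventually_mono) (simp add: v_def)
    have C1': "C1_with_gradient UNIV (\<lambda>y. \<phi> y + p \<bullet> y) (\<lambda>y. p + D\<phi> y)"
      using C1 add_linear[OF C1] unfolding C1_with_gradient_def by (auto intro!: continuous_intros)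
    have "?c * a x \<le> norm (p + D\<phi> x)"
    proof (cases "x \<in> line_family i")
      case True
      then show ?thesis by (rule perron_supersolution_on_lines[OF i add_linear[OF C1] touch])
    next
      case False
      then show ?thesis by (rule perron_supersolution_off_lines[OF C1' touch])
    qed
    then show "hamiltonian x (p + D\<phi> x) - ?c \<ge> 0" using a_pos[of x] by (simp add: field_simps)
  qed
  ultimately show ?thesis unfolding cell_problem_solution_def viscosity_solution_def by blast
qed

text \<open>The two bounds on the cell constant give uniqueness and the Perron function gives
  existence, so the definite description denotes this value.\<close>

lemma effective_hamiltonian_eq: "effective_hamiltonian hamiltonian p = infnorm p / \<delta>"
  unfolding effective_hamiltonian_def
proof (rule the_equality)
  show "\<exists>v. cell_problem_solution hamiltonian p (infnorm p / \<delta>) v" by (rule cell_problem_solution_exists)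
  show "c = infnorm p / \<delta>" if "\<exists>v. cell_problem_solution hamiltonian p c v" for c
    using that cell_constant_le cell_constant_ge by (metis antisym)
qed

text \<open>Both solutions are compared with the infimum \<open>m\<close> of \<open>g\<close> over
  an \<open>l1_norm\<close> ball of radius \<open>t / \<delta>\<close>: each is at least
  \<open>m - 9/2 * (L + 1) * \<epsilon>\<close>, while \<open>u\<close> is at most \<open>m\<close>
  and \<open>w\<close> at most \<open>m + 24 * L / \<delta> * \<epsilon>\<close>.\<close>

lemma homogenization_rate:
  assumes g: "bounded (range g)" and L: "0 \<le> L" "\<And>x y. \<bar>g x - g y\<bar> \<le> L * norm (x - y)"
    and u: "Cauchy_viscosity_solution (\<lambda>x. effective_hamiltonian hamiltonian) g u"
    and w: "Cauchy_viscosity_solution (\<lambda>x. hamiltonian ((1 / \<epsilon>) *\<^sub>R x)) g w"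
    and \<epsilon>: "0 < \<epsilon>" and t: "0 \<le> t"
  shows "\<bar>w (x, t) - u (x, t)\<bar> \<le> (9/2 * (L + 1) + 24 * L / \<delta>) * \<epsilon>"
proof -
  have u': "Cauchy_viscosity_solution (\<lambda>x q. infnorm q / \<delta>) g u"
    using u unfolding effective_hamiltonian_eq .
  define P where "P = {y. \<delta> * l1_norm (y - x) \<le> t}"
  define m where "m = Inf (g ` P)"
  have xP: "x \<in> P" using t by (simp add: P_def l1_norm_def)
  have bdd: "bdd_below (g ` P)"
    using g by (meson bounded_imp_bdd_below bounded_subset image_mono top_greatest)
  have m_le: "m \<le> g y" if "\<delta> * l1_norm (y - x) \<le> t" for y
    unfolding m_def by (rule cINF_lower[OF bdd]) (use that in \<open>simp add: P_def\<close>)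
  have le_m: "r \<le> m" if "\<And>y. \<delta> * l1_norm (y - x) \<le> t \<Longrightarrow> r \<le> g y" for r
    unfolding m_def
  proof (rule cINF_greatest)
    show "P \<noteq> {}" using xP by blast
  qed (use that in \<open>simp add: P_def\<close>)
  have "u (x, t) \<le> m"
    by (rule le_m) (rule upper_bound_infnorm[OF u' \<delta>(1)])
  \<comment> \<open>For the effective equation the coordinates are unperturbed and
    \<open>\<epsilon>\<close> is only the width of the smoothing.\<close>
  moreover have "m - 3/2 * CARD(3) * (L + 1) * \<epsilon> \<le> u (x, t)"
  proof (rule lower_bound[OF u' g L GDERIV_component _ _ \<delta>(1) \<epsilon> _ t m_le])
    fix y s and c :: real assume s: "\<And>i::3. \<bar>s i\<bar> \<le> \<delta>" and c: "0 \<le> c"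
    have "infnorm (\<Sum>i\<in>UNIV. s i *\<^sub>R axis i 1 :: real ^ 3) \<le> \<delta>"
    proof (rule infnorm_le_cart)
      fix j
      have "(\<Sum>i\<in>UNIV. s i *\<^sub>R axis i 1 :: real ^ 3) $ j = (\<Sum>i\<in>UNIV. (s i *\<^sub>R axis i 1 :: real ^ 3) $ j)"
        by (rule sum_component)
      also have "\<dots> = (\<Sum>i\<in>UNIV. if i = j then s j else 0)"
        by (rule sum.cong) (auto simp: axis_def)
      finally have "(\<Sum>i\<in>UNIV. s i *\<^sub>R axis i 1 :: real ^ 3) $ j = s j" by simp
      then show "\<bar>(\<Sum>i\<in>UNIV. s i *\<^sub>R axis i 1 :: real ^ 3) $ j\<bar> \<le> \<delta>" using s by simp
    qed
    then have "c * infnorm (\<Sum>i\<in>UNIV. s i *\<^sub>R axis i 1 :: real ^ 3) \<le> c * \<delta>"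
      using c by (rule mult_left_mono)
    then show "infnorm (- (c *\<^sub>R (\<Sum>i\<in>UNIV. s i *\<^sub>R axis i 1 :: real ^ 3))) / \<delta> \<le> c"
      using \<delta> c by (simp add: infnorm_neg infnorm_mul field_simps)
  qed auto
  moreover have "m - 3/2 * CARD(3) * (L + 1) * \<epsilon> \<le> w (x, t)"
  proof (rule lower_bound[OF w g L GDERIV_flat_coord continuous_flat_coord_grad flat_coord_near \<delta>(1) \<epsilon> _ t m_le])
    fix y s and c :: real assume s: "\<And>i::3. \<bar>s i\<bar> \<le> \<delta>" and c: "0 \<le> c"
    define A where "A = a ((1 / \<epsilon>) *\<^sub>R y)"
    have "norm (\<Sum>i\<in>UNIV. s i *\<^sub>R flat_coord_grad i ((1 / \<epsilon>) *\<^sub>R y)) \<le> A"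
      using flat_coord_combination_bound[of s \<delta>, OF s] \<delta> by (simp add: A_def)
    then have "c * norm (\<Sum>i\<in>UNIV. s i *\<^sub>R flat_coord_grad i ((1 / \<epsilon>) *\<^sub>R y)) \<le> c * A"
      using c by (rule mult_left_mono)
    moreover have "0 < A" by (simp add: A_def a_pos)
    ultimately show "hamiltonian ((1 / \<epsilon>) *\<^sub>R y)
        (- (c *\<^sub>R (\<Sum>i\<in>UNIV. s i *\<^sub>R flat_coord_grad i ((1 / \<epsilon>) *\<^sub>R y)))) \<le> c"
      using c unfolding A_def[symmetric] by (simp add: field_simps)
  qed
  moreover have "w (x, t) - 24 * L / \<delta> * \<epsilon> \<le> m"
  proof (rule le_m)
    fix y assume y: "\<delta> * l1_norm (y - x) \<le> t"
    show "w (x, t) - 24 * L / \<delta> * \<epsilon> \<le> g y"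
    proof (cases "24 * \<epsilon> \<le> t")
      case True
      then have t0: "0 < t" using \<epsilon> by linarith
      \<comment> \<open>Pulling \<open>y\<close> towards \<open>x\<close> by this fraction frees the
        time \<open>24 * \<epsilon>\<close> that the jumps consume, at the price of a displacement
        \<open>24 * \<epsilon> / \<delta>\<close>.\<close>
      define \<theta> where "\<theta> = 24 * \<epsilon> / t"
      have \<theta>: "0 \<le> \<theta>" "\<theta> \<le> 1" using True t0 \<epsilon> by (auto simp: \<theta>_def)
      define y' where "y' = x + (1 - \<theta>) *\<^sub>R (y - x)"
      have "\<delta> * l1_norm (y' - x) = (1 - \<theta>) * (\<delta> * l1_norm (y - x))"
        using \<theta> by (simp add: y'_def l1_norm_scaleR)
      also have "\<dots> \<le> (1 - \<theta>) * t" using \<theta> y by (intro mult_left_mono) auto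
      also have "\<dots> = t - 24 * \<epsilon>" using t0 by (simp add: \<theta>_def field_simps)
      finally have w_le: "w (x, t) \<le> g y'" by (intro upper_bound_oscillating[OF w \<epsilon>]) simp
      have "y' - y = \<theta> *\<^sub>R (x - y)" by (simp add: y'_def algebra_simps)
      then have "\<delta> * norm (y' - y) \<le> \<theta> * (\<delta> * l1_norm (y - x))"
        using norm_le_l1_norm[of "x - y"] \<theta> \<delta> by (simp add: l1_norm_minus_commute[of y x] mult_left_mono)
      also have "\<dots> \<le> \<theta> * t" using \<theta> y by (intro mult_left_mono) auto
      also have "\<dots> = 24 * \<epsilon>" using t0 by (simp add: \<theta>_def)
      finally have "norm (y' - y) \<le> 24 * \<epsilon> / \<delta>" using \<delta> by (simp add: field_simps)
      then have "L * norm (y' - y) \<le> L * (24 * \<epsilon> / \<delta>)" using L by (intro mult_left_mono)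
      then show ?thesis using w_le L(2)[of y' y] by simp
    next
      case False
      \<comment> \<open>Too little time for the jumps: a segment of length 0 shows that waiting at
        \<open>x\<close> is allowed, and every competitor \<open>y\<close> is within
        \<open>24 * \<epsilon> / \<delta>\<close>.\<close>
      have "w (x, t) \<le> g x"
      proof -
        have "w (\<epsilon> *\<^sub>R ((1 / \<epsilon>) *\<^sub>R x), 0 + t) \<le> w (\<epsilon> *\<^sub>R ((1 / \<epsilon>) *\<^sub>R x), 0)"
          by (rule segment_step[OF w \<epsilon>, where m = "1 + \<delta>"]) (use t a_le in auto)
        then show ?thesis using \<epsilon> w by (simp add: Cauchy_viscosity_solution_def)
      qed
      moreover have "norm (x - y) \<le> 24 * \<epsilon> / \<delta>"
      proof -
        have "\<delta> * norm (x - y) \<le> \<delta> * l1_norm (y - x)"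
          unfolding l1_norm_minus_commute[of y x]
          by (rule mult_left_mono[OF norm_le_l1_norm less_imp_le[OF \<delta>(1)]])
        with y False have "\<delta> * norm (x - y) \<le> 24 * \<epsilon>" by linarith
        then show ?thesis using \<delta>(1) by (simp add: pos_le_divide_eq mult.commute)
      qed
      then have "L * norm (x - y) \<le> L * (24 * \<epsilon> / \<delta>)" using L by (intro mult_left_mono)
      ultimately show ?thesis using L(2)[of x y] by simp
    qed
  qed
  moreover have "(9/2 * (L + 1) + 24 * L / \<delta>) * \<epsilon> = 3/2 * CARD(3) * (L + 1) * \<epsilon> + 24 * L / \<delta> * \<epsilon>"
    by (simp add: distrib_right)
  moreover have "0 \<le> 24 * L / \<delta> * \<epsilon>" "0 \<le> 3/2 * CARD(3) * (L + 1) * \<epsilon>" using L \<delta> \<epsilon> by auto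
  ultimately show ?thesis by linarith
qed

end

theorem theorem2p6:
  fixes \<delta> :: real
    and a :: "real ^ 3 \<Rightarrow> real"
    and H :: "real ^ 3 \<Rightarrow> real ^ 3 \<Rightarrow> real"
  assumes delta: "0 < \<delta>" "\<delta> < 1 / 10 ^ 2"
    and a_range: "\<forall>y. a y \<in> {\<delta>..1 + \<delta>}"
    and a_smooth: "smooth a"
    and a_periodic: "periodic a"
    and a_outside: "\<forall>y. y \<notin> neighborhood \<delta> lines \<longrightarrow> a y \<ge> 1"
    and a_min: "\<delta> \<in> range a" "\<forall>y. \<delta> \<le> a y"
    and a_lines: "\<forall>y. a y = \<delta> \<longleftrightarrow> y \<in> lines"
    and H_def: "H = (\<lambda>y p. 1 / a y * norm p)"
  shows "\<forall>L::real. \<exists>C::real. \<forall>g :: real ^ 3 \<Rightarrow> real.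
           bounded (range g) \<and> (\<exists>K. K-lipschitz_on UNIV g) \<and> gradient_Linf_norm g = ereal L \<longrightarrow>
           (\<forall>u. Cauchy_viscosity_solution (\<lambda>x. effective_hamiltonian H) g u \<longrightarrow>
             (\<forall>\<epsilon>>0. \<forall>u\<epsilon>. Cauchy_viscosity_solution (\<lambda>x. H ((1 / \<epsilon>) *\<^sub>R x)) g u\<epsilon> \<longrightarrow>
               (\<forall>x. \<forall>t\<ge>0. \<bar>u\<epsilon> (x, t) - u (x, t)\<bar> \<le> C * \<epsilon>)))"
proof
  fix L :: real
  interpret line_medium \<delta> a
  proof
    have "C_k 0 a" using a_smooth unfolding smooth_def by blast
    then show "continuous_on UNIV a" by simp
  qed (use assms in auto)
  show "\<exists>C::real. \<forall>g :: real ^ 3 \<Rightarrow> real.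
      bounded (range g) \<and> (\<exists>K. K-lipschitz_on UNIV g) \<and> gradient_Linf_norm g = ereal L \<longrightarrow>
      (\<forall>u. Cauchy_viscosity_solution (\<lambda>x. effective_hamiltonian H) g u \<longrightarrow>
        (\<forall>\<epsilon>>0. \<forall>u\<epsilon>. Cauchy_viscosity_solution (\<lambda>x. H ((1 / \<epsilon>) *\<^sub>R x)) g u\<epsilon> \<longrightarrow>
          (\<forall>x. \<forall>t\<ge>0. \<bar>u\<epsilon> (x, t) - u (x, t)\<bar> \<le> C * \<epsilon>)))"
  \<comment> \<open>\<open>L\<close> ranges over all reals here, whereas
    \<open>homogenization_rate\<close> wants a nonnegative Lipschitz constant; hence the absolute
    values.\<close>
  proof (intro exI[of _ "9/2 * (\<bar>L\<bar> + 1) + 24 * \<bar>L\<bar> / \<delta>"] allI impI, elim conjE exE)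
    fix g :: "real ^ 3 \<Rightarrow> real" and u u\<epsilon> :: "(real ^ 3) \<times> real \<Rightarrow> real" and \<epsilon> t K :: real and x
    assume g: "bounded (range g)" "K-lipschitz_on UNIV g" "gradient_Linf_norm g = ereal L"
      and sol: "Cauchy_viscosity_solution (\<lambda>x. effective_hamiltonian H) g u"
        "Cauchy_viscosity_solution (\<lambda>x. H ((1 / \<epsilon>) *\<^sub>R x)) g u\<epsilon>"
      and "0 < \<epsilon>" "0 \<le> t"
    moreover have "\<bar>g x - g y\<bar> \<le> \<bar>L\<bar> * norm (x - y)" for x y
      using lipschitz_gradient_Linf_norm[OF g(2,3), of x y]
        mult_right_mono[OF abs_ge_self[of L] norm_ge_zero[of "x - y"]] by linarith
    ultimately show "\<bar>u\<epsilon> (x, t) - u (x, t)\<bar> \<le> (9/2 * (\<bar>L\<bar> + 1) + 24 * \<bar>L\<bar> / \<delta>) * \<epsilon>"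
      unfolding H_def by (intro homogenization_rate[where g = g]) simp_all
  qed
qed

end
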